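(* Let $n\ge 3$, let $\mathcal{A}$ be one of $F_n^{(+)}$, $H(F_n)$, $H(F_{2n},j)$, and let $\mathcal{J},\mathcal{J}'$ be proper subalgebras of $\mathcal{A}$ which are simple matrix Jordan algebras of the same type, with identity elements $e$ and $e'$ respectively. Then $\mathcal{J}'\in C(\mathcal{J})$ if and only if (1) $\mathrm{rk}(e)=\mathrm{rk}(e')$, and (2) $k_{\mathcal{A}}(\mathcal{J})=k_{\mathcal{A}}(\mathcal{J}')$ in the case when $\mathcal{J}\cong F_m^{(+)}$ or $\mathcal{J}\cong H(F_{2m},j)$ for some $m<n$ and $\mathcal{A}$ is $F_n^{(+)}$ or $H(F_{2n},j)$.
   Context: $F$ is an algebraically closed field of characteristic $\neq 2$. $F_k$ is the algebra of $k\times k$ matrices over $F$; $F_k^{(+)}$ is the Jordan algebra on $F_k$ with product $X\odot Y=\frac{XY+YX}{2}$; $H(F_k)$ is the Jordan subalgebra of symmetric matrices; $H(F_{2k},j)$ is the Jordan subalgebra of $F_{2k}^{(+)}$ of all matrices $\begin{pmatrix} A & B\\ C & A^t\end{pmatrix}$, $A\in F_k$ arbitrary, $B,C\in F_k$ skew-symmetric. A simple matrix Jordan algebra is one isomorphic to $F_m^{(+)}$, $H(F_m)$ or $H(F_{2m},j)$ with $m\ge3$; its type is which of these it is. Subalgebras need not contain the identity matrix; $\mathrm{rk}(e)$ is the rank of $e$ as a matrix. Subalgebras $\mathcal{J}_1,\mathcal{J}_2$ of $\mathcal{A}$ are equivalent if $\varphi(\mathcal{J}_1)=\mathcal{J}_2$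 for some Jordan automorphism $\varphi$ of $\mathcal{A}$, and $C(\mathcal{J})$ (the conjugate class of $\mathcal{J}$) is the set of subalgebras of $\mathcal{A}$ equivalent to $\mathcal{J}$. Every such $\mathcal{J}$ is equivalent to a canonical realization; the relevant ones here are: for $\mathcal{A}=F_n^{(+)}$ and type $F_m^{(+)}$: $\{\mathrm{diag}(X,\dots,X,X^t,\dots,X^t,0):X\in F_m\}$; for $\mathcal{A}=F_n^{(+)}$ and type $H(F_{2m},j)$: $\{\mathrm{diag}(X,\dots,X,0):X\in H(F_{2m},j)\}$; for $\mathcal{A}=H(F_{2n},j)$ and type $F_m^{(+)}$: $\{\mathrm{diag}(P,Q)\}$ with $P=\mathrm{diag}(X,\dots,X,X^t,\dots,X^t,0)$ ($k$ copies of $X$, $l$ of $X^t$) and $Q=\mathrm{diag}(X^t,\dots,X^t,X,\dots,X,0)$ ($k$ of $X^t$, $l$ of $X$), $P,Q$ of order $n$, $X\in F_m$; for $\mathcal{A}=H(F_{2n},j)$ and type $H(F_{2m},j)$: $\left\{\begin{pmatrix}A&B\\C&A^t\end{pmatrix}\right\}$ with $A=\mathrm{diag}\!\left(X,\dots,X,\begin{pmatrix}X&Y\\Z&X^t\end{pmatrix},\dots,\begin{pmatrix}X&Y\\Z&X^t\end{pmatrix}\right)$, $B=\mathrm{diag}(Y,\dots,Y,0)$, $C=\mathrm{diag}(Z,\dots,Z,0)$ (as many $Y$'s, $Z$'s as single $X$ blocks in $A$), $X\in F_m$ arbitrary, $Y,Z\in F_m$ skew-symmetric. The invariant $k_{\mathcal{A}}(\mathcal{J})$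 is $|l-k|$ where $l$ and $k$ are the numbers of diagonal blocks equal to $X$ and to $X^t$ respectively in the canonical form of $\mathcal{J}$, counted in the whole matrix when $\mathcal{A}=F_n^{(+)}$, and in the upper-left block of order $n$ (the block $A$ in the last case) when $\mathcal{A}=H(F_{2n},j)$. Equivalently, for $\mathcal{A}=F_n^{(+)}$ and $\mathcal{J}\cong F_m^{(+)}$: if the associative subalgebra $S(\mathcal{J})$ of $F_n$ generated by $\mathcal{J}$ is simple then $k_{\mathcal{A}}(\mathcal{J})=\mathrm{rk}(e)$, and if $S(\mathcal{J})=\mathcal{I}_1\oplus\mathcal{I}_2$ with simple ideals having identities $e_1,e_2$ then $k_{\mathcal{A}}(\mathcal{J})=|\mathrm{rk}(e_1)-\mathrm{rk}(e_2)|$.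
   Formalization: For A=H(F_2n,j) the number k_A(J) is not determined by J (equivalent canonical forms can have different |l-k|); there k_A(J) is read as an unspecified value depending only on the class of J. "Same type" includes the same m. *)

theory Defs
  imports "Jordan_Normal_Form.DL_Rank_Submatrix" "HOL-Computational_Algebra.Polynomial"
begin

definition alg_closed_field :: "'a::field itself \<Rightarrow> bool" where
  "alg_closed_field _ \<longleftrightarrow> (\<forall>p :: 'a poly. degree p \<ge> 1 \<longrightarrow> (\<exists>x. poly p x = 0))"

definition mrank :: "'a::field mat \<Rightarrow> nat" where
  "mrank A = vec_space.rank (dim_row A) A"

text \<open>Full: F_k^(+);  Sym: H(F_k);  Sympl: H(F_2k, j).\<close>
datatype jkind = Full | Sym | Sympl

definition skew :: "'a::field mat \<Rightarrow> bool" where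
  "skew B \<longleftrightarrow> transpose_mat B = - B"

fun alg :: "jkind \<Rightarrow> nat \<Rightarrow> 'a::field mat set" where
  "alg Full k = carrier_mat k k"
| "alg Sym k = {X \<in> carrier_mat k k. transpose_mat X = X}"
| "alg Sympl k = {M. \<exists>A B C. A \<in> carrier_mat k k \<and> B \<in> carrier_mat k k \<and> C \<in> carrier_mat k k
                      \<and> skew B \<and> skew C \<and> M = four_block_mat A B C (transpose_mat A)}"

definition jprod :: "'a::field mat \<Rightarrow> 'a mat \<Rightarrow> 'a mat" where
  "jprod X Y = (1/2) \<cdot>\<^sub>m (X * Y + Y * X)"

definition jsubalg :: "'a::field mat set \<Rightarrow> 'a mat set \<Rightarrow> bool" where
  "jsubalg S J \<longleftrightarrow> J \<subseteq> S \<and> J \<noteq> {}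
     \<and> (\<forall>X\<in>J. \<forall>Y\<in>J. X + Y \<in> J)
     \<and> (\<forall>c. \<forall>X\<in>J. c \<cdot>\<^sub>m X \<in> J)
     \<and> (\<forall>X\<in>J. \<forall>Y\<in>J. jprod X Y \<in> J)"

definition jiso :: "'a::field mat set \<Rightarrow> 'a mat set \<Rightarrow> ('a mat \<Rightarrow> 'a mat) \<Rightarrow> bool" where
  "jiso J1 J2 \<phi> \<longleftrightarrow> bij_betw \<phi> J1 J2
     \<and> (\<forall>X\<in>J1. \<forall>Y\<in>J1. \<phi> (X + Y) = \<phi> X + \<phi> Y)
     \<and> (\<forall>c. \<forall>X\<in>J1. \<phi> (c \<cdot>\<^sub>m X) = c \<cdot>\<^sub>m \<phi> X)
     \<and> (\<forall>X\<in>J1. \<forall>Y\<in>J1. \<phi> (jprod X Y) = jprod (\<phi> X) (\<phi> Y))"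

definition jisomorphic :: "'a::field mat set \<Rightarrow> 'a mat set \<Rightarrow> bool" where
  "jisomorphic J1 J2 \<longleftrightarrow> (\<exists>\<phi>. jiso J1 J2 \<phi>)"

definition jaut :: "'a::field mat set \<Rightarrow> ('a mat \<Rightarrow> 'a mat) \<Rightarrow> bool" where
  "jaut S \<phi> \<longleftrightarrow> jiso S S \<phi>"

definition conj_class :: "'a::field mat set \<Rightarrow> 'a mat set \<Rightarrow> 'a mat set set" where
  "conj_class S J = {J'. jsubalg S J' \<and> (\<exists>\<phi>. jaut S \<phi> \<and> \<phi> ` J = J')}"

definition is_jid :: "'a::field mat set \<Rightarrow> 'a mat \<Rightarrow> bool" where
  "is_jid J e \<longleftrightarrow> e \<in> J \<and> (\<forall>X\<in>J. jprod e X = X)"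

definition blk :: "nat \<Rightarrow> 'a::field mat list \<Rightarrow> 'a mat" where
  "blk n Ms = (let s = sum_list (map dim_row Ms) in diag_block_mat (Ms @ [0\<^sub>m (n - s) (n - s)]))"

text \<open>canon A T n m l k: canonical realization, inside the algebra of kind A and index n,
  of a Jordan algebra of type T with index m, having l diagonal blocks equal to X and
  k diagonal blocks equal to X^t (counted in the whole matrix for A = Full, in the
  upper-left block of order n for A = Sympl).  Empty for combinations not needed.\<close>
fun canon :: "jkind \<Rightarrow> jkind \<Rightarrow> nat \<Rightarrow> nat \<Rightarrow> nat \<Rightarrow> nat \<Rightarrow> 'a::field mat set" where
  "canon Full Full n m l k =
     (if m * (l + k) \<le> n then
        {blk n (replicate l X @ replicate k (transpose_mat X)) | X. X \<in> carrier_mat m m}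
      else {})"
| "canon Full Sympl n m l k =
     (if 2 * m * l \<le> n \<and> k = 0 then
        {blk n (replicate l X) | X. X \<in> alg Sympl m}
      else {})"
| "canon Sympl Full n m l k =
     (if m * (l + k) \<le> n then
        {four_block_mat
           (blk n (replicate l X @ replicate k (transpose_mat X)))
           (0\<^sub>m n n) (0\<^sub>m n n)
           (blk n (replicate l (transpose_mat X) @ replicate k X)) | X. X \<in> carrier_mat m m}
      else {})"
| "canon Sympl Sympl n m l k =
     (if m * (l + k) \<le> n \<and> k \<le> l then
        {four_block_mat
           (blk n (replicate (l - k) X @ replicate k (four_block_mat X Y Z (transpose_mat X))))
           (blk n (replicate (l - k) Y))
           (blk n (replicate (l - k) Z))
           (transpose_mat (blk n (replicate (l - k) X @ replicate k (four_block_mat X Y Z (transpose_mat X)))))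
         | X Y Z. X \<in> carrier_mat m m \<and> Y \<in> carrier_mat m m \<and> Z \<in> carrier_mat m m \<and> skew Y \<and> skew Z}
      else {})"
| "canon _ _ n m l k = {}"

definition kinv :: "jkind \<Rightarrow> nat \<Rightarrow> 'a::field mat set \<Rightarrow> nat" where
  "kinv A n J = (THE d. \<exists>T m l k. J \<in> conj_class (alg A n) (canon A T n m l k)
                                   \<and> d = nat \<bar>int l - int k\<bar>)"

end

theory Submission
  imports Defs
begin

text \<open>A Jordan homomorphism \<open>\<phi>\<close> from a simple matrix Jordan algebra of index \<open>m \<ge> 3\<close> into
  matrices splits, along the Peirce decomposition of the idempotents \<open>\<phi> (E i i)\<close>, into genuine
  associative matrix units: one system for the types \<open>H(F_m)\<close> and \<open>H(F_2m, j)\<close>, and two orthogonal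
  systems (one for \<open>X\<close>, one for \<open>X\<^sup>t\<close>) for \<open>F_m\<^sup>(\<^sup>+\<^sup>)\<close>.  Two homomorphisms are therefore conjugate in
  \<open>GL_N\<close> as soon as the ranks of the minimal idempotents agree.  If both map into the fixed points of an
  involution \<open>*\<close> and \<open>Q\<close> intertwines them, then so does the isometry \<open>Q S\<^sup>-\<^sup>1\<close>, where \<open>S\<close> is a square root
  of \<open>Q\<^sup>* Q\<close> that is a polynomial in \<open>Q\<^sup>* Q\<close>.  Applied to the automorphisms of the ambient algebra, the same
  result shows that these are \<open>X \<mapsto> P X P\<^sup>-\<^sup>1\<close> or \<open>X \<mapsto> P X\<^sup>t P\<^sup>-\<^sup>1\<close>, hence preserve ranks.  For type
  \<open>F_m\<^sup>(\<^sup>+\<^sup>)\<close> the involution exchanges the two systems, so the invariant \<open>k\<close> carries information beyond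
  the rank of the identity only when the ambient algebra is \<open>F_n\<^sup>(\<^sup>+\<^sup>)\<close>.\<close>

section \<open>Row- and column-finite infinite matrices\<close>

text \<open>A subalgebra is handled through a parametrization by a standard algebra. Two
  parametrizations differ by an automorphism, which for type \<open>Full\<close> may involve a
  transposition and so fixes the two ranks only up to order; this is why the invariant is an
  absolute difference. No classification of subalgebras is presupposed: equivalence of
  \<open>J\<close> to a canonical form follows by comparing it with a block diagonal model of the
  same ranks. The obstacle is that \<open>kinv\<close> is a definite description over all types and
  sizes. Evaluating it means excluding canonical forms of another type or size, which is done for
  type \<open>Full\<close> inside \<open>Full\<close>. In the remaining cases the rank of the
  identity already decides, and for the implication starting from equivalence it is enough that the
  description depends on the class alone. Ranks of idempotents are treated as Murray-von Neumann
  classes: such equivalences add over orthogonal idempotents, pass to complements and come with the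
  elements from which conjugating matrices are assembled.\<close>

text \<open>Extending matrices by zero puts all sizes into one unital ring, so that type-class algebra is
  available; finiteness of rows and columns makes the transpose total.\<close>

typedef (overloaded) 'a imat =
  "{M :: nat \<Rightarrow> nat \<Rightarrow> 'a::field. (\<forall>i. finite {j. M i j \<noteq> 0}) \<and> (\<forall>j. finite {i. M i j \<noteq> 0})}"
  morphisms ent Abs_imat
  by (rule exI[of _ "\<lambda>i j. 0"]) auto

lemma finite_row: "finite {j. ent x i j \<noteq> 0}"
  using ent[of x] by auto

lemma finite_col: "finite {i. ent x i j \<noteq> 0}"
  using ent[of x] by auto

lemma imat_eqI: "(\<And>i j. ent x i j = ent y i j) \<Longrightarrow> x = y"
proof -
  assume "\<And>i j. ent x i j = ent y i j"
  then have "ent x = ent y" by (intro ext)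
  then show "x = y" by (simp add: ent_inject)
qed

lemma ent_Abs:
  assumes "\<And>i. finite {j. M i j \<noteq> 0}" and "\<And>j. finite {i. M i j \<noteq> 0}"
  shows "ent (Abs_imat M) = M"
  using assms by (intro Abs_imat_inverse) auto

definition imat_mult_ent :: "'a::field imat \<Rightarrow> 'a imat \<Rightarrow> nat \<Rightarrow> nat \<Rightarrow> 'a" where
  "imat_mult_ent x y i j = (\<Sum>k | ent x i k \<noteq> 0. ent x i k * ent y k j)"

lemma imat_mult_ent_row:
  assumes "finite K" and "{k. ent x i k \<noteq> 0} \<subseteq> K"
  shows "imat_mult_ent x y i j = (\<Sum>k\<in>K. ent x i k * ent y k j)"
  unfolding imat_mult_ent_def using assms by (intro sum.mono_neutral_left) auto

text \<open>Enlarging the index set by the row support reduces this to the row version; the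
  additional terms vanish.\<close>

lemma imat_mult_ent_col:
  assumes "finite K" and "{k. ent y k j \<noteq> 0} \<subseteq> K"
  shows "imat_mult_ent x y i j = (\<Sum>k\<in>K. ent x i k * ent y k j)"
proof -
  have "imat_mult_ent x y i j = (\<Sum>k\<in>K \<union> {k. ent x i k \<noteq> 0}. ent x i k * ent y k j)"
    using assms finite_row by (intro imat_mult_ent_row) auto
  also have "\<dots> = (\<Sum>k\<in>K. ent x i k * ent y k j)"
    using assms finite_row by (intro sum.mono_neutral_right) auto
  finally show ?thesis .
qed

instantiation imat :: (field) ring_1
begin

definition zero_imat :: "'a imat" where "0 = Abs_imat (\<lambda>i j. 0)"
definition one_imat :: "'a imat" where "1 = Abs_imat (\<lambda>i j. if i = j then 1 else 0)"
definition plus_imat :: "'a imat \<Rightarrow> 'a imat \<Rightarrow> 'a imat"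
  where "x + y = Abs_imat (\<lambda>i j. ent x i j + ent y i j)"
definition uminus_imat :: "'a imat \<Rightarrow> 'a imat"
  where "- x = Abs_imat (\<lambda>i j. - ent x i j)"
definition minus_imat :: "'a imat \<Rightarrow> 'a imat \<Rightarrow> 'a imat"
  where "x - y = Abs_imat (\<lambda>i j. ent x i j - ent y i j)"
definition times_imat :: "'a imat \<Rightarrow> 'a imat \<Rightarrow> 'a imat"
  where "x * y = Abs_imat (imat_mult_ent x y)"

lemma ent_zero [simp]: "ent 0 i j = 0"
  unfolding zero_imat_def by (subst ent_Abs) auto

lemma ent_one [simp]: "ent 1 i j = (if i = j then 1 else 0)"
  unfolding one_imat_def by (subst ent_Abs) auto

lemma ent_add [simp]: "ent (x + y) i j = ent x i j + ent y i j"
proof -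
  have "finite {j. ent x i j + ent y i j \<noteq> 0}" for i
    by (rule finite_subset[OF _ finite_UnI[OF finite_row[of x i] finite_row[of y i]]]) auto
  moreover have "finite {i. ent x i j + ent y i j \<noteq> 0}" for j
    by (rule finite_subset[OF _ finite_UnI[OF finite_col[of x j] finite_col[of y j]]]) auto
  ultimately show ?thesis unfolding plus_imat_def by (subst ent_Abs) auto
qed

lemma ent_uminus [simp]: "ent (- x) i j = - ent x i j"
  unfolding uminus_imat_def by (subst ent_Abs) (auto simp: finite_row finite_col)

lemma ent_minus [simp]: "ent (x - y) i j = ent x i j - ent y i j"
proof -
  have "finite {j. ent x i j - ent y i j \<noteq> 0}" for i
    by (rule finite_subset[OF _ finite_UnI[OF finite_row[of x i] finite_row[of y i]]]) auto
  moreover have "finite {i. ent x i j - ent y i j \<noteq> 0}" for j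
    by (rule finite_subset[OF _ finite_UnI[OF finite_col[of x j] finite_col[of y j]]]) auto
  ultimately show ?thesis unfolding minus_imat_def by (subst ent_Abs) auto
qed

lemma ent_mult: "ent (x * y) i j = imat_mult_ent x y i j"
proof -
  have "finite {j. imat_mult_ent x y i j \<noteq> 0}" for i
  proof (rule finite_subset)
    show "{j. imat_mult_ent x y i j \<noteq> 0} \<subseteq> (\<Union>k\<in>{k. ent x i k \<noteq> 0}. {j. ent y k j \<noteq> 0})"
    proof
      fix j assume "j \<in> {j. imat_mult_ent x y i j \<noteq> 0}"
      then have "(\<Sum>k | ent x i k \<noteq> 0. ent x i k * ent y k j) \<noteq> 0"
        by (simp add: imat_mult_ent_def)
      then obtain k where "ent x i k \<noteq> 0" "ent x i k * ent y k j \<noteq> 0"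
        by (elim sum.not_neutral_contains_not_neutral) auto
      then show "j \<in> (\<Union>k\<in>{k. ent x i k \<noteq> 0}. {j. ent y k j \<noteq> 0})" by auto
    qed
  qed (auto simp: finite_row)
  moreover have "finite {i. imat_mult_ent x y i j \<noteq> 0}" for j
  proof (rule finite_subset)
    show "{i. imat_mult_ent x y i j \<noteq> 0} \<subseteq> (\<Union>k\<in>{k. ent y k j \<noteq> 0}. {i. ent x i k \<noteq> 0})"
    proof
      fix i assume "i \<in> {i. imat_mult_ent x y i j \<noteq> 0}"
      then have "(\<Sum>k | ent x i k \<noteq> 0. ent x i k * ent y k j) \<noteq> 0"
        by (simp add: imat_mult_ent_def)
      then obtain k where "ent x i k \<noteq> 0" "ent x i k * ent y k j \<noteq> 0"
        by (elim sum.not_neutral_contains_not_neutral) auto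
      then show "i \<in> (\<Union>k\<in>{k. ent y k j \<noteq> 0}. {i. ent x i k \<noteq> 0})" by auto
    qed
  qed (auto simp: finite_col)
  ultimately show ?thesis unfolding times_imat_def by (subst ent_Abs) auto
qed

lemma ent_mult_row:
  "finite K \<Longrightarrow> (\<And>k. k \<notin> K \<Longrightarrow> ent x i k = 0) \<Longrightarrow> ent (x * y) i j = (\<Sum>k\<in>K. ent x i k * ent y k j)"
  unfolding ent_mult by (rule imat_mult_ent_row) auto

lemma ent_mult_col:
  "finite K \<Longrightarrow> (\<And>k. k \<notin> K \<Longrightarrow> ent y k j = 0) \<Longrightarrow> ent (x * y) i j = (\<Sum>k\<in>K. ent x i k * ent y k j)"
  unfolding ent_mult by (rule imat_mult_ent_col) auto

instance
proof
  fix a b c :: "'a imat"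
  show "a * b * c = a * (b * c)"
  proof (rule imat_eqI)
    fix i j
    \<comment> \<open>Row finiteness of \<open>a\<close> and column finiteness of \<open>c\<close>
      alone bound the double sum, which permits the exchange of the summations.\<close>
    define K where "K = {k. ent a i k \<noteq> 0}"
    define L where "L = {k. ent c k j \<noteq> 0}"
    have K: "finite K" and L: "finite L" unfolding K_def L_def by (rule finite_row finite_col)+
    have "ent (a * b * c) i j = (\<Sum>l\<in>L. ent (a * b) i l * ent c l j)"
      by (rule ent_mult_col) (use L in \<open>auto simp: L_def\<close>)
    also have "\<dots> = (\<Sum>l\<in>L. \<Sum>k\<in>K. ent a i k * ent b k l * ent c l j)"
    proof (rule sum.cong[OF refl])
      fix l
      have "ent (a * b) i l = (\<Sum>k\<in>K. ent a i k * ent b k l)"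
        by (rule ent_mult_row) (use K in \<open>auto simp: K_def\<close>)
      then show "ent (a * b) i l * ent c l j = (\<Sum>k\<in>K. ent a i k * ent b k l * ent c l j)"
        by (simp add: sum_distrib_right)
    qed
    also have "\<dots> = (\<Sum>k\<in>K. \<Sum>l\<in>L. ent a i k * ent b k l * ent c l j)"
      by (rule sum.swap)
    also have "\<dots> = (\<Sum>k\<in>K. ent a i k * ent (b * c) k j)"
    proof (rule sum.cong[OF refl])
      fix k
      have "ent (b * c) k j = (\<Sum>l\<in>L. ent b k l * ent c l j)"
        by (rule ent_mult_col) (use L in \<open>auto simp: L_def\<close>)
      then show "(\<Sum>l\<in>L. ent a i k * ent b k l * ent c l j) = ent a i k * ent (b * c) k j"
        by (simp add: sum_distrib_left mult.assoc)
    qed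
    also have "\<dots> = ent (a * (b * c)) i j"
      by (rule ent_mult_row[symmetric]) (use K in \<open>auto simp: K_def\<close>)
    finally show "ent (a * b * c) i j = ent (a * (b * c)) i j" .
  qed
  show "(a + b) * c = a * c + b * c"
  proof (rule imat_eqI)
    fix i j
    define L where "L = {k. ent c k j \<noteq> 0}"
    have L: "finite L" unfolding L_def by (rule finite_col)
    show "ent ((a + b) * c) i j = ent (a * c + b * c) i j"
      using L unfolding ent_add ent_mult
      by (simp add: imat_mult_ent_col[of L] L_def sum.distrib algebra_simps)
  qed
  show "a * (b + c) = a * b + a * c"
    by (rule imat_eqI) (simp add: ent_mult imat_mult_ent_def sum.distrib algebra_simps)
  show "1 * a = a"
  proof (rule imat_eqI)
    fix i j
    show "ent (1 * a) i j = ent a i j"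
      unfolding ent_mult by (subst imat_mult_ent_row[of "{i}"]) (auto split: if_splits)
  qed
  show "a * 1 = a"
  proof (rule imat_eqI)
    fix i j
    show "ent (a * 1) i j = ent a i j"
      unfolding ent_mult by (subst imat_mult_ent_col[of "{j}"]) (auto split: if_splits)
  qed
  show "(0::'a imat) \<noteq> 1"
  proof
    assume "(0::'a imat) = 1"
    then have "ent (0::'a imat) 0 0 = ent 1 0 0" by simp
    then show False by simp
  qed
qed (auto intro!: imat_eqI)

end

section \<open>Scalars, matrix units and the transpose\<close>

lemma ent_sum [simp]: "ent (sum f S) i j = (\<Sum>s\<in>S. ent (f s) i j)"
  by (induction S rule: infinite_finite_induct) auto

text \<open>Scalars become central diagonal elements, so that linearity is multiplication in the
  ring and the class \<open>ring_1\<close> suffices.\<close>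

definition sc :: "'a::field \<Rightarrow> 'a imat" where
  "sc c = Abs_imat (\<lambda>i j. if i = j then c else 0)"

lemma ent_sc [simp]: "ent (sc c) i j = (if i = j then c else 0)"
  unfolding sc_def by (subst ent_Abs) auto

lemma ent_sc_mult [simp]: "ent (sc c * x) i j = c * ent x i j"
  by (subst ent_mult_row[of "{i}"]) auto

lemma ent_mult_sc [simp]: "ent (x * sc c) i j = ent x i j * c"
  by (subst ent_mult_col[of "{j}"]) auto

lemma sc_commute: "x * sc c = sc c * x"
  by (rule imat_eqI) (simp add: mult.commute)

lemma sc_left_commute: "x * (sc c * y) = sc c * (x * y)"
  by (metis mult.assoc sc_commute)

lemma sc_0 [simp]: "sc 0 = 0" and sc_1 [simp]: "sc 1 = 1"
  and sc_add: "sc (a + b) = sc a + sc b" and sc_mult: "sc (a * b) = sc a * sc b"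
  and sc_uminus: "sc (- a) = - sc a"
  by (auto intro!: imat_eqI)

lemma sc_inverse: "c \<noteq> 0 \<Longrightarrow> sc c * (sc (1 / c) * x) = x"
  by (rule imat_eqI) simp

definition unit_mat :: "nat \<Rightarrow> nat \<Rightarrow> 'a::field imat" where
  "unit_mat i j = Abs_imat (\<lambda>k l. if k = i \<and> l = j then 1 else 0)"

abbreviation E :: "nat \<Rightarrow> nat \<Rightarrow> 'a::field imat" where "E \<equiv> unit_mat"

lemma ent_unit_mat [simp]: "ent (E i j) k l = (if k = i \<and> l = j then 1 else 0)"
  unfolding unit_mat_def by (subst ent_Abs) auto

lemma unit_mat_mult: "E i j * E k l = (if j = k then E i l else 0)"
  by (intro imat_eqI, subst ent_mult_row[of "{j}"]) auto

definition tr :: "'a::field imat \<Rightarrow> 'a imat" where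
  "tr x = Abs_imat (\<lambda>i j. ent x j i)"

lemma ent_tr [simp]: "ent (tr x) i j = ent x j i"
  unfolding tr_def by (subst ent_Abs) (auto simp: finite_row finite_col)

lemma tr_tr [simp]: "tr (tr x) = x" and tr_add: "tr (x + y) = tr x + tr y"
  and tr_minus: "tr (x - y) = tr x - tr y" and tr_uminus: "tr (- x) = - tr x"
  and tr_0 [simp]: "tr 0 = 0" and tr_1 [simp]: "tr 1 = 1"
  and tr_sc [simp]: "tr (sc c) = sc c" and tr_unit [simp]: "tr (E i j) = E j i"
  and tr_sum: "tr (sum f S) = (\<Sum>s\<in>S. tr (f s))"
  by (auto intro!: imat_eqI)

lemma tr_mult: "tr (x * y) = tr y * tr x"
proof (rule imat_eqI)
  fix i j
  define K where "K = {k. ent x j k \<noteq> 0}"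
  have K: "finite K" unfolding K_def by (rule finite_row)
  have "ent (x * y) j i = (\<Sum>k\<in>K. ent x j k * ent y k i)"
    by (rule ent_mult_row) (use K in \<open>auto simp: K_def\<close>)
  moreover have "ent (tr y * tr x) i j = (\<Sum>k\<in>K. ent (tr y) i k * ent (tr x) k j)"
    by (rule ent_mult_col) (use K in \<open>auto simp: K_def\<close>)
  ultimately show "ent (tr (x * y)) i j = ent (tr y * tr x) i j" by (simp add: mult.commute)
qed

section \<open>Corners: matrices supported in the first N rows and columns\<close>

definition corner :: "nat \<Rightarrow> 'a::field imat" where
  "corner r = (\<Sum>i<r. E i i)"

lemma ent_corner [simp]: "ent (corner r) i j = (if i = j \<and> i < r then 1 else 0)"
proof -
  have "ent (corner r) i j = (\<Sum>k<r. if i = k then (if j = k then 1 else 0) else 0)"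
    by (auto simp: corner_def intro!: sum.cong)
  then show ?thesis by (auto simp: sum.delta)
qed

lemma ent_corner_mult: "ent (corner r * x) i j = (if i < r then ent x i j else 0)"
  by (subst ent_mult_row[of "{i}"]) auto

lemma ent_mult_corner: "ent (x * corner r) i j = (if j < r then ent x i j else 0)"
  by (subst ent_mult_col[of "{j}"]) auto

lemma corner_idem [simp]: "corner r * corner r = corner r"
  by (rule imat_eqI) (simp add: ent_corner_mult)

lemma corner_mult_corner: "r \<le> s \<Longrightarrow> corner r * corner s = corner r" "r \<le> s \<Longrightarrow> corner s * corner r = corner r"
  by (auto intro!: imat_eqI simp: ent_corner_mult)

lemma tr_corner [simp]: "tr (corner r) = corner r"
  by (rule imat_eqI) auto

text \<open>Stated by absorption laws, the form in which associativity arguments consume it;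
  \<open>in_corner_ent\<close> gives the entrywise reading.\<close>

definition in_corner :: "nat \<Rightarrow> 'a::field imat \<Rightarrow> bool" where
  "in_corner N x \<longleftrightarrow> corner N * x = x \<and> x * corner N = x"

lemma in_corner_ent: "in_corner N x \<longleftrightarrow> (\<forall>i j. ent x i j \<noteq> 0 \<longrightarrow> i < N \<and> j < N)"
proof
  assume "in_corner N x"
  then have 1: "corner N * x = x" and 2: "x * corner N = x" by (auto simp: in_corner_def)
  show "\<forall>i j. ent x i j \<noteq> 0 \<longrightarrow> i < N \<and> j < N"
  proof (intro allI impI)
    fix i j assume "ent x i j \<noteq> 0"
    then have "ent (corner N * x) i j \<noteq> 0" "ent (x * corner N) i j \<noteq> 0" unfolding 1 2 by auto
    then show "i < N \<and> j < N" by (auto simp: ent_corner_mult ent_mult_corner split: if_splits)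
  qed
next
  assume "\<forall>i j. ent x i j \<noteq> 0 \<longrightarrow> i < N \<and> j < N"
  then show "in_corner N x"
    unfolding in_corner_def by (force simp: ent_corner_mult ent_mult_corner intro!: imat_eqI)
qed

lemma in_corner_intros:
  "in_corner N 0" "in_corner N (corner N)"
  "in_corner N x \<Longrightarrow> in_corner N y \<Longrightarrow> in_corner N (x + y)"
  "in_corner N x \<Longrightarrow> in_corner N y \<Longrightarrow> in_corner N (x - y)"
  "in_corner N x \<Longrightarrow> in_corner N (- x)"
  "in_corner N x \<Longrightarrow> in_corner N (sc c * x)"
  "in_corner N x \<Longrightarrow> in_corner N (tr x)"
  "i < N \<Longrightarrow> j < N \<Longrightarrow> in_corner N (E i j)"
proof -
  show "in_corner N x \<Longrightarrow> in_corner N y \<Longrightarrow> in_corner N (x + y)"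
    by (simp add: in_corner_def algebra_simps)
  show "in_corner N x \<Longrightarrow> in_corner N y \<Longrightarrow> in_corner N (x - y)"
    by (simp add: in_corner_def algebra_simps)
qed (auto simp: in_corner_ent split: if_splits)

lemma in_corner_mult: "in_corner N x \<Longrightarrow> in_corner N y \<Longrightarrow> in_corner N (x * y)"
  unfolding in_corner_def by (auto simp: mult.assoc) (simp add: mult.assoc[symmetric])

lemma in_cornerD: "in_corner N x \<Longrightarrow> corner N * x = x" "in_corner N x \<Longrightarrow> x * corner N = x"
  by (auto simp: in_corner_def)

lemma imat_eq_sum:
  assumes "in_corner N x"
  shows "x = (\<Sum>i<N. \<Sum>j<N. sc (ent x i j) * E i j)"
proof (rule imat_eqI)
  fix k l
  have "ent (\<Sum>i<N. \<Sum>j<N. sc (ent x i j) * E i j) k l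
      = (\<Sum>i<N. \<Sum>j<N. if k = i then (if l = j then ent x i j else 0) else 0)"
    by (auto intro!: sum.cong)
  also have "\<dots> = (\<Sum>i<N. if k = i then (\<Sum>j<N. if l = j then ent x i j else 0) else 0)"
    by (intro sum.cong) auto
  also have "\<dots> = (if k < N \<and> l < N then ent x k l else 0)"
    by (auto simp: sum.delta)
  also have "\<dots> = ent x k l" using assms by (auto simp: in_corner_ent)
  finally show "ent x k l = ent (\<Sum>i<N. \<Sum>j<N. sc (ent x i j) * E i j) k l" by simp
qed

section \<open>Passage between finite matrices and the ring\<close>

definition emb :: "'a::field mat \<Rightarrow> 'a imat" where
  "emb A = Abs_imat (\<lambda>i j. if i < dim_row A \<and> j < dim_col A then A $$ (i, j) else 0)"

lemma ent_emb [simp]: "ent (emb A) i j = (if i < dim_row A \<and> j < dim_col A then A $$ (i, j) else 0)"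
proof -
  have "finite {j. (if i < dim_row A \<and> j < dim_col A then A $$ (i, j) else 0) \<noteq> 0}" for i
    by (rule finite_subset[of _ "{..<dim_col A}"]) auto
  moreover have "finite {i. (if i < dim_row A \<and> j < dim_col A then A $$ (i, j) else 0) \<noteq> 0}" for j
    by (rule finite_subset[of _ "{..<dim_row A}"]) auto
  ultimately show ?thesis unfolding emb_def by (subst ent_Abs) auto
qed

definition unemb :: "nat \<Rightarrow> 'a::field imat \<Rightarrow> 'a mat" where
  "unemb N x = mat N N (\<lambda>(i, j). ent x i j)"

lemma unemb_carrier [simp]: "unemb N x \<in> carrier_mat N N"
  "dim_row (unemb N x) = N" "dim_col (unemb N x) = N"
  by (auto simp: unemb_def)

lemma emb_unemb: "in_corner N x \<Longrightarrow> emb (unemb N x) = x"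
  by (rule imat_eqI) (auto simp: unemb_def in_corner_ent)

lemma unemb_emb: "A \<in> carrier_mat N N \<Longrightarrow> unemb N (emb A) = A"
  by (rule eq_matI) (auto simp: unemb_def)

lemma in_corner_emb: "A \<in> carrier_mat N N \<Longrightarrow> in_corner N (emb A)"
  by (auto simp: in_corner_ent split: if_splits)

lemma emb_inj: "A \<in> carrier_mat N N \<Longrightarrow> B \<in> carrier_mat N N \<Longrightarrow> emb A = emb B \<Longrightarrow> A = B"
  by (metis unemb_emb)

lemma emb_mult:
  assumes "A \<in> carrier_mat a b" "B \<in> carrier_mat b c"
  shows "emb (A * B) = emb A * emb B"
proof (rule imat_eqI)
  fix i j
  have "ent (emb A * emb B) i j = (\<Sum>k\<in>{0..<b}. ent (emb A) i k * ent (emb B) k j)"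
    using assms by (intro ent_mult_row) auto
  then show "ent (emb (A * B)) i j = ent (emb A * emb B) i j"
    using assms by (auto simp: scalar_prod_def intro!: sum.cong)
qed

lemma emb_add: "A \<in> carrier_mat a b \<Longrightarrow> B \<in> carrier_mat a b \<Longrightarrow> emb (A + B) = emb A + emb B"
  by (rule imat_eqI) auto

lemma emb_smult: "emb (c \<cdot>\<^sub>m A) = sc c * emb A"
  by (rule imat_eqI) auto

lemma emb_zero [simp]: "emb (0\<^sub>m a b) = 0"
  by (rule imat_eqI) auto

lemma emb_one: "emb (1\<^sub>m N) = corner N"
  by (rule imat_eqI) auto

lemma emb_transpose: "emb (transpose_mat A) = tr (emb A)"
  by (rule imat_eqI) auto

section \<open>Murray--von Neumann equivalence and rank\<close>

definition idem :: "'r::ring_1 \<Rightarrow> bool" where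
  "idem p \<longleftrightarrow> p * p = p"

text \<open>The absorption laws normalise the witnesses, placing \<open>x\<close> in
  \<open>q R p\<close> and \<open>y\<close> in \<open>p R q\<close> for the ambient ring
  \<open>R\<close>; so they compose, and add over orthogonal idempotents, without correction
  terms.\<close>

definition mvn_pair :: "'r::ring_1 \<Rightarrow> 'r \<Rightarrow> 'r \<Rightarrow> 'r \<Rightarrow> bool" where
  "mvn_pair p q x y \<longleftrightarrow> y * x = p \<and> x * y = q \<and> q * x = x \<and> x * p = x \<and> p * y = y \<and> y * q = y"

definition mvn :: "'r::ring_1 \<Rightarrow> 'r \<Rightarrow> bool" where
  "mvn p q \<longleftrightarrow> (\<exists>x y. mvn_pair p q x y)"

text \<open>Cutting \<open>x\<close> and \<open>y\<close> down by the idempotents costs nothing,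
  since \<open>x * p = x * y * x = q * x\<close> and likewise \<open>y * q = p * y\<close>.\<close>

lemma mvn_pairI:
  assumes "idem p" "idem q" "y * x = p" "x * y = q"
  shows "mvn_pair p q (q * x * p) (p * y * q)"
proof -
  have p: "p * p = p" and q: "q * q = q" using assms by (auto simp: idem_def)
  have px: "x * p = q * x" and py: "y * q = p * y"
    using assms(3,4) by (auto simp: mult.assoc[symmetric])
  have 1: "(p * y * q) * (q * x * p) = p * (y * ((q * q) * (x * p)))" by (simp only: mult.assoc)
  also have "\<dots> = p * ((y * q) * (q * x))" using q px by (simp add: mult.assoc)
  also have "\<dots> = p * (y * ((q * q) * x))" by (simp only: mult.assoc)
  also have "\<dots> = p * (p * (y * x))" using q py by (simp add: mult.assoc[symmetric])
  finally have a: "(p * y * q) * (q * x * p) = p" using p assms(3) by simp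
  have "(q * x * p) * (p * y * q) = q * (x * ((p * p) * (y * q)))" by (simp only: mult.assoc)
  also have "\<dots> = q * ((x * p) * (p * y))" using p py by (simp add: mult.assoc)
  also have "\<dots> = q * (x * ((p * p) * y))" by (simp only: mult.assoc)
  also have "\<dots> = q * (q * (x * y))" using p px by (simp add: mult.assoc[symmetric])
  finally have b: "(q * x * p) * (p * y * q) = q" using q assms(4) by simp
  show ?thesis unfolding mvn_pair_def using a b p q
    by (simp add: mult.assoc[symmetric]) (simp add: mult.assoc)
qed

lemma mvnI: "idem p \<Longrightarrow> idem q \<Longrightarrow> y * x = p \<Longrightarrow> x * y = q \<Longrightarrow> mvn p q"
  using mvn_pairI unfolding mvn_def by blast

lemma mvn_sym: "mvn p q \<Longrightarrow> mvn q p"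
  unfolding mvn_def mvn_pair_def by blast

lemma mvn_refl: "idem p \<Longrightarrow> mvn p p"
  unfolding mvn_def mvn_pair_def idem_def by blast

lemma mvn_trans:
  assumes "mvn p q" "mvn q r" shows "mvn p r"
proof -
  obtain x y where 1: "y * x = p" "x * y = q" "q * x = x" "x * p = x" "p * y = y" "y * q = y"
    using assms(1) unfolding mvn_def mvn_pair_def by blast
  obtain x' y' where 2: "y' * x' = q" "x' * y' = r" "r * x' = x'" "x' * q = x'" "q * y' = y'" "y' * r = y'"
    using assms(2) unfolding mvn_def mvn_pair_def by blast
  have "(y * y') * (x' * x) = y * ((y' * x') * x)" "(x' * x) * (y * y') = x' * ((x * y) * y')"
    by (simp_all only: mult.assoc)
  then have "mvn_pair p r (x' * x) (y * y')"
    unfolding mvn_pair_def using 1 2 by (simp add: mult.assoc) (simp add: mult.assoc[symmetric])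
  then show ?thesis unfolding mvn_def by blast
qed

lemma mvn_idem: "mvn p q \<Longrightarrow> idem p" "mvn p q \<Longrightarrow> idem q"
  unfolding mvn_def mvn_pair_def idem_def by (metis mult.assoc)+

lemma mvn_add:
  assumes "mvn p q" "mvn p' q'" "p * p' = 0" "p' * p = 0" "q * q' = 0" "q' * q = 0"
  shows "mvn (p + p') (q + q')"
proof -
  obtain x y where 1: "y * x = p" "x * y = q" "q * x = x" "x * p = x" "p * y = y" "y * q = y"
    using assms(1) unfolding mvn_def mvn_pair_def by blast
  obtain x' y' where 2: "y' * x' = p'" "x' * y' = q'" "q' * x' = x'" "x' * p' = x'" "p' * y' = y'" "y' * q' = y'"
    using assms(2) unfolding mvn_def mvn_pair_def by blast
  have "y * x' = (y * q) * (q' * x')" "x * y' = (x * p) * (p' * y')"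
    "y' * x = (y' * q') * (q * x)" "x' * y = (x' * p') * (p * y)"
    using 1 2 by simp_all
  then have "y * x' = y * (q * q') * x'" "x * y' = x * (p * p') * y'"
    "y' * x = y' * (q' * q) * x" "x' * y = x' * (p' * p) * y"
    by (simp_all only: mult.assoc)
  then have z: "y * x' = 0" "x * y' = 0" "y' * x = 0" "x' * y = 0"
    using assms by simp_all
  have ip: "idem (p + p')" "idem (q + q')"
    using mvn_idem[OF assms(1)] mvn_idem[OF assms(2)] assms(3-6) by (auto simp: idem_def algebra_simps)
  show ?thesis
    by (rule mvnI[OF ip, of "y + y'" "x + x'"]) (use 1 2 z in \<open>auto simp: algebra_simps\<close>)
qed

lemma mvn_sum:
  assumes "finite S" "\<And>i. i \<in> S \<Longrightarrow> mvn (f i) (g i)"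
    "\<And>i j. i \<in> S \<Longrightarrow> j \<in> S \<Longrightarrow> i \<noteq> j \<Longrightarrow> f i * f j = 0"
    "\<And>i j. i \<in> S \<Longrightarrow> j \<in> S \<Longrightarrow> i \<noteq> j \<Longrightarrow> g i * g j = 0"
  shows "mvn (sum f S) (sum g S)"
  using assms
proof (induction S rule: finite_induct)
  case empty then show ?case by (simp add: mvn_refl idem_def)
next
  case (insert a S)
  have o: "f a * f x = 0" "f x * f a = 0" "g a * g x = 0" "g x * g a = 0" if "x \<in> S" for x
    using insert.prems(2)[of a x] insert.prems(2)[of x a] insert.prems(3)[of a x]
      insert.prems(3)[of x a] insert.hyps that by auto
  have "mvn (sum f S) (sum g S)" using insert.prems by (intro insert.IH) auto
  then have "mvn (f a + sum f S) (g a + sum g S)"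
    using insert.prems(1)[of a] o
    by (intro mvn_add) (auto simp: sum_distrib_left sum_distrib_right)
  then show ?case using insert.hyps by simp
qed

section \<open>The rank of an idempotent\<close>

lemma idem_corner [simp]: "idem (corner r)"
  by (simp add: idem_def)

text \<open>For \<open>r < s\<close> the witnesses are square matrices of order \<open>s\<close>
  whose product \<open>x * y\<close> is the identity, while \<open>corner r * y = y\<close> forces a
  zero row in \<open>y\<close>; determinants exclude this. Hence ranks are well defined.\<close>

lemma corner_mvn_le:
  assumes "mvn (corner r :: 'a::field imat) (corner s)" shows "s \<le> r"
proof (rule ccontr)
  assume "\<not> s \<le> r"
  then have rs: "r < s" by simp
  obtain x y :: "'a imat" where 1: "y * x = corner r" "x * y = corner s"
    "corner s * x = x" "x * corner r = x" "corner r * y = y" "y * corner s = y"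
    using assms unfolding mvn_def mvn_pair_def by blast
  have le: "corner s * corner r = (corner r :: 'a imat)" "corner r * corner s = (corner r :: 'a imat)"
    using rs by (auto simp: corner_mult_corner)
  have x: "in_corner s x" unfolding in_corner_def using 1 le by (metis mult.assoc)
  have y: "in_corner s y" unfolding in_corner_def using 1 le by (metis mult.assoc)
  have "emb (unemb s x * unemb s y) = emb (1\<^sub>m s)"
    by (subst emb_mult[of _ s s _ s]) (auto simp: emb_unemb x y 1 emb_one)
  then have "unemb s x * unemb s y = 1\<^sub>m s"
    by (intro emb_inj[of _ s]) auto
  then have "det (unemb s x) * det (unemb s y) = 1"
    by (metis det_mult det_one unemb_carrier(1))
  moreover have "ent y r j = 0" for j
    using arg_cong[OF 1(5), of "\<lambda>z. ent z r j"] by (simp add: ent_corner_mult)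
  then have "row (unemb s y) r = 0\<^sub>v s"
    using rs by (intro eq_vecI) (auto simp: unemb_def)
  then have eq: "unemb s y = mat\<^sub>r s s (\<lambda>i. if i = r then 0\<^sub>v s else row (unemb s y) i)"
    by (intro eq_rowI) auto
  have "det (mat\<^sub>r s s (\<lambda>i. if i = r then 0\<^sub>v s else row (unemb s y) i)) = 0"
    using rs by (intro det_row_0) auto
  then have "det (unemb s y) = 0" using eq by simp
  ultimately show False by simp
qed

lemma corner_mvn_eq: "mvn (corner r :: 'a::field imat) (corner s) \<Longrightarrow> r = s"
  by (meson corner_mvn_le le_antisym mvn_sym)

text \<open>A relation, because an idempotent of the infinite ring may have infinite rank. Since
  \<open>rk p r\<close> entails \<open>idem p\<close>, every rank statement below concerns
  idempotents.\<close>

definition rk :: "'a::field imat \<Rightarrow> nat \<Rightarrow> bool" where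
  "rk p r \<longleftrightarrow> mvn p (corner r)"

lemma rk_unique: "rk p r \<Longrightarrow> rk p s \<Longrightarrow> r = s"
  unfolding rk_def by (meson corner_mvn_eq mvn_sym mvn_trans)

lemma rk_mvn: "rk p r \<Longrightarrow> rk q r \<Longrightarrow> mvn p q"
  unfolding rk_def by (meson mvn_sym mvn_trans)

lemma mvn_rk: "mvn p q \<Longrightarrow> rk p r \<Longrightarrow> rk q r"
  unfolding rk_def by (meson mvn_sym mvn_trans)

lemma rk_corner: "rk (corner r) r"
  by (simp add: rk_def mvn_refl)

lemma rk_0: "rk 0 0"
  using rk_corner[of 0] by (simp add: corner_def)

lemma rk_0D: "rk p 0 \<Longrightarrow> p = 0"
  by (auto simp: rk_def corner_def mvn_def mvn_pair_def)

lemma rk_unit: "rk (E i i) 1"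
  unfolding rk_def
  by (rule mvnI[of _ _ "E i 0" "E 0 i"]) (auto simp: unit_mat_mult idem_def corner_def)

text \<open>The idempotent \<open>q\<close> is moved to the diagonal segment \<open>w\<close> of
  length \<open>s\<close> directly after \<open>corner r\<close>, where it is orthogonal to the
  image of \<open>p\<close>.\<close>

lemma rk_add:
  assumes "rk p r" "rk q s" "p * q = 0" "q * p = 0"
  shows "rk (p + q) (r + s)"
proof -
  define w :: "'a imat" where "w = (\<Sum>i\<in>{r..<r+s}. E i i)"
  have w: "w = corner (r + s) - corner r"
  proof -
    have "(corner (r + s) :: 'a imat) = corner r + w"
      unfolding corner_def w_def
      by (subst sum.union_disjoint[symmetric]) (auto intro!: sum.cong)
    then show ?thesis by simp
  qed
  have "w = (\<Sum>i<s. E (r + i) (r + i))"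
    unfolding w_def by (rule sum.reindex_bij_witness[of _ "\<lambda>i. r + i" "\<lambda>i. i - r"]) auto
  moreover have "mvn (\<Sum>i<s. E i i) (\<Sum>i<s. E (r + i) (r + i) :: 'a imat)"
    by (intro mvn_sum) (auto simp: unit_mat_mult
      intro!: mvnI[of _ _ "E _ (r + _)" "E (r + _) _"] simp: idem_def)
  ultimately have "mvn (corner s) w" by (simp add: corner_def)
  then have "mvn q w" using assms(2) unfolding rk_def by (meson mvn_trans)
  then have "mvn (p + q) (corner r + w)"
    using assms unfolding rk_def
    by (intro mvn_add) (auto simp: w algebra_simps corner_mult_corner)
  then show ?thesis by (simp add: rk_def w)
qed

lemma rk_sum:
  assumes "finite S" "\<And>i. i \<in> S \<Longrightarrow> rk (f i) (r i)"
    "\<And>i j. i \<in> S \<Longrightarrow> j \<in> S \<Longrightarrow> i \<noteq> j \<Longrightarrow> f i * f j = 0"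
  shows "rk (sum f S) (sum r S)"
  using assms
proof (induction S rule: finite_induct)
  case empty then show ?case by (simp add: rk_0)
next
  case (insert a S)
  have o: "f a * f x = 0" "f x * f a = 0" if "x \<in> S" for x
    using insert.prems(2)[of a x] insert.prems(2)[of x a] insert.hyps that by auto
  have "rk (sum f S) (sum r S)" using insert.prems by (intro insert.IH) auto
  then have "rk (f a + sum f S) (r a + sum r S)"
    using insert.prems(1)[of a] o
    by (intro rk_add) (auto simp: sum_distrib_left sum_distrib_right)
  then show ?case using insert.hyps by simp
qed

lemma rk_tr: "rk p r \<Longrightarrow> rk (tr p) r"
proof -
  assume "rk p r"
  then obtain x y where "mvn_pair p (corner r) x y" unfolding rk_def mvn_def by blast
  then have "y * x = p" "x * y = corner r" "corner r * x = x" "x * p = x" "p * y = y" "y * corner r = y"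
    by (simp_all add: mvn_pair_def)
  note 1 = this[THEN arg_cong[of _ _ tr]]
  have "mvn_pair (tr p) (corner r) (tr y) (tr x)"
    unfolding mvn_pair_def using 1 by (simp add: tr_mult)
  then show ?thesis unfolding rk_def mvn_def by blast
qed

section \<open>Comparison with the column rank of a matrix\<close>

lemma mult_mat_unit_vec:
  "A \<in> carrier_mat n nc \<Longrightarrow> j < nc \<Longrightarrow> A *\<^sub>v unit_vec nc j = col (A :: 'a::field mat) j"
  using col_mult2[of A n nc "1\<^sub>m nc" nc j] by simp

text \<open>A full rank factorization: \<open>X\<close> is formed from a maximal independent set of
  columns of \<open>P\<close>, \<open>Y\<close> holds the coordinates of all columns in this basis,
  and the zero-one matrix \<open>Z\<close> selects the basis columns.\<close>

lemma (in vec_space) exists_mat_basis: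
  assumes P: "P \<in> carrier_mat n nc"
  shows "\<exists>X Z Y. X \<in> carrier_mat n (rank P) \<and> Z \<in> carrier_mat nc (rank P)
    \<and> Y \<in> carrier_mat (rank P) nc \<and> X = P * Z \<and> P = X * Y
    \<and> (\<forall>v\<in>carrier_vec (rank P). X *\<^sub>v v = 0\<^sub>v n \<longrightarrow> v = 0\<^sub>v (rank P))"
proof -
  have "\<exists>S. finite S \<and> maximal S (\<lambda>T. T \<subseteq> set (cols P) \<and> lin_indpt T) \<and> {} \<subseteq> S"
    by (rule maximal_exists_superset[of "set (cols P)"]) (auto simp: lin_dep_def)
  then obtain S where S: "maximal S (\<lambda>T. T \<subseteq> set (cols P) \<and> lin_indpt T)" by blast
  then have rk: "rank P = card S" using rank_card_indpt[OF P] by simp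
  have sub: "S \<subseteq> set (cols P)" and li: "lin_indpt S" using S by (auto simp: maximal_def)
  have fin: "finite S" using sub finite_subset by blast
  obtain Ss where Ss: "set Ss = S" "distinct Ss" using finite_distinct_list[OF fin] by blast
  have len: "length Ss = rank P" using Ss rk distinct_card by fastforce
  have carrS: "S \<subseteq> carrier_vec n" using sub cols_dim[of P] P by auto
  define X where "X = mat_of_cols n Ss"
  have X: "X \<in> carrier_mat n (rank P)" by (intro carrier_matI) (auto simp: X_def len)
  have colsX: "cols X = Ss" unfolding X_def using carrS Ss by (intro cols_mat_of_cols) auto
  have inj: "v = 0\<^sub>v (rank P)" if v: "v \<in> carrier_vec (rank P)" "X *\<^sub>v v = 0\<^sub>v n" for v
  proof (rule ccontr)
    assume "v \<noteq> 0\<^sub>v (rank P)"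
    then have "lin_dep (set (cols X))"
      using lin_depI[OF X v(1) _ v(2)] colsX Ss by simp
    then show False using li colsX Ss by simp
  qed
  have "\<exists>y\<in>carrier_vec (rank P). col P j = X *\<^sub>v y" if j: "j < nc" for j
  proof -
    have cj: "col P j \<in> set (cols P)" using j P by (auto simp: cols_def)
    have "col P j \<in> span S"
    proof (rule ccontr)
      assume not: "col P j \<notin> span S"
      then have "col P j \<notin> S" using in_own_span[of S] carrS by auto
      moreover have "lin_indpt (insert (col P j) S)"
        using lin_dep_iff_in_span[of S "col P j"] carrS li not cj \<open>col P j \<notin> S\<close> P cols_dim[of P] by auto
      ultimately show False using S cj unfolding maximal_def by blast
    qed
    then have "col P j \<in> span (set (cols X))" using colsX Ss by simp
    then obtain a where a: "lincomb a (set (cols X)) = col P j"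
      using fin colsX Ss finite_in_span[of "set (cols X)" "col P j"] carrS by auto
    have "col P j = lincomb a (set (cols X))" using a by (rule sym)
    also have "\<dots> = X *\<^sub>v vec (rank P) (\<lambda>i. a (col X i))"
      using mat_mult_eq_lincomb[OF X, of a] colsX Ss by simp
    finally show ?thesis by (intro bexI[of _ "vec (rank P) (\<lambda>i. a (col X i))"]) auto
  qed
  then obtain yf where yf: "\<And>j. j < nc \<Longrightarrow> yf j \<in> carrier_vec (rank P) \<and> col P j = X *\<^sub>v yf j"
    by metis
  define Y where "Y = mat_of_cols (rank P) (map yf [0..<nc])"
  have Y: "Y \<in> carrier_mat (rank P) nc" by (intro carrier_matI) (auto simp: Y_def)
  have PY: "P = X * Y"
  proof (rule mat_col_eqI)
    fix j assume "j < dim_col (X * Y)"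
    then have j: "j < nc" using Y by simp
    have "col Y j = yf j" unfolding Y_def using j yf by (subst col_mat_of_cols) auto
    then show "col P j = col (X * Y) j" using j yf col_mult2[OF X Y j] by simp
  qed (use P X Y in auto)
  have "\<exists>k<nc. Ss ! i = col P k" if "i < rank P" for i
  proof -
    have "Ss ! i \<in> set (cols P)" using that len Ss sub by (metis nth_mem subsetD)
    then show ?thesis using P by (auto simp: cols_def)
  qed
  then obtain kf where kf: "\<And>i. i < rank P \<Longrightarrow> kf i < nc \<and> Ss ! i = col P (kf i)" by metis
  define Z where "Z = mat_of_cols nc (map (\<lambda>i. unit_vec nc (kf i)) [0..<rank P] :: 'a vec list)"
  have Z: "Z \<in> carrier_mat nc (rank P)" by (intro carrier_matI) (auto simp: Z_def)
  have XZ: "X = P * Z"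
  proof (rule mat_col_eqI)
    fix i assume "i < dim_col (P * Z)"
    then have i: "i < rank P" using Z by simp
    have "col Z i = unit_vec nc (kf i)" unfolding Z_def using i by (subst col_mat_of_cols) auto
    then have "col (P * Z) i = P *\<^sub>v unit_vec nc (kf i)" using col_mult2[OF P Z i] by simp
    also have "\<dots> = col P (kf i)" using P kf[OF i] by (simp add: mult_mat_unit_vec)
    also have "\<dots> = Ss ! i" using kf[OF i] by simp
    also have "\<dots> = col X i" unfolding X_def using i len carrS Ss
      by (subst col_mat_of_cols) (auto simp: subset_eq)
    finally show "col X i = col (P * Z) i" by simp
  qed (use P X Z in auto)
  show ?thesis using X Y Z XZ PY inj by blast
qed

text \<open>For idempotent \<open>P\<close> the relation \<open>X = P * Z\<close> gives
  \<open>P * X = X\<close>, so \<open>X * (Y * X) = X\<close>; injectivity of \<open>X\<close>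
  cancels this to \<open>Y * X = 1\<close>, and the two factors witness the equivalence.\<close>

lemma rk_mrank:
  assumes P: "P \<in> carrier_mat N N" and id: "P * P = P"
  shows "rk (emb P) (mrank P)"
proof -
  define r where "r = vec_space.rank N P"
  have r: "mrank P = r" using P by (simp add: mrank_def r_def)
  obtain X Z Y where X: "X \<in> carrier_mat N r" and Z: "Z \<in> carrier_mat N r"
    and Y: "Y \<in> carrier_mat r N" and XZ: "X = P * Z" and PY: "P = X * Y"
    and inj: "\<And>v. v\<in>carrier_vec r \<Longrightarrow> X *\<^sub>v v = 0\<^sub>v N \<Longrightarrow> v = 0\<^sub>v r"
    using vec_space.exists_mat_basis[OF P] unfolding r_def by blast
  have "P * X = (P * P) * Z" unfolding XZ using assoc_mult_mat[OF P P Z] by simp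
  then have PX: "P * X = X" using id XZ by simp
  have "X * (Y * X) = (X * Y) * X" using assoc_mult_mat[OF X Y X] by simp
  then have eq: "X * (Y * X) = X" using PX PY[symmetric] by simp
  have "Y * X = 1\<^sub>m r"
  proof (rule mat_col_eqI)
    fix j assume "j < dim_col (1\<^sub>m r :: 'a mat)"
    then have j: "j < r" by simp
    have "X *\<^sub>v (col (Y * X) j - unit_vec r j) = X *\<^sub>v col (Y * X) j - X *\<^sub>v unit_vec r j"
      using X Y j by (intro mult_minus_distrib_mat_vec) auto
    also have "X *\<^sub>v col (Y * X) j = col (X * (Y * X)) j"
      using X Y j by (intro col_mult2[symmetric, of _ N r _ r]) auto
    also have "\<dots> = col X j" by (simp add: eq)
    also have "X *\<^sub>v unit_vec r j = col X j" using X j by (simp add: mult_mat_unit_vec)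
    finally have "X *\<^sub>v (col (Y * X) j - unit_vec r j) = 0\<^sub>v N" using X by auto
    then have z: "col (Y * X) j - unit_vec r j = 0\<^sub>v r"
      using X Y by (intro inj carrier_vecI) auto
    have "col (Y * X) j = unit_vec r j"
    proof (rule eq_vecI)
      fix i assume "i < dim_vec (unit_vec r j :: 'a vec)"
      then have i: "i < r" by simp
      have "(col (Y * X) j - unit_vec r j) $ i = 0" using z i by simp
      then show "col (Y * X) j $ i = unit_vec r j $ i" using i by simp
    qed (use X Y in auto)
    then show "col (Y * X) j = col (1\<^sub>m r) j" using j by simp
  qed (use X Y in auto)
  then have 1: "emb Y * emb X = corner r" using emb_mult[OF Y X] by (simp add: emb_one)
  have 2: "emb X * emb Y = emb P" using emb_mult[OF X Y] PY by simp
  have "idem (emb P)" using emb_mult[OF P P] id by (simp add: idem_def)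
  then show ?thesis unfolding r rk_def using 1 2
    by (intro mvnI[of _ _ "emb X" "emb Y"]) auto
qed

lemma ex_rk: "in_corner N p \<Longrightarrow> idem p \<Longrightarrow> \<exists>r. rk p r"
proof -
  assume "in_corner N p" "idem p"
  then have "emb (unemb N p * unemb N p) = emb (unemb N p)"
    by (subst emb_mult[of _ N N _ N]) (auto simp: emb_unemb idem_def)
  then have "unemb N p * unemb N p = unemb N p"
    by (intro emb_inj[of _ N]) auto
  then show ?thesis using rk_mrank[of "unemb N p" N] emb_unemb[OF \<open>in_corner N p\<close>] by auto
qed

text \<open>The ranks of \<open>p\<close> and of its complement add up to that of
  \<open>corner N\<close>, which is \<open>N\<close> by uniqueness.\<close>

lemma rk_complement:
  assumes "in_corner N p" "rk p r"
  shows "rk (corner N - p) (N - r)" and "r \<le> N"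
proof -
  have p: "p * p = p" using assms(2) mvn_idem by (auto simp: rk_def idem_def)
  note c = in_cornerD[OF assms(1)]
  have i: "in_corner N (corner N - p)" "idem (corner N - p)"
    using assms(1) p c by (auto intro: in_corner_intros simp: idem_def algebra_simps)
  obtain s where s: "rk (corner N - p) s" using ex_rk[OF i] by blast
  have "rk (p + (corner N - p)) (r + s)"
    using assms s p c by (intro rk_add) (auto simp: algebra_simps)
  then have "r + s = N" using rk_unique[OF rk_corner] by fastforce
  then show "rk (corner N - p) (N - r)" "r \<le> N" using s by auto
qed

text \<open>A cancellation law that rests on finiteness of the ranks. It is what extends a partial
  intertwiner to an invertible one.\<close>

lemma mvn_complement:
  assumes "in_corner N p" "in_corner N q" "mvn p q"
  shows "mvn (corner N - p) (corner N - q)"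
proof -
  obtain r where r: "rk p r" using ex_rk[OF assms(1)] mvn_idem[OF assms(3)] by blast
  then have "rk q r" using assms(3) mvn_rk by blast
  then show ?thesis using rk_complement[OF assms(1) r] rk_complement[OF assms(2)] rk_mvn by blast
qed

lemma rk_le:
  assumes "in_corner N p" "rk p r"
  shows "r \<le> N"
  using rk_complement assms by blast

section \<open>Jordan frames and their matrix units\<close>

text \<open>Multiplying the relation by \<open>e\<close> from either side gives
  \<open>e * x = - e * x * e = x * e\<close>; absence of 2-torsion finishes.\<close>

lemma idem_anticommute_zero:
  fixes e x :: "'r::ring_1"
  assumes two: "\<And>x::'r. x + x = 0 \<Longrightarrow> x = 0" and k: "e * e = e" and 0: "e * x + x * e = 0"
  shows "e * x = 0" "x * e = 0"
proof -
  have "e * (e * x + x * e) = 0" "(e * x + x * e) * e = 0" using 0 by simp_all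
  then have 1: "e * x + e * x * e = 0" and 2: "e * x * e + x * e = 0"
    using k by (simp_all add: distrib_left distrib_right mult.assoc[symmetric]) (simp add: mult.assoc k)
  from 1 2 have 3: "e * x = x * e" by (metis add.commute add_left_cancel)
  then have "x * e + x * e = 0" using 0 by simp
  then show "x * e = 0" by (rule two)
  then show "e * x = 0" using 3 by simp
qed

text \<open>Indices are pairs of a row \<open>i < m\<close> and a flag: the flags tell \<open>X\<close> from \<open>X\<^sup>t\<close> for
  \<open>Full\<close>, and the two halves of the row for \<open>Sympl\<close>.  Multiplying the Jordan matrix unit \<open>u p q\<close>
  by the idempotent of its row isolates one associative matrix unit.\<close>

locale jordan_frame =
  fixes m :: nat and S :: "bool set" and rel :: "bool \<Rightarrow> bool \<Rightarrow> bool"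
    and e :: "nat \<Rightarrow> 'r::ring_1" and u :: "nat \<times> bool \<Rightarrow> nat \<times> bool \<Rightarrow> 'r"
    and adj :: "nat \<times> bool \<Rightarrow> nat \<times> bool \<Rightarrow> bool"
  assumes adj_def: "\<And>p q. adj p q \<longleftrightarrow> fst p < m \<and> fst q < m \<and> snd p \<in> S \<and> snd q \<in> S \<and> rel (snd p) (snd q)"
    and m3: "3 \<le> m"
    and two: "\<And>x::'r. x + x = 0 \<Longrightarrow> x = 0"
    and rel_refl: "\<And>a. rel a a"
    and rel_sym: "\<And>a b. rel a b \<Longrightarrow> rel b a"
    and rel_trans: "\<And>a b c. rel a b \<Longrightarrow> rel b c \<Longrightarrow> rel a c"
    and e_idem: "\<And>i. i < m \<Longrightarrow> e i * e i = e i"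
    and e_orth: "\<And>i j. i < m \<Longrightarrow> j < m \<Longrightarrow> i \<noteq> j \<Longrightarrow> e i * e j = 0"
    and peirce: "\<And>p q. adj p q \<Longrightarrow> fst p \<noteq> fst q \<Longrightarrow> e (fst p) * u p q + u p q * e (fst p) = u p q"
    and peirce': "\<And>p q. adj p q \<Longrightarrow> fst p \<noteq> fst q \<Longrightarrow> e (fst q) * u p q + u p q * e (fst q) = u p q"
    and peirce0: "\<And>p q k. adj p q \<Longrightarrow> fst p \<noteq> fst q \<Longrightarrow> k < m \<Longrightarrow> k \<noteq> fst p \<Longrightarrow> k \<noteq> fst q \<Longrightarrow>
        e k * u p q + u p q * e k = 0"
    and triple: "\<And>p q r. adj p q \<Longrightarrow> adj q r \<Longrightarrow> fst p \<noteq> fst q \<Longrightarrow> fst q \<noteq> fst r \<Longrightarrow> fst p \<noteq> fst r \<Longrightarrow>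
        u p q * u q r + u q r * u p q = u p r"
    and triple0: "\<And>p q q' r. adj p q \<Longrightarrow> adj q' r \<Longrightarrow> q \<noteq> q' \<Longrightarrow> fst q' = fst q \<Longrightarrow>
        fst p \<noteq> fst q \<Longrightarrow> fst q \<noteq> fst r \<Longrightarrow> fst p \<noteq> fst r \<Longrightarrow> u p q * u q' r + u q' r * u p q = 0"
    and diag: "\<And>i j. i < m \<Longrightarrow> j < m \<Longrightarrow> i \<noteq> j \<Longrightarrow>
        e i * (\<Sum>\<alpha>\<in>S. u (i, \<alpha>) (j, \<alpha>) * u (j, \<alpha>) (i, \<alpha>)) = e i"
begin

definition H :: "nat \<times> bool \<Rightarrow> nat \<times> bool \<Rightarrow> 'r" where
  "H p q = e (fst p) * u p q"

lemma adj_sym: "adj p q \<Longrightarrow> adj q p"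
  using rel_sym by (auto simp: adj_def)

lemma adj_trans: "adj p q \<Longrightarrow> adj q r \<Longrightarrow> adj p r"
  using rel_trans by (auto simp: adj_def)

lemma adj_lt: "adj p q \<Longrightarrow> fst p < m" "adj p q \<Longrightarrow> fst q < m"
  by (auto simp: adj_def)

lemma adj_row: "adj p q \<Longrightarrow> k < m \<Longrightarrow> adj p (k, snd q)" "adj p q \<Longrightarrow> k < m \<Longrightarrow> adj p (k, snd p)"
  "adj p q \<Longrightarrow> k < m \<Longrightarrow> adj (k, snd p) q" "adj p q \<Longrightarrow> k < m \<Longrightarrow> adj (k, snd q) q"
  using rel_refl by (auto simp: adj_def)

text \<open>Here the bound \<open>3 \<le> m\<close> enters: for three different rows only one order
  of a product of Peirce components survives multiplication by an idempotent, which turns Jordan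
  products into associative ones.\<close>

lemma ex_third: "\<exists>k<m. k \<noteq> i \<and> k \<noteq> j"
proof -
  have "\<exists>k\<in>{0, 1, 2 :: nat}. k \<noteq> i \<and> k \<noteq> j" by auto
  then obtain k where "k \<in> {0, 1, 2 :: nat}" "k \<noteq> i" "k \<noteq> j" by blast
  then show ?thesis using m3 by (intro exI[of _ k]) auto
qed

lemma e_u_zero:
  assumes "adj p q" "fst p \<noteq> fst q" "k < m" "k \<noteq> fst p" "k \<noteq> fst q"
  shows "e k * u p q = 0" "u p q * e k = 0"
  using idem_anticommute_zero[OF two e_idem[OF assms(3)] peirce0[OF assms]] by auto

text \<open>With \<open>i\<close> and \<open>j\<close> the rows of \<open>p\<close> and
  \<open>q\<close>, the Peirce law for \<open>j\<close> and \<open>e i * e j = 0\<close> give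
  \<open>e i * u p q = e i * u p q * e j\<close>, so \<open>H p q\<close> sits in a single two-sided
  Peirce component.\<close>

lemma H_e:
  assumes "adj p q" "fst p \<noteq> fst q"
  shows "e (fst p) * H p q = H p q" "H p q * e (fst q) = H p q"
proof -
  let ?u = "u p q" and ?i = "e (fst p)" and ?j = "e (fst q)"
  have i: "?i * ?i = ?i" and ij: "?i * ?j = 0"
    using e_idem e_orth assms adj_lt by auto
  show "e (fst p) * H p q = H p q" by (simp add: H_def mult.assoc[symmetric] i)
  have "?i * ?u = ?i * (?j * ?u + ?u * ?j)" using peirce'[OF assms] by simp
  also have "\<dots> = (?i * ?j) * ?u + ?i * ?u * ?j" by (simp add: distrib_left mult.assoc)
  finally show "H p q * e (fst q) = H p q" using ij by (simp add: H_def)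
qed

text \<open>The two Peirce laws leave only the components from \<open>i\<close> to \<open>j\<close>
  and from \<open>j\<close> to \<open>i\<close>; the second one is identified as a unit in
  \<open>u_eq_G\<close>.\<close>

lemma u_eq_H: "adj p q \<Longrightarrow> fst p \<noteq> fst q \<Longrightarrow> u p q = H p q + e (fst q) * u p q"
proof -
  assume a: "adj p q" "fst p \<noteq> fst q"
  let ?u = "u p q" and ?i = "e (fst p)" and ?j = "e (fst q)"
  have "?j * ?i = 0" "?j * ?j = ?j"
    using e_idem[of "fst q"] e_orth[of "fst q" "fst p"] a adj_lt[OF a(1)] by auto
  then have "?j * (?i * ?u + ?u * ?i) = ?j * ?u * ?i"
    by (simp add: distrib_left mult.assoc[symmetric])
  then have 1: "?j * ?u = ?j * ?u * ?i" using peirce[OF a] by simp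
  have "?i * ?i = ?i" using e_idem[of "fst p"] adj_lt[OF a(1)] by auto
  then have "?i * (?i * ?u + ?u * ?i) = ?i * ?u + ?i * ?u * ?i"
    by (simp add: distrib_left mult.assoc[symmetric])
  then have 2: "?i * ?u * ?i = 0" using peirce[OF a] by simp
  have "?u * ?i = (?j * ?u + ?u * ?j) * ?i" using peirce'[OF a] by simp
  also have "\<dots> = ?j * ?u * ?i" using e_orth[of "fst q" "fst p"] a adj_lt[OF a(1)]
    by (simp add: distrib_right mult.assoc)
  finally have "?u * ?i = ?j * ?u" using 1 by simp
  then show ?thesis using peirce[OF a] by (simp add: H_def)
qed

lemma H_u:
  assumes "adj p q" "adj q' r" "fst p \<noteq> fst q" "fst q' \<noteq> fst r" "fst q' = fst q"
  shows "H p q * u q' r = H p q * H q' r"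
  using H_e(2)[OF assms(1,3)] assms(5) by (simp add: H_def[of q' r] mult.assoc[symmetric])

text \<open>Left multiplication by the idempotent of the first row annihilates \<open>u q r\<close>,
  hence the summand of the triple relation in which the factors stand in the wrong order.\<close>

lemma H_mult:
  assumes "adj p q" "adj q r" "fst p \<noteq> fst q" "fst q \<noteq> fst r" "fst p \<noteq> fst r"
  shows "H p q * H q r = H p r"
proof -
  have "e (fst p) * (u p q * u q r + u q r * u p q) = H p q * u q r + (e (fst p) * u q r) * u p q"
    by (simp add: H_def distrib_left mult.assoc)
  also have "e (fst p) * u q r = 0"
    using assms adj_lt[OF assms(1)] by (intro e_u_zero) auto
  also have "H p q * u q r = H p q * H q r" using assms by (intro H_u) auto
  finally show ?thesis using triple[OF assms] by (simp add: H_def[of p r])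
qed

lemma H_mult_zero:
  assumes "adj p q" "adj q' r" "q \<noteq> q'" "fst q' = fst q" "fst p \<noteq> fst q" "fst q \<noteq> fst r" "fst p \<noteq> fst r"
  shows "H p q * H q' r = 0"
proof -
  have "e (fst p) * (u p q * u q' r + u q' r * u p q) = H p q * u q' r + (e (fst p) * u q' r) * u p q"
    by (simp add: H_def distrib_left mult.assoc)
  also have "e (fst p) * u q' r = 0"
    using assms adj_lt[OF assms(1)] by (intro e_u_zero) auto
  also have "H p q * u q' r = H p q * H q' r" using assms by (intro H_u) auto
  finally show ?thesis using triple0[OF assms] by simp
qed

text \<open>A third row is inserted:
  \<open>H p q * H q p' = H p q * H q s * H s p' = H p s * H s p'\<close>. Two detours through the
  same row are compared by way of another one.\<close>

lemma H_loop:
  assumes "adj p q" "adj q p'" "adj p' r" "fst p' = fst p" "fst q \<noteq> fst p" "fst r \<noteq> fst p"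
  shows "H p q * H q p' = H p r * H r p'"
proof -
  have step: "H p q * H q p' = H p s * H s p'"
    if "adj p q" "adj q p'" "adj p' s" "fst q \<noteq> fst p" "fst s \<noteq> fst p" "fst q \<noteq> fst s" for q s
  proof -
    have sp: "adj s p'" by (rule adj_sym[OF that(3)])
    have qs: "adj q s" by (rule adj_trans[OF that(2,3)])
    have "H q p' = H q s * H s p'"
      by (rule H_mult[OF qs sp, symmetric]) (use that assms(4) in auto)
    moreover have "H p q * H q s = H p s"
      by (rule H_mult[OF that(1) qs]) (use that in auto)
    ultimately show ?thesis by (simp add: mult.assoc[symmetric])
  qed
  obtain k where k: "k < m" "k \<noteq> fst p" "k \<noteq> fst q" using ex_third by blast
  show ?thesis
  proof (cases "fst q = fst r")
    case False then show ?thesis using step[OF assms(1-3,5,6)] by blast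
  next
    case True
    define s where "s = (k, snd p')"
    have s: "adj p' s" unfolding s_def using adj_row(2)[OF assms(3)] k(1) by blast
    have ps: "adj p s" by (rule adj_trans[OF adj_trans[OF assms(1,2)] s])
    have "H p q * H q p' = H p s * H s p'"
      by (rule step[OF assms(1,2) s]) (use k assms in \<open>auto simp: s_def\<close>)
    also have "\<dots> = H p r * H r p'"
      by (rule step[OF ps adj_sym[OF s] assms(3)]) (use k assms True in \<open>auto simp: s_def\<close>)
    finally show ?thesis .
  qed
qed

text \<open>The frame axioms say nothing about \<open>u\<close> within one row, so there the unit is
  built as a detour through row 0 or 1; by \<open>H_loop\<close> the choice of the detour is
  immaterial.\<close>

definition G :: "nat \<times> bool \<Rightarrow> nat \<times> bool \<Rightarrow> 'r" where
  "G p q = (if fst p \<noteq> fst q then H p q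
            else let s = (if fst p = 0 then 1 else 0, snd p) in H p s * H s q)"

lemma G_off: "fst p \<noteq> fst q \<Longrightarrow> G p q = H p q"
  by (simp add: G_def)

lemma G_via:
  assumes "adj p q" "fst p = fst q" "adj q s" "fst s \<noteq> fst p"
  shows "G p q = H p s * H s q"
proof -
  define s' :: "nat \<times> bool" where "s' = (if fst p = 0 then 1 else 0, snd p)"
  have a: "adj p s'" unfolding s'_def using adj_row[OF assms(1)] m3 by auto
  have a': "adj s' q" by (rule adj_trans[OF adj_sym[OF a] assms(1)])
  have "G p q = H p s' * H s' q" using assms by (simp add: G_def s'_def Let_def)
  also have "\<dots> = H p s * H s q" 
    by (rule H_loop[OF a a' assms(3)]) (use assms in \<open>auto simp: s'_def\<close>)
  finally show ?thesis .
qed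

lemma G_e: assumes "adj p q" shows "e (fst p) * G p q = G p q" "G p q * e (fst q) = G p q"
proof -
  have "e (fst p) * G p q = G p q \<and> G p q * e (fst q) = G p q"
  proof (cases "fst p = fst q")
    case False then show ?thesis using H_e[OF assms] by (simp add: G_off)
  next
    case True
    obtain k where k: "k < m" "k \<noteq> fst p" using ex_third by blast
    have s: "adj p (k, snd q)" "adj (k, snd q) q"
      using adj_row(1)[OF assms k(1)] adj_row(4)[OF assms k(1)] by auto
    have eq: "G p q = H p (k, snd q) * H (k, snd q) q"
      using k by (intro G_via[OF assms True adj_sym[OF s(2)]]) auto
    have "e (fst p) * G p q = G p q"
      unfolding eq using H_e(1)[OF s(1)] k by (simp add: mult.assoc[symmetric])
    moreover have "G p q * e (fst q) = G p q"
      unfolding eq using H_e(2)[OF s(2)] k True by (simp add: mult.assoc)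
    ultimately show ?thesis by blast
  qed
  then show "e (fst p) * G p q = G p q" "G p q * e (fst q) = G p q" by auto
qed

lemma adj_rows:
  assumes "adj p q" "adj q r" "k < m"
  shows "adj q (k, snd q)" "adj (k, snd q) q" "adj (k, snd q) r" "adj p (k, snd q)"
    "adj (k, snd q) p" "adj r (k, snd q)"
proof -
  show 1: "adj q (k, snd q)" by (rule adj_row(2)[OF assms(2,3)])
  show 2: "adj (k, snd q) q" by (rule adj_sym[OF 1])
  show 3: "adj (k, snd q) r" by (rule adj_trans[OF 2 assms(2)])
  show 4: "adj p (k, snd q)" by (rule adj_trans[OF assms(1) 1])
  show "adj (k, snd q) p" by (rule adj_sym[OF 4])
  show "adj r (k, snd q)" by (rule adj_sym[OF 3])
qed

text \<open>When \<open>q\<close> shares its row with \<open>p\<close> or \<open>r\<close>, detours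
  through fresh rows reduce the claim to \<open>H_mult\<close>; if only \<open>p\<close> and
  \<open>r\<close> share a row, the product is itself an admissible detour.\<close>

lemma G_mult_eq:
  assumes "adj p q" "adj q r"
  shows "G p q * G q r = G p r"
proof -
  note pr = adj_trans[OF assms]
  obtain k where k: "k < m" "k \<noteq> fst q" "k \<noteq> fst r" using ex_third by blast
  define s where "s = (k, snd q)"
  have s: "adj q s" "adj s q" "adj s r" "adj p s" "adj s p" "adj r s"
    unfolding s_def using adj_rows[OF assms k(1)] by simp_all
  have ks: "fst s = k" by (simp add: s_def)
  consider "fst p \<noteq> fst q" "fst q \<noteq> fst r" "fst p \<noteq> fst r" | "fst p \<noteq> fst q" "fst q \<noteq> fst r" "fst p = fst r"
    | "fst p = fst q" "fst q \<noteq> fst r" | "fst p \<noteq> fst q" "fst q = fst r" | "fst p = fst q" "fst q = fst r"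
    by blast
  then show ?thesis
  proof cases
    case 1 then show ?thesis using assms by (simp add: G_off H_mult)
  next
    case 2 then show ?thesis using assms adj_sym pr by (simp add: G_off G_via[of p r q])
  next
    case 3
    then have "G p q * G q r = H p s * (H s q * H q r)"
      using s k ks assms by (simp add: G_off G_via[of p q s] mult.assoc)
    also have "H s q * H q r = H s r" using 3 s ks k assms by (intro H_mult) auto
    also have "H p s * H s r = H p r" using 3 s ks k pr by (intro H_mult) auto
    finally show ?thesis using 3 by (simp add: G_off)
  next
    case 4
    \<comment> \<open>The new detour avoids the row of \<open>p\<close>; the earlier
      \<open>k\<close> avoids only those of \<open>q\<close> and \<open>r\<close>, which coincide in
      this case.\<close>
    obtain k where k: "k < m" "k \<noteq> fst q" "k \<noteq> fst p" using ex_third by blast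
    define s where "s = (k, snd q)"
    have s: "adj q s" "adj s q" "adj s r" "adj p s" "adj s p" "adj r s"
      unfolding s_def using adj_rows[OF assms k(1)] by simp_all
    have ks: "fst s = k" by (simp add: s_def)
    have "G p q * G q r = (H p q * H q s) * H s r"
      using s k ks assms 4 by (simp add: G_off G_via[of q r s] mult.assoc)
    also have "H p q * H q s = H p s" using 4 s ks k assms by (intro H_mult) auto
    also have "H p s * H s r = H p r" using 4 s ks k pr by (intro H_mult) auto
    finally show ?thesis using 4 by (simp add: G_off)
  next
    case 5
    \<comment> \<open>The two factors get different detour rows, so that the inner product joins
      three distinct rows.\<close>
    obtain k' where k': "k' < m" "k' \<noteq> fst q" "k' \<noteq> k" using ex_third by blast
    define t where "t = (k', snd q)"
    have t: "adj q t" "adj t q" "adj t r" "adj p t" "adj t p" "adj r t"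
      unfolding t_def using adj_rows[OF assms k'(1)] by simp_all
    have kt: "fst t = k'" by (simp add: t_def)
    have st: "adj s t" using s t adj_trans by blast
    have "G p q * G q r = H p s * (H s q * H q t) * H t r"
      using s k ks assms 5 t k' kt by (simp add: G_via[of p q s] G_via[of q r t] mult.assoc)
    also have "H s q * H q t = H s t" using 5 s t ks kt k k' by (intro H_mult) auto
    also have "H p s * H s t = H p t" using 5 s t st ks kt k k' by (intro H_mult) auto
    also have "H p t * H t r = G p r"
      using 5 t kt k' pr by (intro G_via[symmetric]) auto
    finally show ?thesis .
  qed
qed

text \<open>For different rows this is orthogonality of the \<open>e\<close>. For one row with
  different flags both factors are routed through fresh rows, distinct from each other, and the
  inner product falls under \<open>H_mult_zero\<close>.\<close>

lemma G_mult_zero: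
  assumes "adj p q" "adj q' r" "q \<noteq> q'"
  shows "G p q * G q' r = 0"
proof (cases "fst q = fst q'")
  case False
  have "G p q * G q' r = (G p q * e (fst q)) * (e (fst q') * G q' r)"
    using G_e assms by simp
  also have "\<dots> = G p q * (e (fst q) * e (fst q')) * G q' r" by (simp only: mult.assoc)
  also have "\<dots> = 0" using e_orth[of "fst q" "fst q'"] False assms adj_lt by auto
  finally show ?thesis .
next
  case True
  obtain k where k: "k < m" "k \<noteq> fst q" using ex_third by blast
  obtain k' where k': "k' < m" "k' \<noteq> fst q" "k' \<noteq> k" using ex_third by blast
  define s where "s = (k, snd q)"
  define t where "t = (k', snd q')"
  have s: "adj p s" "adj s q" and t: "adj q' t" "adj t r"
    unfolding s_def t_def using adj_row(1,4)[OF assms(1) k(1)] adj_row(2,3)[OF assms(2) k'(1)] by auto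
  have "G p q * G q' r = (G p s * G s q) * (G q' t * G t r)"
    using G_mult_eq s t by simp
  also have "\<dots> = G p s * (G s q * G q' t) * G t r" by (simp only: mult.assoc)
  also have "G s q * G q' t = 0"
    using k k' s t True assms by (simp add: G_off s_def t_def H_mult_zero)
  finally show ?thesis by simp
qed

lemma e_eq_sum_G:
  assumes "i < m"
  shows "e i = (\<Sum>\<alpha>\<in>S. G (i, \<alpha>) (i, \<alpha>))"
proof -
  obtain j where j: "j < m" "j \<noteq> i" using ex_third by blast
  have "e i = e i * (\<Sum>\<alpha>\<in>S. u (i, \<alpha>) (j, \<alpha>) * u (j, \<alpha>) (i, \<alpha>))"
    using diag assms j by simp
  also have "\<dots> = (\<Sum>\<alpha>\<in>S. H (i, \<alpha>) (j, \<alpha>) * u (j, \<alpha>) (i, \<alpha>))"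
    by (simp add: sum_distrib_left H_def mult.assoc)
  also have "\<dots> = (\<Sum>\<alpha>\<in>S. G (i, \<alpha>) (i, \<alpha>))"
  proof (rule sum.cong[OF refl])
    fix \<alpha> assume "\<alpha> \<in> S"
    then have a: "adj (i, \<alpha>) (j, \<alpha>)" "adj (j, \<alpha>) (i, \<alpha>)" "adj (i, \<alpha>) (i, \<alpha>)"
      using assms j rel_refl by (auto simp: adj_def)
    then have "H (i, \<alpha>) (j, \<alpha>) * u (j, \<alpha>) (i, \<alpha>) = H (i, \<alpha>) (j, \<alpha>) * H (j, \<alpha>) (i, \<alpha>)"
      using j by (intro H_u) auto
    then show "H (i, \<alpha>) (j, \<alpha>) * u (j, \<alpha>) (i, \<alpha>) = G (i, \<alpha>) (i, \<alpha>)"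
      using a j by (simp add: G_via[of "(i, \<alpha>)" "(i, \<alpha>)" "(j, \<alpha>)"])
  qed
  finally show ?thesis .
qed

end

section \<open>Intertwining two systems of matrix units\<close>

text \<open>Units are indexed only by the pairs in \<open>adj\<close>; keeping this relation
  abstract treats one full system of matrix units and two mutually orthogonal systems alike.\<close>

locale groupoid_units =
  fixes m :: nat and S :: "bool set" and adj :: "nat \<times> bool \<Rightarrow> nat \<times> bool \<Rightarrow> bool"
    and G :: "nat \<times> bool \<Rightarrow> nat \<times> bool \<Rightarrow> 'r::ring_1"
  assumes units_eq: "\<And>p q r. adj p q \<Longrightarrow> adj q r \<Longrightarrow> G p q * G q r = G p r"
    and units_zero: "\<And>p q q' r. adj p q \<Longrightarrow> adj q' r \<Longrightarrow> q \<noteq> q' \<Longrightarrow> G p q * G q' r = 0"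
begin

definition total :: 'r where
  "total = (\<Sum>p\<in>{..<m} \<times> S. G p p)"

end

lemma sum_only_one:
  assumes "finite A" "a \<in> A" "\<And>b. b \<in> A \<Longrightarrow> b \<noteq> a \<Longrightarrow> f b = (0::'b::comm_monoid_add)"
  shows "sum f A = f a"
  using assms by (simp add: sum.remove)

text \<open>In each component one equivalence is chosen, at the base point in row 0 with
  representative flag \<open>c\<close>, and transported along the units to all other indices.
  Independent choices at linked indices would destroy the commutation with the units.\<close>

lemma groupoid_units_intertwine:
  fixes G G' :: "nat \<times> bool \<Rightarrow> nat \<times> bool \<Rightarrow> 'r::ring_1"
  assumes "groupoid_units adj G" and "groupoid_units adj G'"
    and adj: "\<And>p q. adj p q \<Longrightarrow> p \<in> {..<m} \<times> S \<and> q \<in> {..<m} \<times> S \<and> c (snd p) = c (snd q)"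
    and adj': "\<And>p. p \<in> {..<m} \<times> S \<Longrightarrow> adj p (0, c (snd p)) \<and> adj (0, c (snd p)) p \<and> adj p p"
    and mvn: "\<And>\<alpha>. \<alpha> \<in> S \<Longrightarrow> mvn (G (0, c \<alpha>) (0, c \<alpha>)) (G' (0, c \<alpha>) (0, c \<alpha>))"
  shows "\<exists>Q R. mvn_pair (groupoid_units.total m S G) (groupoid_units.total m S G') Q R
    \<and> (\<forall>p q. adj p q \<longrightarrow> Q * G p q = G' p q * Q)"
proof -
  interpret A: groupoid_units m S adj G by fact
  interpret B: groupoid_units m S adj G' by fact
  have "\<exists>x y. \<forall>\<alpha>\<in>S. mvn_pair (G (0, c \<alpha>) (0, c \<alpha>)) (G' (0, c \<alpha>) (0, c \<alpha>)) (x \<alpha>) (y \<alpha>)"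
    using mvn unfolding mvn_def by metis
  then obtain x y where xy: "\<And>\<alpha>. \<alpha> \<in> S \<Longrightarrow>
      mvn_pair (G (0, c \<alpha>) (0, c \<alpha>)) (G' (0, c \<alpha>) (0, c \<alpha>)) (x \<alpha>) (y \<alpha>)" by blast
  have fin: "finite ({..<m} \<times> S)" by simp
  define \<rho> where "\<rho> p = (0::nat, c (snd p))" for p :: "nat \<times> bool"
  have \<rho>: "adj p (\<rho> p)" "adj (\<rho> p) p" "adj p p" "adj (\<rho> p) (\<rho> p)" if "p \<in> {..<m} \<times> S" for p
  proof -
    show 1: "adj p (\<rho> p)" "adj (\<rho> p) p" "adj p p" using adj'[OF that] by (auto simp: \<rho>_def)
    have "\<rho> p \<in> {..<m} \<times> S" using adj[OF 1(1)] by blast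
    from adj'[OF this] show "adj (\<rho> p) (\<rho> p)" by blast
  qed
  have \<rho>_eq: "\<rho> p = \<rho> q" if "adj p q" for p q using adj[OF that] by (simp add: \<rho>_def)
  \<comment> \<open>Read off at the representative flag, so that linked indices share one
    witness.\<close>
  define X where "X p = x (c (snd p))" for p :: "nat \<times> bool"
  define Y where "Y p = y (c (snd p))" for p :: "nat \<times> bool"
  have cS: "c (snd p) \<in> S" and cc: "c (c (snd p)) = c (snd p)" if "p \<in> {..<m} \<times> S" for p
    using adj[OF \<rho>(1)[OF that]] by (auto simp: \<rho>_def)
  have XY: "Y p * X p = G (\<rho> p) (\<rho> p)" "X p * Y p = G' (\<rho> p) (\<rho> p)"
    "G' (\<rho> p) (\<rho> p) * X p = X p" "X p * G (\<rho> p) (\<rho> p) = X p"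
    if "p \<in> {..<m} \<times> S" for p
    using xy[OF cS[OF that]] cc[OF that] by (auto simp: mvn_pair_def \<rho>_def X_def Y_def)
  have X_eq: "X p = X q" if "adj p q" for p q using adj[OF that] by (simp add: X_def)
  define Q where "Q = (\<Sum>p\<in>{..<m} \<times> S. G' p (\<rho> p) * X p * G (\<rho> p) p)"
  define R where "R = (\<Sum>p\<in>{..<m} \<times> S. G p (\<rho> p) * Y p * G' (\<rho> p) p)"
  have QG: "Q * G r s = G' r (\<rho> r) * X r * G (\<rho> r) s" if rs: "adj r s" for r s
  proof -
    have r: "r \<in> {..<m} \<times> S" using adj[OF rs] by blast
    have "Q * G r s = (\<Sum>p\<in>{..<m} \<times> S. G' p (\<rho> p) * X p * (G (\<rho> p) p * G r s))"
      by (simp add: Q_def sum_distrib_right mult.assoc)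
    also have "\<dots> = G' r (\<rho> r) * X r * (G (\<rho> r) r * G r s)"
      by (rule sum_only_one[OF fin r]) (simp add: A.units_zero[OF \<rho>(2) rs])
    finally show ?thesis using A.units_eq[OF \<rho>(2)[OF r] rs] by simp
  qed
  have GQ: "G' r s * Q = G' r (\<rho> s) * X s * G (\<rho> s) s" if rs: "adj r s" for r s
  proof -
    have s: "s \<in> {..<m} \<times> S" using adj[OF rs] by blast
    have "G' r s * Q = (\<Sum>p\<in>{..<m} \<times> S. (G' r s * G' p (\<rho> p)) * X p * G (\<rho> p) p)"
      by (simp add: Q_def sum_distrib_left mult.assoc)
    also have "\<dots> = (G' r s * G' s (\<rho> s)) * X s * G (\<rho> s) s"
      by (rule sum_only_one[OF fin s]) (simp add: B.units_zero[OF rs \<rho>(1)])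
    finally show ?thesis using B.units_eq[OF rs \<rho>(1)[OF s]] by simp
  qed
  have comm: "Q * G p q = G' p q * Q" if "adj p q" for p q
    using QG[OF that] GQ[OF that] \<rho>_eq[OF that] X_eq[OF that] by simp
  have Qr: "Q * G p (\<rho> p) = G' p (\<rho> p) * X p" if p: "p \<in> {..<m} \<times> S" for p
    using QG[OF \<rho>(1)[OF p]] XY(4)[OF p] by (simp add: mult.assoc)
  have lQ: "G' (\<rho> p) p * Q = X p * G (\<rho> p) p" if p: "p \<in> {..<m} \<times> S" for p
    using GQ[OF \<rho>(2)[OF p]] XY(3)[OF p] \<rho>_eq[OF \<rho>(2)[OF p]] by simp
  have RQ: "R * Q = A.total"
    unfolding R_def A.total_def sum_distrib_right
  proof (rule sum.cong[OF refl])
    fix p assume p: "p \<in> {..<m} \<times> S"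
    have "G p (\<rho> p) * Y p * G' (\<rho> p) p * Q = G p (\<rho> p) * Y p * (G' (\<rho> p) p * Q)"
      by (rule mult.assoc)
    also have "\<dots> = G p (\<rho> p) * (Y p * X p) * G (\<rho> p) p"
      by (simp add: lQ[OF p] mult.assoc)
    also have "\<dots> = G p p"
      using XY(1)[OF p] A.units_eq[OF \<rho>(1)[OF p] \<rho>(4)[OF p]] A.units_eq[OF \<rho>(1)[OF p] \<rho>(2)[OF p]] by simp
    finally show "G p (\<rho> p) * Y p * G' (\<rho> p) p * Q = G p p" .
  qed
  have QR: "Q * R = B.total"
    unfolding R_def B.total_def sum_distrib_left
  proof (rule sum.cong[OF refl])
    fix p assume p: "p \<in> {..<m} \<times> S"
    have "Q * (G p (\<rho> p) * Y p * G' (\<rho> p) p) = (Q * G p (\<rho> p)) * Y p * G' (\<rho> p) p"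
      by (simp only: mult.assoc)
    also have "\<dots> = G' p (\<rho> p) * (X p * Y p) * G' (\<rho> p) p"
      by (simp add: Qr[OF p] mult.assoc)
    also have "\<dots> = G' p p"
      using XY(2)[OF p] B.units_eq[OF \<rho>(1)[OF p] \<rho>(4)[OF p]] B.units_eq[OF \<rho>(1)[OF p] \<rho>(2)[OF p]] by simp
    finally show "Q * (G p (\<rho> p) * Y p * G' (\<rho> p) p) = G' p p" .
  qed
  have tot: "A.total * G p q = G p q" "G p q * A.total = G p q"
    "B.total * G' p q = G' p q" "G' p q * B.total = G' p q" if pq: "adj p q" for p q
  proof -
    have p: "p \<in> {..<m} \<times> S" and q: "q \<in> {..<m} \<times> S" using adj[OF pq] by auto
    show "A.total * G p q = G p q" unfolding A.total_def sum_distrib_right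
      by (subst sum_only_one[OF fin p])
        (simp_all add: A.units_zero[OF \<rho>(3) pq] A.units_eq[OF \<rho>(3)[OF p] pq])
    show "G p q * A.total = G p q" unfolding A.total_def sum_distrib_left
      by (subst sum_only_one[OF fin q])
        (simp_all add: A.units_zero[OF pq \<rho>(3)] A.units_eq[OF pq \<rho>(3)[OF q]])
    show "B.total * G' p q = G' p q" unfolding B.total_def sum_distrib_right
      by (subst sum_only_one[OF fin p])
        (simp_all add: B.units_zero[OF \<rho>(3) pq] B.units_eq[OF \<rho>(3)[OF p] pq])
    show "G' p q * B.total = G' p q" unfolding B.total_def sum_distrib_left
      by (subst sum_only_one[OF fin q])
        (simp_all add: B.units_zero[OF pq \<rho>(3)] B.units_eq[OF pq \<rho>(3)[OF q]])
  qed
  have "mvn_pair A.total B.total Q R"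
    unfolding mvn_pair_def
  proof (intro conjI RQ QR)
    have t: "B.total * (G' p (\<rho> p) * z) = G' p (\<rho> p) * z" "A.total * (G p (\<rho> p) * z) = G p (\<rho> p) * z"
      if "p \<in> {..<m} \<times> S" for p z
      using tot(1,3)[OF \<rho>(1)[OF that]] by (simp_all add: mult.assoc[symmetric])
    show "B.total * Q = Q" "A.total * R = R" unfolding Q_def R_def sum_distrib_left
      by (auto intro!: sum.cong simp: mult.assoc t)
    show "Q * A.total = Q" "R * B.total = R" unfolding Q_def R_def sum_distrib_right
      by (auto intro!: sum.cong simp: mult.assoc tot \<rho>)
  qed
  then show ?thesis using comm by blast
qed

section \<open>The Jordan algebras inside infinite matrices\<close>

fun msize :: "jkind \<Rightarrow> nat \<Rightarrow> nat" where
  "msize Sympl m = 2 * m"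
| "msize _ m = m"

text \<open>The Gram matrix of the involution. It is orthogonal, so its transpose is its inverse
  within the corner.\<close>

fun form :: "jkind \<Rightarrow> nat \<Rightarrow> 'a::field imat" where
  "form Sympl m = (\<Sum>i<m. E i (m + i) - E (m + i) i)"
| "form _ m = corner m"

definition star :: "jkind \<Rightarrow> nat \<Rightarrow> 'a::field imat \<Rightarrow> 'a imat" where
  "star T m x = form T m * tr x * tr (form T m)"

text \<open>Fixed points of an involution are closed under the Jordan product for a uniform reason,
  which puts \<open>Sym\<close> and \<open>Sympl\<close> on one footing; \<open>alg_iff\<close> is
  the dictionary to the block description.\<close>

definition ialg :: "jkind \<Rightarrow> nat \<Rightarrow> 'a::field imat set" where
  "ialg T m = {x. in_corner (msize T m) x \<and> (T \<noteq> Full \<longrightarrow> star T m x = x)}"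

lemma ent_form_Sympl:
  "ent (form Sympl m) i j = (if i < m \<and> j = m + i then 1 else if j < m \<and> i = m + j then - 1 else 0)"
proof -
  have "ent (form Sympl m) i j = (\<Sum>k<m. (if k = i \<and> j = m + i then 1 else 0) - (if k = j \<and> i = m + j then 1 else 0))"
    by (auto intro!: sum.cong)
  also have "\<dots> = (if i < m \<and> j = m + i then 1 else 0) - (if j < m \<and> i = m + j then 1 else 0)"
    by (simp add: sum_subtractf sum.delta if_conn(1) cong: if_cong)
  finally show ?thesis by auto
qed

lemma in_corner_form: "in_corner (msize T m) (form T m)"
  by (cases T) (auto simp: in_corner_ent ent_form_Sympl simp del: form.simps(1) split: if_splits)

lemma tr_form: "tr (form T m) = (if T = Sympl then - form T m else form T m)"
  by (cases T) (auto intro!: imat_eqI simp: ent_form_Sympl simp del: form.simps(1))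

lemma form_Sympl_unit:
  "i < m \<Longrightarrow> form Sympl m * E i j = - E (m + i) j"
  "i < m \<Longrightarrow> form Sympl m * E (m + i) j = E i j"
  "i < m \<Longrightarrow> E j i * tr (form Sympl m) = - E j (m + i)"
  "i < m \<Longrightarrow> E j (m + i) * tr (form Sympl m) = E j i"
proof -
  show 1: "form Sympl m * E i j = - E (m + i) j" if "i < m" for i j
    by (rule imat_eqI, subst ent_mult_col[of "{i}"])
      (use that in \<open>auto simp: ent_form_Sympl simp del: form.simps(1)\<close>)
  show 2: "form Sympl m * E (m + i) j = E i j" if "i < m" for i j
    by (rule imat_eqI, subst ent_mult_col[of "{m + i}"])
      (use that in \<open>auto simp: ent_form_Sympl simp del: form.simps(1)\<close>)
  show "i < m \<Longrightarrow> E j i * tr (form Sympl m) = - E j (m + i)"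
    using arg_cong[OF 1[of i j], of tr] by (simp add: tr_mult tr_uminus del: form.simps(1))
  show "i < m \<Longrightarrow> E j (m + i) * tr (form Sympl m) = E j i"
    using arg_cong[OF 2[of i j], of tr] by (simp add: tr_mult tr_uminus del: form.simps(1))
qed

lemma form_mult_tr: "form T m * tr (form T m) = corner (msize T m)"
  "tr (form T m) * form T m = corner (msize T m)"
proof -
  have "form T m * tr (form T m) = corner (msize T m)"
  proof (cases T)
    case Sympl
    have "form Sympl m * tr (form Sympl m) = corner (2 * m)"
    proof (rule imat_eqI)
      fix i j
      show "ent (form Sympl m * tr (form Sympl m)) i j = ent (corner (2 * m)) i j"
        by (subst ent_mult_row[of "{if i < m then m + i else i - m}"])
          (auto simp: ent_form_Sympl simp del: form.simps(1) split: if_splits)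
    qed
    then show ?thesis using Sympl by (simp del: form.simps(1))
  qed simp_all
  then show 1: "form T m * tr (form T m) = corner (msize T m)" .
  then show "tr (form T m) * form T m = corner (msize T m)"
    by (simp add: tr_form split: if_splits)
qed

lemma star_simps:
  "star T m (x + y) = star T m x + star T m y"
  "star T m (x - y) = star T m x - star T m y"
  "star T m (sc c * x) = sc c * star T m x"
  "star T m 0 = 0"
  "star T m (sum f A) = (\<Sum>a\<in>A. star T m (f a))"
  by (auto simp: star_def tr_add tr_minus tr_mult tr_sum algebra_simps sc_left_commute
      sum_distrib_left sum_distrib_right sc_commute)

lemma star_corner: "star T m (corner (msize T m)) = corner (msize T m)"
  by (simp add: star_def form_mult_tr in_cornerD[OF in_corner_form])

lemma in_corner_star: "in_corner (msize T m) x \<Longrightarrow> in_corner (msize T m) (star T m x)"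
  unfolding star_def by (intro in_corner_mult in_corner_intros(7) in_corner_form)

lemma star_mult:
  assumes "in_corner (msize T m) x" "in_corner (msize T m) y"
  shows "star T m (x * y) = star T m y * star T m x"
proof -
  have "star T m y * star T m x = form T m * tr y * ((tr (form T m) * form T m) * tr x) * tr (form T m)"
    by (simp only: star_def mult.assoc)
  also have "\<dots> = star T m (x * y)"
    using in_cornerD[OF in_corner_intros(7)[OF assms(1)]]
    by (simp add: form_mult_tr star_def tr_mult mult.assoc)
  finally show ?thesis by simp
qed

lemma star_star:
  assumes "in_corner (msize T m) x"
  shows "star T m (star T m x) = x"
proof -
  have "star T m (star T m x) = (form T m * form T m) * x * (tr (form T m) * tr (form T m))"
    by (simp add: star_def tr_mult mult.assoc)
  also have "\<dots> = (form T m * tr (form T m)) * x * (form T m * tr (form T m))"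
    by (simp add: tr_form)
  also have "\<dots> = x" using in_cornerD[OF assms] by (simp add: form_mult_tr)
  finally show ?thesis .
qed

text \<open>\<open>star T m p\<close> arises from \<open>tr p\<close> by conjugation with
  \<open>form T m\<close>, and transposition preserves ranks.\<close>

lemma star_rk: "in_corner (msize T m) p \<Longrightarrow> rk p r \<Longrightarrow> rk (star T m p) r"
proof -
  assume p: "in_corner (msize T m) p" and r: "rk p r"
  have t: "rk (tr p) r" by (rule rk_tr[OF r])
  have id: "tr p * tr p = tr p" using t mvn_idem(1) by (auto simp: rk_def idem_def)
  have c: "corner (msize T m) * tr p = tr p"
    using in_cornerD[OF in_corner_intros(7)[OF p]] by auto
  have 1: "tr p * tr (form T m) * (form T m * tr p) = tr p * ((tr (form T m) * form T m) * tr p)"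
    by (simp only: mult.assoc)
  then have 1: "tr p * tr (form T m) * (form T m * tr p) = tr p"
    using id c by (simp add: form_mult_tr)
  have 2: "(form T m * tr p) * (tr p * tr (form T m)) = star T m p"
  proof -
    have "(form T m * tr p) * (tr p * tr (form T m)) = form T m * (tr p * tr p) * tr (form T m)"
      by (simp only: mult.assoc)
    then show ?thesis using id by (simp add: star_def)
  qed
  have "star T m p * star T m p = form T m * (tr p * ((tr (form T m) * form T m) * tr p)) * tr (form T m)"
    by (simp only: star_def mult.assoc)
  then have "idem (star T m p)" using id c by (simp add: form_mult_tr idem_def star_def mult.assoc)
  moreover have "idem (tr p)" using id by (simp add: idem_def)
  ultimately have "mvn (tr p) (star T m p)" using 1 2 by (intro mvnI)
  then show ?thesis using t mvn_rk by blast
qed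

lemma ialg_intros:
  "0 \<in> ialg T m"
  "corner (msize T m) \<in> ialg T m"
  "x \<in> ialg T m \<Longrightarrow> y \<in> ialg T m \<Longrightarrow> x + y \<in> ialg T m"
  "x \<in> ialg T m \<Longrightarrow> sc c * x \<in> ialg T m"
  "x \<in> ialg T m \<Longrightarrow> y \<in> ialg T m \<Longrightarrow> x * y + y * x \<in> ialg T m"
  "x \<in> ialg T m \<Longrightarrow> x * x \<in> ialg T m"
  by (auto simp: ialg_def star_simps star_corner star_mult intro: in_corner_intros in_corner_mult)

lemma ialg_sum: "(\<And>a. a \<in> A \<Longrightarrow> f a \<in> ialg T m) \<Longrightarrow> sum f A \<in> ialg T m"
  by (induction A rule: infinite_finite_induct) (auto intro: ialg_intros)

lemma ialg_corner: "x \<in> ialg T m \<Longrightarrow> in_corner (msize T m) x"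
  by (auto simp: ialg_def)

section \<open>Jordan matrix units\<close>

fun flags :: "jkind \<Rightarrow> bool set" where
  "flags Sym = {False}"
| "flags _ = UNIV"

fun linked :: "jkind \<Rightarrow> bool \<Rightarrow> bool \<Rightarrow> bool" where
  "linked Full a b = (a = b)"
| "linked _ a b = True"

text \<open>The sign with which the involution reflects a matrix unit: in \<open>Sympl\<close>
  different flags point into the skew blocks.\<close>

fun sgn_flags :: "jkind \<Rightarrow> bool \<Rightarrow> bool \<Rightarrow> 'a::field imat" where
  "sgn_flags Sympl a b = (if a = b then 1 else - 1)"
| "sgn_flags _ a b = 1"

text \<open>The reflection of indices induced by the involution, or by transposition in
  \<open>Full\<close>: \<open>off_unit T m p q\<close> and
  \<open>off_unit T m (bar T q) (bar T p)\<close> agree up to sign.\<close>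

fun bar :: "jkind \<Rightarrow> nat \<times> bool \<Rightarrow> nat \<times> bool" where
  "bar Sym (i, a) = (i, a)"
| "bar _ (i, a) = (i, \<not> a)"

fun pos :: "nat \<Rightarrow> nat \<times> bool \<Rightarrow> nat" where
  "pos m (i, a) = (if a then m + i else i)"

fun diag_unit :: "jkind \<Rightarrow> nat \<Rightarrow> nat \<Rightarrow> 'a::field imat" where
  "diag_unit Sympl m i = E i i + E (m + i) (m + i)"
| "diag_unit _ m i = E i i"

text \<open>In \<open>Full\<close> the flag \<open>True\<close> reverses the indices of the unit, so
  that the triple relation has the same shape for both flags; in \<open>Sym\<close> and
  \<open>Sympl\<close> a matrix unit is symmetrised by adding its image under the
  involution.\<close>

fun off_unit :: "jkind \<Rightarrow> nat \<Rightarrow> nat \<times> bool \<Rightarrow> nat \<times> bool \<Rightarrow> 'a::field imat" where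
  "off_unit Full m (i, a) (j, b) = (if a then E j i else E i j)"
| "off_unit Sym m (i, a) (j, b) = E i j + E j i"
| "off_unit Sympl m (i, a) (j, b) = E (pos m (i, a)) (pos m (j, b))
     + (if a = b then 1 else - 1) * E (pos m (j, \<not> b)) (pos m (i, \<not> a))"

definition linked_idx :: "jkind \<Rightarrow> nat \<Rightarrow> nat \<times> bool \<Rightarrow> nat \<times> bool \<Rightarrow> bool" where
  "linked_idx T m p q \<longleftrightarrow> fst p < m \<and> fst q < m \<and> snd p \<in> flags T \<and> snd q \<in> flags T
     \<and> linked T (snd p) (snd q)"

lemma add_neq_less [simp]: "j < m \<Longrightarrow> m + i \<noteq> (j::nat)" "j < m \<Longrightarrow> j \<noteq> m + i"
  by auto

lemma star_E_Sympl:
  assumes "i < m" "j < m"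
  shows "star Sympl m (E (pos m (i, a)) (pos m (j, b)))
    = (if a = b then 1 else - 1) * E (pos m (j, \<not> b)) (pos m (i, \<not> a))"
  using assms
  by (cases a; cases b)
    (simp_all add: star_def form_Sympl_unit mult.assoc del: form.simps(1))

lemma star_E_Sym: "i < m \<Longrightarrow> j < m \<Longrightarrow> star Sym m (E i j) = E j i"
  by (simp add: star_def in_cornerD[OF in_corner_intros(8)])

lemma diag_unit_ialg: "i < m \<Longrightarrow> (diag_unit T m i :: 'a::field imat) \<in> ialg T m"
proof -
  assume i: "i < m"
  show ?thesis
  proof (cases T)
    case Sympl
    have "star Sympl m (E i i :: 'a imat) = E (m + i) (m + i)" "star Sympl m (E (m + i) (m + i) :: 'a imat) = E i i"
      using star_E_Sympl[OF i i, of False False] star_E_Sympl[OF i i, of True True] by simp_all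
    then show ?thesis using Sympl i by (auto simp: ialg_def star_simps intro!: in_corner_intros)
  qed (use i in \<open>auto simp: ialg_def star_E_Sym intro!: in_corner_intros\<close>)
qed

lemma off_unit_eq_star:
  assumes "fst p < m" "fst q < m"
  shows "off_unit Sympl m p q = E (pos m p) (pos m q) + star Sympl m (E (pos m p) (pos m q))"
    "off_unit Sym m p q = E (fst p) (fst q) + star Sym m (E (fst p) (fst q))"
proof -
  obtain i a j b where p: "p = (i, a)" "q = (j, b)" by (cases p; cases q)
  have lt: "i < m" "j < m" using assms p by auto
  show "off_unit Sympl m p q = E (pos m p) (pos m q) + star Sympl m (E (pos m p) (pos m q))"
    unfolding p off_unit.simps star_E_Sympl[OF lt] ..
  show "off_unit Sym m p q = E (fst p) (fst q) + star Sym m (E (fst p) (fst q))"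
    unfolding p off_unit.simps fst_conv star_E_Sym[OF lt] ..
qed

lemma pos_less: "fst p < m \<Longrightarrow> pos m p < 2 * m"
  by (cases p) auto

lemma off_unit_ialg:
  assumes "linked_idx T m p q"
  shows "(off_unit T m p q :: 'a::field imat) \<in> ialg T m"
proof -
  have lt: "fst p < m" "fst q < m" using assms by (auto simp: linked_idx_def)
  show ?thesis
  proof (cases T)
    case Full then show ?thesis using lt
      by (cases p; cases q) (auto simp: ialg_def intro!: in_corner_intros)
  next
    case Sym
    have c: "in_corner (msize Sym m) (E (fst p) (fst q) :: 'a imat)" using lt by (auto intro: in_corner_intros)
    then show ?thesis unfolding Sym off_unit_eq_star[OF lt] ialg_def
      using star_star[OF c] in_corner_star[OF c] c
      by (auto simp: star_simps add.commute simp del: msize.simps intro: in_corner_intros(3))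
  next
    case Sympl
    have c: "in_corner (msize Sympl m) (E (pos m p) (pos m q) :: 'a imat)"
      using pos_less[OF lt(1)] pos_less[OF lt(2)] by (auto intro: in_corner_intros)
    then show ?thesis unfolding Sympl off_unit_eq_star[OF lt] ialg_def
      using star_star[OF c] in_corner_star[OF c] c
      by (auto simp: star_simps add.commute simp del: msize.simps intro: in_corner_intros(3))
  qed
qed

text \<open>If \<open>x\<close> is fixed by the involution, then \<open>x + x\<close> is the
  combination of the elements \<open>E i j + star T m (E i j)\<close> with the entries of
  \<open>x\<close> as coefficients, and division by 2 is allowed. Each of these elements is zero, an
  off-diagonal unit or a multiple of a diagonal one.\<close>

lemma ialg_span_induct [consumes 2, case_names zero add scale diag off]:
  fixes x :: "'a::field imat"
  assumes two: "(2::'a) \<noteq> 0" and x: "x \<in> ialg T m"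
    and P0: "P 0"
    and Padd: "\<And>x y. x \<in> ialg T m \<Longrightarrow> y \<in> ialg T m \<Longrightarrow> P x \<Longrightarrow> P y \<Longrightarrow> P (x + y)"
    and Psc: "\<And>c x. x \<in> ialg T m \<Longrightarrow> P x \<Longrightarrow> P (sc c * x)"
    and Pd: "\<And>i. i < m \<Longrightarrow> P (diag_unit T m i)"
    and Po: "\<And>p q. linked_idx T m p q \<Longrightarrow> fst p \<noteq> fst q \<Longrightarrow> P (off_unit T m p q)"
  shows "P x"
proof -
  have sum: "P (sum f A) \<and> sum f A \<in> ialg T m" if "\<And>a. a \<in> A \<Longrightarrow> f a \<in> ialg T m \<and> P (f a)"
    for f :: "nat \<Rightarrow> 'a imat" and A
    using that
    by (induction A rule: infinite_finite_induct) (auto intro: P0 Padd ialg_intros)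
  define F :: "nat \<Rightarrow> nat \<Rightarrow> 'a imat"
    where "F i j = (if T = Full then E i j else E i j + star T m (E i j))" for i j
  have F: "F i j \<in> ialg T m \<and> P (F i j)" if ij: "i < msize T m" "j < msize T m" for i j
  proof (cases T)
    case Full
    then show ?thesis
      using ij Pd[of i] Po[of "(i, False)" "(j, False)"] diag_unit_ialg[where 'a='a, of i m T]
        off_unit_ialg[where 'a='a, of T m "(i, False)" "(j, False)"]
      by (cases "i = j") (auto simp: F_def linked_idx_def)
  next
    case Sym
    have eq: "F i j = E i j + E j i" using ij Sym by (simp add: F_def star_E_Sym)
    then show ?thesis
      using ij Pd[of i] Po[of "(i, False)" "(j, False)"] diag_unit_ialg[where 'a='a, of i m T] Sym
        off_unit_ialg[where 'a='a, of T m "(i, False)" "(j, False)"]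
      by (cases "i = j") (auto simp: linked_idx_def intro: Padd ialg_intros)
  next
    case Sympl
    have ex: "\<exists>p. fst p < m \<and> k = pos m p" if "k < 2 * m" for k
      by (cases "k < m", rule exI[of _ "(k, False)"], simp,
          rule exI[of _ "(k - m, True)"], use that in auto)
    obtain p q where p: "fst p < m" "i = pos m p" and q: "fst q < m" "j = pos m q"
      using ex[of i] ex[of j] ij Sympl by auto
    have eq: "F i j = off_unit Sympl m p q"
      using Sympl by (simp add: F_def off_unit_eq_star(1)[OF p(1) q(1)] flip: p(2) q(2))
    consider "fst p \<noteq> fst q" | "p = q" | "fst p = fst q" "p \<noteq> q" by blast
    then show ?thesis
    proof cases
      case 1
      then show ?thesis using eq p q Po[of p q] off_unit_ialg[where 'a='a, of T m p q] Sympl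
        by (simp add: linked_idx_def)
    next
      case 2
      then have "F i j = diag_unit Sympl m (fst p)"
        unfolding eq by (cases p) (auto simp: add.commute)
      then show ?thesis using Pd[of "fst p"] diag_unit_ialg[where 'a='a, of "fst p" m T] Sympl p by simp
    next
      case 3
      \<comment> \<open>Opposite halves of the same row meet on the diagonal of a skew block, where
        symmetrisation yields zero.\<close>
      then have "F i j = 0" unfolding eq by (cases p; cases q) auto
      then show ?thesis by (simp add: P0 ialg_intros)
    qed
  qed
  define M where "M = msize T m"
  have xs: "x = (\<Sum>i<M. \<Sum>j<M. sc (ent x i j) * E i j)"
    unfolding M_def by (rule imat_eq_sum[OF ialg_corner[OF x]])
  have key: "P (\<Sum>i<M. \<Sum>j<M. sc (ent x i j) * F i j)
      \<and> (\<Sum>i<M. \<Sum>j<M. sc (ent x i j) * F i j) \<in> ialg T m"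
    by (intro sum) (auto simp: M_def F Psc intro!: ialg_intros sum[THEN conjunct1] sum[THEN conjunct2])
  show ?thesis
  proof (cases "T = Full")
    case True then show ?thesis using key xs by (simp add: F_def)
  next
    case False
    then have "x + x = (\<Sum>i<M. \<Sum>j<M. sc (ent x i j) * E i j)
        + star T m (\<Sum>i<M. \<Sum>j<M. sc (ent x i j) * E i j)"
      using x xs[symmetric] by (simp add: ialg_def)
    also have "\<dots> = (\<Sum>i<M. \<Sum>j<M. sc (ent x i j) * F i j)"
      using False by (simp add: F_def star_simps sum.distrib distrib_left)
    finally have "P (x + x)" "x + x \<in> ialg T m" using key by auto
    then have "P (sc (1 / 2) * (x + x))" by (rule Psc[rotated])
    moreover have "sc (1 / 2) * (x + x) = x"
      using two by (intro imat_eqI) (simp add: field_simps)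
    ultimately show ?thesis by simp
  qed
qed

lemma diag_unit_mult: "i < m \<Longrightarrow> j < m \<Longrightarrow>
   diag_unit T m i * diag_unit T m j = (if i = j then diag_unit T m i else 0)"
  by (cases T) (auto simp: unit_mat_mult algebra_simps)

lemma diag_unit_sum: "(\<Sum>i<m. diag_unit T m i) = corner (msize T m)"
proof (cases T)
  case Sympl
  have "(\<Sum>i<m. E (m + i) (m + i)) = (\<Sum>i\<in>{m..<2 * m}. E i i :: 'a imat)"
    by (rule sum.reindex_bij_witness[of _ "\<lambda>i. i - m" "\<lambda>i. m + i"]) auto
  moreover have "(\<Sum>i<m. E i i) + (\<Sum>i\<in>{m..<2 * m}. E i i) = (\<Sum>i<2 * m. E i i :: 'a imat)"
    by (subst sum.union_disjoint[symmetric]) (auto intro!: sum.cong)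
  ultimately show ?thesis using Sympl by (simp add: sum.distrib corner_def)
qed (auto simp: corner_def)

lemma off_unit_peirce:
  assumes "linked_idx T m p q" "fst p \<noteq> fst q" "k < m"
  shows "diag_unit T m k * off_unit T m p q + off_unit T m p q * diag_unit T m k
    = (if k = fst p \<or> k = fst q then off_unit T m p q else 0)"
  using assms
  by (cases T; cases p; cases q; cases "snd p"; cases "snd q")
    (auto simp: linked_idx_def unit_mat_mult algebra_simps)

lemma off_unit_triple:
  assumes "linked_idx T m p q" "linked_idx T m q r" "fst p \<noteq> fst q" "fst q \<noteq> fst r" "fst p \<noteq> fst r"
  shows "off_unit T m p q * off_unit T m q r + off_unit T m q r * off_unit T m p q = off_unit T m p r"
  using assms
  by (cases T; cases p; cases q; cases r; cases "snd p"; cases "snd q"; cases "snd r")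
    (auto simp: linked_idx_def unit_mat_mult algebra_simps)

lemma off_unit_triple_zero:
  assumes "linked_idx T m p q" "linked_idx T m q' r" "q \<noteq> q'" "fst q' = fst q"
    "fst p \<noteq> fst q" "fst q \<noteq> fst r" "fst p \<noteq> fst r"
  shows "off_unit T m p q * off_unit T m q' r + off_unit T m q' r * off_unit T m p q = 0"
  using assms
  by (cases T; cases p; cases q; cases q'; cases r; cases "snd p"; cases "snd q"; cases "snd q'"; cases "snd r")
    (auto simp: linked_idx_def unit_mat_mult algebra_simps)

text \<open>These identities supply the frame axiom \<open>diag\<close>: in \<open>Sym\<close> its
  single product is a square, and otherwise the units with flag \<open>True\<close> are those with
  flag \<open>False\<close> reversed, so that the sum over the flags is a Jordan product.\<close>

lemma off_unit_square:
  assumes "i < m" "j < m" "i \<noteq> j"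
  shows "off_unit Sym m (i, a) (j, b) * off_unit Sym m (i, a) (j, b) = (diag_unit Sym m i + diag_unit Sym m j :: 'a::field imat)"
    "T \<noteq> Sym \<Longrightarrow> off_unit T m (i, False) (j, False) * off_unit T m (j, False) (i, False)
      + off_unit T m (j, False) (i, False) * off_unit T m (i, False) (j, False)
      = (diag_unit T m i + diag_unit T m j :: 'a imat)"
    "T \<noteq> Sym \<Longrightarrow> off_unit T m (i, True) (j, True) = (off_unit T m (j, False) (i, False) :: 'a imat)"
proof -
  show "off_unit Sym m (i, a) (j, b) * off_unit Sym m (i, a) (j, b) = (diag_unit Sym m i + diag_unit Sym m j :: 'a::field imat)"
    using assms by (auto simp: unit_mat_mult algebra_simps)
  show "off_unit T m (i, False) (j, False) * off_unit T m (j, False) (i, False)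
      + off_unit T m (j, False) (i, False) * off_unit T m (i, False) (j, False)
      = (diag_unit T m i + diag_unit T m j :: 'a imat)" if "T \<noteq> Sym"
    using assms that by (cases T) (auto simp: unit_mat_mult algebra_simps)
  show "off_unit T m (i, True) (j, True) = (off_unit T m (j, False) (i, False) :: 'a imat)" if "T \<noteq> Sym"
    using assms that by (cases T) (auto simp: add.commute)
qed

lemma off_unit_bar:
  assumes "linked_idx T m p q" "fst p \<noteq> fst q"
  shows "linked_idx T m (bar T q) (bar T p)"
    "off_unit T m p q = sgn_flags T (snd p) (snd q) * (off_unit T m (bar T q) (bar T p) :: 'a::field imat)"
proof -
  show "linked_idx T m (bar T q) (bar T p)"
    using assms by (cases T; cases p; cases q) (auto simp: linked_idx_def)
  show "off_unit T m p q = sgn_flags T (snd p) (snd q) * (off_unit T m (bar T q) (bar T p) :: 'a::field imat)"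
    using assms
    by (cases T; cases p; cases q; cases "snd p"; cases "snd q")
      (auto simp: linked_idx_def algebra_simps)
qed

section \<open>Jordan homomorphisms\<close>

text \<open>The product is taken as \<open>x * y + y * x\<close>, without the factor one half, so
  that the relations between the units are integral; \<open>lift_jhom\<close> removes the
  factor.\<close>

definition jhom :: "jkind \<Rightarrow> nat \<Rightarrow> nat \<Rightarrow> ('a::field imat \<Rightarrow> 'a imat) \<Rightarrow> bool" where
  "jhom T m N \<phi> \<longleftrightarrow>
     (\<forall>x\<in>ialg T m. in_corner N (\<phi> x))
     \<and> (\<forall>x\<in>ialg T m. \<forall>y\<in>ialg T m. \<phi> (x + y) = \<phi> x + \<phi> y)
     \<and> (\<forall>c. \<forall>x\<in>ialg T m. \<phi> (sc c * x) = sc c * \<phi> x)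
     \<and> (\<forall>x\<in>ialg T m. \<forall>y\<in>ialg T m. \<phi> (x * y + y * x) = \<phi> x * \<phi> y + \<phi> y * \<phi> x)"

lemma imat_double_zero: "(2::'a::field) \<noteq> 0 \<Longrightarrow> x + x = 0 \<Longrightarrow> x = (0 :: 'a imat)"
proof (rule imat_eqI)
  fix i j assume "(2::'a) \<noteq> 0" "x + x = 0"
  then have "ent (x + x) i j = 0" by simp
  then have "2 * ent x i j = 0" by simp
  then show "ent x i j = ent 0 i j" using \<open>(2::'a) \<noteq> 0\<close> by simp
qed

lemma imat_double_eq: "(2::'a::field) \<noteq> 0 \<Longrightarrow> x + x = y + y \<Longrightarrow> x = (y :: 'a imat)"
  using imat_double_zero[of "x - y"] by (simp add: algebra_simps)

locale jordan_hom =
  fixes T :: jkind and m N :: nat and \<phi> :: "'a::field imat \<Rightarrow> 'a imat"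
  assumes char2: "(2::'a) \<noteq> 0" and m3: "3 \<le> m" and hom: "jhom T m N \<phi>"
begin

lemma phi_corner: "x \<in> ialg T m \<Longrightarrow> in_corner N (\<phi> x)"
  and phi_add: "x \<in> ialg T m \<Longrightarrow> y \<in> ialg T m \<Longrightarrow> \<phi> (x + y) = \<phi> x + \<phi> y"
  and phi_sc: "x \<in> ialg T m \<Longrightarrow> \<phi> (sc c * x) = sc c * \<phi> x"
  and phi_jordan: "x \<in> ialg T m \<Longrightarrow> y \<in> ialg T m \<Longrightarrow> \<phi> (x * y + y * x) = \<phi> x * \<phi> y + \<phi> y * \<phi> x"
  using hom by (auto simp: jhom_def)

lemma phi_zero [simp]: "\<phi> 0 = 0"
  using phi_add[of 0 0] by (simp add: ialg_intros)

lemma phi_square: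
  assumes "x \<in> ialg T m" shows "\<phi> (x * x) = \<phi> x * \<phi> x"
proof -
  have "\<phi> (x * x) + \<phi> (x * x) = \<phi> x * \<phi> x + \<phi> x * \<phi> x"
    using phi_jordan[OF assms assms] phi_add[of "x * x" "x * x"] assms by (simp add: ialg_intros)
  then show ?thesis by (rule imat_double_eq[OF char2])
qed

lemma phi_sum: "(\<And>a. a \<in> A \<Longrightarrow> f a \<in> ialg T m) \<Longrightarrow> \<phi> (sum f A) = (\<Sum>a\<in>A. \<phi> (f a))"
  by (induction A rule: infinite_finite_induct) (auto simp: phi_add ialg_sum)

definition e :: "nat \<Rightarrow> 'a imat" where "e i = \<phi> (diag_unit T m i)"
definition u :: "nat \<times> bool \<Rightarrow> nat \<times> bool \<Rightarrow> 'a imat" where "u p q = \<phi> (off_unit T m p q)"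

lemma e_idem: "i < m \<Longrightarrow> e i * e i = e i"
  using phi_square[of "diag_unit T m i"] diag_unit_ialg[where 'a='a, of i m T]
  by (simp add: e_def diag_unit_mult)

lemma e_orth:
  assumes "i < m" "j < m" "i \<noteq> j" shows "e i * e j = 0"
proof -
  have "e i * e j + e j * e i = 0"
    using phi_jordan[of "diag_unit T m i" "diag_unit T m j"] diag_unit_ialg[where 'a='a, of i m T]
      diag_unit_ialg[where 'a='a, of j m T] assms by (simp add: e_def diag_unit_mult)
  then show ?thesis
    using idem_anticommute_zero[OF imat_double_zero[OF char2] e_idem[OF assms(1)]] by blast
qed

sublocale jordan_frame m "flags T" "linked T" e u "linked_idx T m"
proof
  note [simp] = diag_unit_ialg off_unit_ialg
  show "linked_idx T m p q \<longleftrightarrow> fst p < m \<and> fst q < m \<and> snd p \<in> flags T \<and> snd q \<in> flags T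
      \<and> linked T (snd p) (snd q)" for p q
    by (simp add: linked_idx_def)
  show "linked T a a" for a by (cases T) auto
  show "linked T a b \<Longrightarrow> linked T b a" for a b by (cases T) auto
  show "linked T a b \<Longrightarrow> linked T b c \<Longrightarrow> linked T a c" for a b c by (cases T) auto
  show "e (fst p) * u p q + u p q * e (fst p) = u p q"
    if "linked_idx T m p q" "fst p \<noteq> fst q" for p q
    using phi_jordan[of "diag_unit T m (fst p)" "off_unit T m p q"] that
      off_unit_peirce[where 'a='a, OF that, of "fst p"] by (auto simp: e_def u_def linked_idx_def)
  show "e (fst q) * u p q + u p q * e (fst q) = u p q"
    if "linked_idx T m p q" "fst p \<noteq> fst q" for p q
    using phi_jordan[of "diag_unit T m (fst q)" "off_unit T m p q"] that
      off_unit_peirce[where 'a='a, OF that, of "fst q"] by (auto simp: e_def u_def linked_idx_def)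
  show "e k * u p q + u p q * e k = 0"
    if "linked_idx T m p q" "fst p \<noteq> fst q" "k < m" "k \<noteq> fst p" "k \<noteq> fst q" for p q k
    using phi_jordan[of "diag_unit T m k" "off_unit T m p q"] that
      off_unit_peirce[where 'a='a, OF that(1,2,3)] by (auto simp: e_def u_def)
  show "u p q * u q r + u q r * u p q = u p r"
    if "linked_idx T m p q" "linked_idx T m q r" "fst p \<noteq> fst q" "fst q \<noteq> fst r" "fst p \<noteq> fst r" for p q r
    using phi_jordan[of "off_unit T m p q" "off_unit T m q r"] that off_unit_triple[where 'a='a, OF that]
    by (auto simp: u_def)
  show "u p q * u q' r + u q' r * u p q = 0"
    if "linked_idx T m p q" "linked_idx T m q' r" "q \<noteq> q'" "fst q' = fst q"
      "fst p \<noteq> fst q" "fst q \<noteq> fst r" "fst p \<noteq> fst r" for p q q' r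
    using phi_jordan[of "off_unit T m p q" "off_unit T m q' r"] that off_unit_triple_zero[where 'a='a, OF that]
    by (auto simp: u_def)
  show "e i * (\<Sum>\<alpha>\<in>flags T. u (i, \<alpha>) (j, \<alpha>) * u (j, \<alpha>) (i, \<alpha>)) = e i"
    if ij: "i < m" "j < m" "i \<noteq> j" for i j
  proof -
    have dd: "\<phi> (diag_unit T m i + diag_unit T m j) = e i + e j"
      using ij by (simp add: e_def phi_add)
    have "(\<Sum>\<alpha>\<in>flags T. u (i, \<alpha>) (j, \<alpha>) * u (j, \<alpha>) (i, \<alpha>)) = e i + e j"
    proof (cases "T = Sym")
      case True
      have o: "off_unit T m (i, False) (j, False) \<in> ialg T m"
        using ij True by (intro off_unit_ialg) (auto simp: linked_idx_def)
      have "off_unit T m (i, False) (j, False) * off_unit T m (i, False) (j, False)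
          = (diag_unit T m i + diag_unit T m j :: 'a imat)"
        using off_unit_square(1)[where 'a='a, OF ij, of False False] True by simp
      then have "u (i, False) (j, False) * u (i, False) (j, False) = e i + e j"
        using phi_square[OF o] dd by (simp only: u_def)
      moreover have "u (j, False) (i, False) = u (i, False) (j, False)"
      proof -
        have "off_unit T m (j, False) (i, False) = (off_unit T m (i, False) (j, False) :: 'a imat)"
          using True by (simp add: add.commute)
        then show ?thesis by (simp only: u_def)
      qed
      ultimately show ?thesis using True by simp
    next
      case False
      have l: "linked_idx T m (i, False) (j, False)" "linked_idx T m (j, False) (i, False)"
        using ij False by (cases T; simp add: linked_idx_def)+
      have S: "flags T = {True, False}" using False by (cases T) auto
      have t: "u (i, True) (j, True) = u (j, False) (i, False)" "u (j, True) (i, True) = u (i, False) (j, False)"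
        using off_unit_square(3)[where 'a='a, OF ij False] off_unit_square(3)[where 'a='a, OF ij(2,1) ij(3)[symmetric] False]
        by (simp_all add: u_def)
      have "u (i, False) (j, False) * u (j, False) (i, False) + u (j, False) (i, False) * u (i, False) (j, False)
          = e i + e j"
        using phi_jordan[OF off_unit_ialg[OF l(1)] off_unit_ialg[OF l(2)]] dd
          off_unit_square(2)[where 'a='a, OF ij False] by (simp only: u_def)
      then show ?thesis by (simp add: S t add.commute)
    qed
    then show ?thesis using e_idem[OF ij(1)] e_orth[OF ij] by (simp add: distrib_left)
  qed
  show "3 \<le> m" by (rule m3)
  show "x = 0" if "x + x = 0" for x :: "'a imat" using that by (rule imat_double_zero[OF char2])
  show "e i * e i = e i" if "i < m" for i using that by (rule e_idem)
  show "e i * e j = 0" if "i < m" "j < m" "i \<noteq> j" for i j using that by (rule e_orth)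
qed

lemma groupoid: "groupoid_units (linked_idx T m) G"
  by unfold_locales (auto intro: G_mult_eq G_mult_zero)

lemma e_u_eq_G: "linked_idx T m p q \<Longrightarrow> fst p \<noteq> fst q \<Longrightarrow> e (fst p) * u p q = G p q"
  by (simp add: G_off H_def)

lemma sgn_flags_sc: "\<exists>c. sgn_flags T a b = (sc c :: 'a imat)"
  by (cases T; cases "a = b") (auto intro: exI[of _ 1] exI[of _ "- 1"] simp: sc_uminus)

text \<open>The remaining Peirce component of \<open>u p q\<close> is a unit as well: up to sign
  \<open>off_unit T m p q\<close> is the unit with reflected indices, whose leading component is
  \<open>G (bar T q) (bar T p)\<close>. For \<open>Full\<close> this summand is the antihomomorphic
  part.\<close>

lemma u_eq_G:
  assumes "linked_idx T m p q" "fst p \<noteq> fst q"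
  shows "u p q = G p q + sgn_flags T (snd p) (snd q) * G (bar T q) (bar T p)"
proof -
  have b: "linked_idx T m (bar T q) (bar T p)" by (rule off_unit_bar(1)[OF assms])
  have f: "fst (bar T q) = fst q" "fst (bar T p) = fst p"
    by (cases T; cases q; simp) (cases T; cases p; simp)
  obtain c where c: "sgn_flags T (snd p) (snd q) = (sc c :: 'a imat)" using sgn_flags_sc by blast
  have "u p q = sc c * u (bar T q) (bar T p)"
    using off_unit_bar(2)[where 'a='a, OF assms] off_unit_ialg[where 'a='a, OF b] c by (simp add: u_def phi_sc)
  then have "e (fst q) * u p q = sc c * (e (fst q) * u (bar T q) (bar T p))"
    by (simp add: sc_left_commute)
  also have "\<dots> = sc c * G (bar T q) (bar T p)"
    using e_u_eq_G[OF b] f assms by simp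
  finally show ?thesis using u_eq_H[OF assms] assms by (simp add: G_off c)
qed

definition unit_image :: "'a imat" where "unit_image = \<phi> (corner (msize T m))"

lemma unit_image_eq: "unit_image = (\<Sum>i<m. e i)"
  unfolding unit_image_def e_def diag_unit_sum[symmetric]
  by (rule phi_sum) (auto intro: diag_unit_ialg)

lemma total_eq: "groupoid_units.total m (flags T) G = unit_image"
  unfolding groupoid_units.total_def[OF groupoid] unit_image_eq
  by (simp add: e_eq_sum_G sum.cartesian_product)

end

section \<open>Conjugacy of Jordan homomorphisms with equal ranks\<close>

context jordan_hom
begin

text \<open>The rank of this base idempotent is the multiplicity of its component. Outside
  \<open>Full\<close> all flags are linked and the ranks agree by \<open>comp_mvn\<close>.\<close>

definition comp :: "bool \<Rightarrow> 'a imat" where "comp \<alpha> = G (0, \<alpha>) (0, \<alpha>)"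

lemma e_corner: "i < m \<Longrightarrow> in_corner N (e i)"
  by (simp add: e_def phi_corner diag_unit_ialg)

lemma u_corner: "linked_idx T m p q \<Longrightarrow> in_corner N (u p q)"
  by (simp add: u_def phi_corner off_unit_ialg)

lemma G_corner:
  assumes "linked_idx T m p q" shows "in_corner N (G p q)"
proof -
  have off: "in_corner N (G p q)" if "linked_idx T m p q" "fst p \<noteq> fst q" for p q
    using that in_corner_mult[OF e_corner u_corner] adj_lt e_u_eq_G[OF that] by metis
  obtain k where k: "k < m" "k \<noteq> fst p" "k \<noteq> fst q" using ex_third by blast
  have s: "linked_idx T m p (k, snd q)" "linked_idx T m (k, snd q) q"
    using adj_row(1,4)[OF assms k(1)] by auto
  have "in_corner N (G p (k, snd q) * G (k, snd q) q)"
    using off[OF s(1)] off[OF s(2)] k by (intro in_corner_mult) auto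
  then show ?thesis using G_mult_eq[OF s] by simp
qed

lemma e_mult_G: "linked_idx T m p q \<Longrightarrow> i < m \<Longrightarrow> e i * G p q = (if i = fst p then G p q else 0)"
  "linked_idx T m p q \<Longrightarrow> i < m \<Longrightarrow> G p q * e i = (if i = fst q then G p q else 0)"
proof -
  assume a: "linked_idx T m p q" and i: "i < m"
  have "e i * G p q = (e i * e (fst p)) * G p q" "G p q * e i = G p q * (e (fst q) * e i)"
    using G_e[OF a] by (simp_all add: mult.assoc) (simp add: mult.assoc[symmetric])
  then show "e i * G p q = (if i = fst p then G p q else 0)"
    "G p q * e i = (if i = fst q then G p q else 0)"
    using G_e[OF a] e_orth[OF i adj_lt(1)[OF a]] e_orth[OF adj_lt(2)[OF a] i] by auto
qed

lemma unit_image_G: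
  assumes a: "linked_idx T m p q"
  shows "unit_image * G p q = G p q" "G p q * unit_image = G p q"
  unfolding unit_image_eq sum_distrib_left sum_distrib_right
  using adj_lt[OF a] by (simp_all add: e_mult_G[OF a])

lemma unit_image_idem: "unit_image * unit_image = unit_image"
  unfolding unit_image_def
  using phi_square[OF ialg_intros(2)] by simp

lemma unit_image_corner: "in_corner N unit_image"
  by (simp add: unit_image_def phi_corner ialg_intros)

lemma linked_refl: "fst p < m \<Longrightarrow> snd p \<in> flags T \<Longrightarrow> linked_idx T m p p"
  using rel_refl by (simp add: linked_idx_def)

lemma G_mvn: "linked_idx T m p q \<Longrightarrow> mvn (G p p) (G q q)"
proof -
  assume a: "linked_idx T m p q"
  have b: "linked_idx T m q p" by (rule adj_sym[OF a])
  have pp: "linked_idx T m p p" "linked_idx T m q q" using adj_trans[OF a b] adj_trans[OF b a] .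
  show ?thesis
    by (rule mvnI[of _ _ "G p q" "G q p"]) (simp_all add: idem_def G_mult_eq a b pp)
qed

lemma comp_idem: "\<alpha> \<in> flags T \<Longrightarrow> idem (comp \<alpha>)" and comp_corner: "\<alpha> \<in> flags T \<Longrightarrow> in_corner N (comp \<alpha>)"
proof -
  assume "\<alpha> \<in> flags T"
  then have l: "linked_idx T m (0, \<alpha>) (0, \<alpha>)" using m3 by (intro linked_refl) auto
  show "idem (comp \<alpha>)" using G_mult_eq[OF l l] by (simp add: comp_def idem_def)
  show "in_corner N (comp \<alpha>)" unfolding comp_def by (rule G_corner[OF l])
qed

lemma rk_e:
  assumes "i < m" "\<And>\<alpha>. \<alpha> \<in> flags T \<Longrightarrow> rk (comp \<alpha>) (r \<alpha>)"
  shows "rk (e i) (\<Sum>\<alpha>\<in>flags T. r \<alpha>)"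
  unfolding e_eq_sum_G[OF assms(1)]
proof (rule rk_sum)
  show "finite (flags T)" by (rule finite_subset[of _ UNIV]) auto
  fix \<alpha> assume \<alpha>: "\<alpha> \<in> flags T"
  then have "linked_idx T m (0, \<alpha>) (i, \<alpha>)" using assms m3 rel_refl by (auto simp: linked_idx_def)
  then show "rk (G (i, \<alpha>) (i, \<alpha>)) (r \<alpha>)"
    using mvn_rk[OF G_mvn assms(2)[OF \<alpha>, unfolded comp_def]] by blast
  fix \<beta> assume \<beta>: "\<beta> \<in> flags T" "\<alpha> \<noteq> \<beta>"
  show "G (i, \<alpha>) (i, \<alpha>) * G (i, \<beta>) (i, \<beta>) = 0"
    using \<alpha> \<beta> assms(1) by (intro G_mult_zero linked_refl) auto
qed

lemma rk_unit_image:
  assumes "\<And>\<alpha>. \<alpha> \<in> flags T \<Longrightarrow> rk (comp \<alpha>) (r \<alpha>)"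
  shows "rk unit_image (m * (\<Sum>\<alpha>\<in>flags T. r \<alpha>))"
proof -
  have "rk (\<Sum>i<m. e i) (\<Sum>i<m. \<Sum>\<alpha>\<in>flags T. r \<alpha>)"
    by (rule rk_sum) (auto intro!: rk_e assms e_orth)
  then show ?thesis by (simp add: unit_image_eq)
qed

lemma comp_mvn: "T \<noteq> Full \<Longrightarrow> \<alpha> \<in> flags T \<Longrightarrow> mvn (comp False) (comp \<alpha>)"
  unfolding comp_def using m3 by (intro G_mvn) (cases T; simp add: linked_idx_def)

lemma rk_unit_image_not_Full:
  assumes "T \<noteq> Full" "rk (comp False) r"
  shows "rk unit_image (msize T m * r)"
proof -
  have "rk unit_image (m * (\<Sum>\<alpha>\<in>flags T. r))"
    using assms mvn_rk[OF comp_mvn] by (intro rk_unit_image) auto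
  moreover have "m * (\<Sum>\<alpha>\<in>flags T. r) = msize T m * r"
    using assms(1) by (cases T) auto
  ultimately show ?thesis by (simp only:)
qed

lemma rk_unit_image_Full:
  assumes "T = Full" "rk (comp False) l" "rk (comp True) k"
  shows "rk unit_image (m * (l + k))"
proof -
  have "rk unit_image (m * (\<Sum>\<alpha>\<in>flags T. if \<alpha> then k else l))"
    using assms by (intro rk_unit_image) auto
  then show ?thesis using assms(1) by (simp add: UNIV_bool add.commute)
qed

text \<open>Written as products of values of \<open>\<phi>\<close>, the base idempotents no longer
  refer to the frame, so their ranks can be followed through compositions with
  automorphisms.\<close>

lemma comp_Full:
  assumes "T = Full"
  shows "comp False = \<phi> (E 0 0) * \<phi> (E 0 1) * \<phi> (E 1 0)"
    "comp True = \<phi> (E 0 0) * \<phi> (E 1 0) * \<phi> (E 0 1)"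
proof -
  have l: "linked_idx T m (0, a) (1, a)" "linked_idx T m (1, a) (0, a)" for a
    using assms m3 by (auto simp: linked_idx_def)
  have "comp a = H (0, a) (1, a) * H (1, a) (0, a)" for a
    using G_mult_eq[OF l(1)[of a] l(2)[of a]] by (simp add: comp_def G_off)
  also have "\<dots>a = H (0, a) (1, a) * u (1, a) (0, a)" for a
    by (rule H_u[symmetric]) (use l[of a] in auto)
  finally have "comp a = e 0 * u (0, a) (1, a) * u (1, a) (0, a)" for a
    by (simp add: H_def)
  from this[of False] this[of True]
  show "comp False = \<phi> (E 0 0) * \<phi> (E 0 1) * \<phi> (E 1 0)"
    "comp True = \<phi> (E 0 0) * \<phi> (E 1 0) * \<phi> (E 0 1)"
    unfolding e_def u_def using assms by simp_all
qed

end

text \<open>Equivalent base idempotents yield an intertwiner between the images of the identity; an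
  equivalence of the complements is added to make it invertible. The spanning induction extends the
  commutation from units to the whole algebra.\<close>

lemma jhom_conjugate:
  fixes \<phi> \<psi> :: "'a::field imat \<Rightarrow> 'a imat"
  assumes "jordan_hom T m N \<phi>" and "jordan_hom T m N \<psi>"
    and mvn: "\<And>\<alpha>. \<alpha> \<in> flags T \<Longrightarrow> mvn (jordan_hom.comp T m \<phi> \<alpha>) (jordan_hom.comp T m \<psi> \<alpha>)"
  shows "\<exists>Q R. in_corner N Q \<and> in_corner N R \<and> Q * R = corner N \<and> R * Q = corner N
    \<and> (\<forall>x\<in>ialg T m. Q * \<phi> x = \<psi> x * Q)"
proof -
  interpret A: jordan_hom T m N \<phi> by fact
  interpret B: jordan_hom T m N \<psi> by fact
  \<comment> \<open>Only in \<open>Full\<close> do the flags label separate components; otherwise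
    every flag is linked to \<open>False\<close>.\<close>
  define c where "c \<alpha> = (if T = Full then \<alpha> else False)" for \<alpha>
  have "\<exists>Q R. mvn_pair (groupoid_units.total m (flags T) A.G) (groupoid_units.total m (flags T) B.G) Q R
    \<and> (\<forall>p q. linked_idx T m p q \<longrightarrow> Q * A.G p q = B.G p q * Q)"
  proof (rule groupoid_units_intertwine[where c = c, OF A.groupoid B.groupoid])
    show "p \<in> {..<m} \<times> flags T \<and> q \<in> {..<m} \<times> flags T \<and> c (snd p) = c (snd q)"
      if "linked_idx T m p q" for p q
      using that by (cases T; cases p; cases q) (auto simp: linked_idx_def c_def)
    show "linked_idx T m p (0, c (snd p)) \<and> linked_idx T m (0, c (snd p)) p \<and> linked_idx T m p p"
      if "p \<in> {..<m} \<times> flags T" for p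
      using that A.m3 by (cases T; cases p) (auto simp: linked_idx_def c_def)
    show "mvn (A.G (0, c \<alpha>) (0, c \<alpha>)) (B.G (0, c \<alpha>) (0, c \<alpha>))" if "\<alpha> \<in> flags T" for \<alpha>
    proof -
      have "c \<alpha> \<in> flags T" using that by (cases T) (auto simp: c_def)
      then show ?thesis using mvn by (simp add: A.comp_def B.comp_def)
    qed
  qed
  then obtain Q0 R0 where pair: "mvn_pair A.unit_image B.unit_image Q0 R0"
    and int: "\<And>p q. linked_idx T m p q \<Longrightarrow> Q0 * A.G p q = B.G p q * Q0"
    unfolding A.total_eq B.total_eq by blast
  \<comment> \<open>All units are annihilated by the complements of the images of the identity, so
    any equivalence of these complements may be added to \<open>Q0\<close>.\<close>
  have "mvn (corner N - A.unit_image) (corner N - B.unit_image)"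
    using pair A.unit_image_corner B.unit_image_corner
    by (intro mvn_complement) (auto simp: mvn_def)
  then obtain x0 y0 where pair0: "mvn_pair (corner N - A.unit_image) (corner N - B.unit_image) x0 y0"
    unfolding mvn_def by blast
  let ?p = A.unit_image and ?q = B.unit_image
  let ?p' = "corner N - ?p" and ?q' = "corner N - ?q"
  have Q0: "R0 * Q0 = ?p" "Q0 * R0 = ?q" "?q * Q0 = Q0" "Q0 * ?p = Q0" "?p * R0 = R0" "R0 * ?q = R0"
    using pair by (auto simp: mvn_pair_def)
  have x0: "y0 * x0 = ?p'" "x0 * y0 = ?q'" "?q' * x0 = x0" "x0 * ?p' = x0" "?p' * y0 = y0" "y0 * ?q' = y0"
    using pair0 by (auto simp: mvn_pair_def)
  have pp: "?p * ?p = ?p" "?q * ?q = ?q" by (rule A.unit_image_idem, rule B.unit_image_idem)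
  have pc: "corner N * ?p = ?p" "?p * corner N = ?p" "corner N * ?q = ?q" "?q * corner N = ?q"
    using in_cornerD[OF A.unit_image_corner] in_cornerD[OF B.unit_image_corner] by auto
  have orth: "?p * ?p' = 0" "?p' * ?p = 0" "?q * ?q' = 0" "?q' * ?q = 0"
    using pp pc by (simp_all add: algebra_simps)
  have sandwich: "a * b = 0" if "a * p = a" "q * b = b" "p * q = 0" for a b p q :: "'a imat"
    by (metis that mult.assoc mult_zero_left mult_zero_right)
  have cr: "Q0 * y0 = 0" "x0 * R0 = 0" "R0 * x0 = 0" "y0 * Q0 = 0"
    using sandwich[OF Q0(4) x0(5) orth(1)] sandwich[OF x0(4) Q0(5) orth(2)]
      sandwich[OF Q0(6) x0(3) orth(3)] sandwich[OF x0(6) Q0(3) orth(4)] .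
  have corner_of: "in_corner N a" if "q * a = a" "a * p = a" "in_corner N p" "in_corner N q" for a p q :: "'a imat"
    using that in_cornerD unfolding in_corner_def by (metis mult.assoc)
  have c': "in_corner N ?p'" "in_corner N ?q'"
    using A.unit_image_corner B.unit_image_corner by (auto intro: in_corner_intros)
  have cor: "in_corner N Q0" "in_corner N R0" "in_corner N x0" "in_corner N y0"
    using corner_of[OF Q0(3,4) A.unit_image_corner B.unit_image_corner]
      corner_of[OF Q0(5,6) B.unit_image_corner A.unit_image_corner]
      corner_of[OF x0(3,4) c'] corner_of[OF x0(5,6) c'(2,1)] .
  define Q where "Q = Q0 + x0"
  define R where "R = R0 + y0"
  have QR: "Q * R = corner N" "R * Q = corner N"
    unfolding Q_def R_def using Q0(1,2) x0(1,2) cr by (simp_all add: distrib_left distrib_right)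
  have x0G: "x0 * A.G p q = 0" "B.G p q * x0 = 0" if "linked_idx T m p q" for p q
    using sandwich[OF x0(4) A.unit_image_G(1)[OF that] orth(2)]
      sandwich[OF B.unit_image_G(2)[OF that] x0(3) orth(3)] by auto
  have QG: "Q * A.G p q = B.G p q * Q" if "linked_idx T m p q" for p q
    using x0G[OF that] int[OF that] by (simp add: Q_def distrib_left distrib_right)
  have "Q * \<phi> x = \<psi> x * Q" if x: "x \<in> ialg T m" for x
    using A.char2 x
  proof (induction x rule: ialg_span_induct)
    case zero then show ?case by simp
  next
    case (add x y) then show ?case by (simp add: A.phi_add B.phi_add distrib_left distrib_right)
  next
    case (scale c x)
    then show ?case by (simp add: A.phi_sc B.phi_sc sc_left_commute mult.assoc)
  next
    case (diag i)
    have "Q * A.e i = B.e i * Q"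
      unfolding A.e_eq_sum_G[OF diag] B.e_eq_sum_G[OF diag] sum_distrib_left sum_distrib_right
      using diag by (intro sum.cong refl QG A.linked_refl) auto
    then show ?case by (simp add: A.e_def B.e_def)
  next
    case (off p q)
    obtain c where c: "sgn_flags T (snd p) (snd q) = (sc c :: 'a imat)" using A.sgn_flags_sc by blast
    have "Q * A.u p q = B.u p q * Q"
      unfolding A.u_eq_G[OF off] B.u_eq_G[OF off] c
      using QG[OF off(1)] QG[OF off_unit_bar(1)[OF off]]
      by (simp add: distrib_left distrib_right sc_left_commute mult.assoc)
    then show ?case by (simp add: A.u_def B.u_def)
  qed
  moreover have "in_corner N Q" "in_corner N R"
    unfolding Q_def R_def using cor by (auto intro: in_corner_intros)
  ultimately show ?thesis using QR by blast
qed

section \<open>Polynomial square roots\<close>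

text \<open>By induction on \<open>f = (X - a) g\<close>: a root \<open>p\<close> of \<open>X\<close> modulo \<open>g\<close> is corrected to \<open>p + c g\<close>, where
  \<open>c\<close> solves a quadratic equation.\<close>

lemma poly_sqrt_mod:
  fixes f :: "'a::field poly"
  assumes ac: "alg_closed_field TYPE('a)" and two: "(2::'a) \<noteq> 0"
    and "f \<noteq> 0" and "poly f 0 \<noteq> 0"
  shows "\<exists>p. f dvd p * p - [:0, 1:]"
  using assms(3,4)
proof (induction "degree f" arbitrary: f)
  case 0
  then have "is_unit f" by (metis is_unit_iff_degree)
  then have "f dvd 0 * 0 - [:0, 1:]" by (rule unit_imp_dvd)
  then show ?case by blast
next
  case (Suc d)
  obtain a where a: "poly f a = 0"
    using ac Suc.hyps(2) unfolding alg_closed_field_def by (metis le_add1 plus_1_eq_Suc)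
  then obtain g where g: "f = [:- a, 1:] * g" using poly_eq_0_iff_dvd by blast
  have g0: "g \<noteq> 0" "poly g 0 \<noteq> 0" "a \<noteq> 0" using Suc.prems g by auto
  have "degree f = Suc (degree g)" unfolding g using g0 by (subst degree_mult_eq) auto
  then have "d = degree g" using Suc.hyps(2) by simp
  then obtain p where "g dvd p * p - [:0, 1:]" using Suc.hyps(1) g0 by blast
  then obtain h where h: "p * p - [:0, 1:] = g * h" by blast
  have "\<exists>c. poly h a + 2 * c * poly p a + c * c * poly g a = 0"
  proof (cases "poly g a = 0")
    \<comment> \<open>The equation is then linear; its leading coefficient is nonzero because the
      value of \<open>p\<close> at \<open>a\<close> squares to \<open>a\<close>, and
      \<open>a\<close> is not 0.\<close>
    case True
    have "poly (p * p - [:0, 1:]) a = 0" unfolding h using True by simp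
    then have "poly p a \<noteq> 0" using g0 by auto
    then show ?thesis using True two by (intro exI[of _ "- poly h a / (2 * poly p a)"]) simp
  next
    case False
    then have "degree [:poly h a, 2 * poly p a, poly g a:] \<ge> 1" by simp
    then obtain c where "poly [:poly h a, 2 * poly p a, poly g a:] c = 0"
      using ac unfolding alg_closed_field_def by blast
    then show ?thesis by (intro exI[of _ c]) (simp add: algebra_simps)
  qed
  then obtain c where c: "poly h a + 2 * c * poly p a + c * c * poly g a = 0" by blast
  define k where "k = h + Polynomial.smult (2 * c) p + Polynomial.smult (c * c) g"
  have "poly k a = 0" using c by (simp add: k_def)
  then have kd: "[:- a, 1:] dvd k" by (simp add: poly_eq_0_iff_dvd)
  have two_c: "Polynomial.smult (2 * c) p = Polynomial.smult c p + Polynomial.smult c p" by (simp flip: smult_add_left)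
  have "(p + Polynomial.smult c g) * (p + Polynomial.smult c g) - [:0, 1:] = (p * p - [:0, 1:]) + g * (Polynomial.smult (2 * c) p + Polynomial.smult (c * c) g)"
    unfolding two_c by (simp add: algebra_simps)
  also have "\<dots> = g * k" unfolding h k_def by (simp add: algebra_simps)
  finally have "f dvd (p + Polynomial.smult c g) * (p + Polynomial.smult c g) - [:0, 1:]"
    using mult_dvd_mono[OF kd dvd_refl[of g]] by (simp only: g mult.commute[of g k])
  then show ?case by blast
qed

text \<open>Horner evaluation. Constant terms go to scalars of the whole ring, not of a corner;
  hence the factor \<open>corner N\<close> in the results on corner elements.\<close>

definition peval :: "'a::field poly \<Rightarrow> 'a imat \<Rightarrow> 'a imat" where
  "peval p x = fold_coeffs (\<lambda>a r. sc a + x * r) p 0"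

lemma peval_0 [simp]: "peval 0 x = 0"
  by (simp add: peval_def)

lemma peval_pCons: "peval (pCons a p) x = sc a + x * peval p x"
  by (cases "p = 0 \<and> a = 0") (auto simp: peval_def)

lemma peval_commute: "y * x = x * y \<Longrightarrow> y * peval p x = peval p x * y"
proof (induction p rule: pCons_induct)
  case (pCons a p)
  have "y * (x * peval p x) = x * (y * peval p x)" using pCons.prems by (simp add: mult.assoc[symmetric])
  then show ?case using pCons by (simp add: peval_pCons algebra_simps sc_commute)
qed simp

lemma peval_add: "peval (p + q) x = peval p x + peval q x"
proof (induction p arbitrary: q rule: pCons_induct)
  case (pCons a p)
  then show ?case by (cases q) (simp add: peval_pCons sc_add algebra_simps)
qed simp

lemma peval_smult: "peval (Polynomial.smult c p) x = sc c * peval p x"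
  by (induction p rule: pCons_induct) (auto simp: peval_pCons sc_mult distrib_left sc_left_commute mult.assoc)

lemma peval_mult: "peval (p * q) x = peval p x * peval q x"
  by (induction p rule: pCons_induct)
    (auto simp: peval_pCons peval_add peval_smult algebra_simps)

lemma peval_sum: "peval (sum f A) x = (\<Sum>a\<in>A. peval (f a) x)"
  by (induction A rule: infinite_finite_induct) (auto simp: peval_add)

lemma peval_monom: "peval (Polynomial.monom c k) x = sc c * x ^ k"
  by (induction k) (auto simp: peval_pCons monom_0 monom_Suc sc_left_commute)

text \<open>There are \<open>N * N + 1\<close> powers with exponent at most \<open>N * N\<close>, in
  a space of dimension \<open>N * N\<close>.\<close>

lemma ex_annihilator:
  assumes x: "in_corner N (x :: 'a::field imat)"
  shows "\<exists>f. f \<noteq> 0 \<and> peval f x * corner N = 0"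
proof -
  define D where "D = N * N"
  \<comment> \<open>Column \<open>k\<close> lists the entries of the \<open>k\<close>-th power; the
    appended zero row makes the matrix square and singular, so that a kernel vector supplies the
    coefficients.\<close>
  define M where "M = mat (Suc D) (Suc D)
    (\<lambda>(r, k). if r < D then ent (x ^ k * corner N) (r div N) (r mod N) else 0)"
  have M: "M \<in> carrier_mat (Suc D) (Suc D)" by (simp add: M_def)
  have "M = mat\<^sub>r (Suc D) (Suc D) (\<lambda>i. if i = D then 0\<^sub>v (Suc D) else row M i)"
    by (rule eq_matI) (auto simp: M_def)
  moreover have "det (mat\<^sub>r (Suc D) (Suc D) (\<lambda>i. if i = D then 0\<^sub>v (Suc D) else row M i)) = 0"
    using M by (intro det_row_0) auto
  ultimately have "det M = 0" by simp
  then obtain v where v: "v \<in> carrier_vec (Suc D)" "v \<noteq> 0\<^sub>v (Suc D)" "M *\<^sub>v v = 0\<^sub>v (Suc D)"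
    using det_0_iff_vec_prod_zero_field[OF M] by auto
  define f where "f = (\<Sum>k<Suc D. Polynomial.monom (v $ k) k)"
  have cf: "Polynomial.coeff f k = v $ k" if "k < Suc D" for k
    using that by (simp add: f_def coeff_sum sum.delta del: sum.lessThan_Suc)
  have "f \<noteq> 0"
  proof
    assume "f = 0"
    then have "v = 0\<^sub>v (Suc D)" using v(1) cf by (intro eq_vecI) auto
    then show False using v(2) by simp
  qed
  moreover have "peval f x * corner N = 0"
  proof (rule imat_eqI)
    fix i j
    have eq: "peval f x * corner N = (\<Sum>k<Suc D. sc (v $ k) * (x ^ k * corner N))"
      by (simp add: f_def peval_sum peval_monom sum_distrib_right mult.assoc del: sum.lessThan_Suc)
    have pw: "in_corner N (x ^ k * corner N)" for k
      by (induction k) (auto simp: mult.assoc intro: in_corner_intros in_corner_mult x)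
    show "ent (peval f x * corner N) i j = ent 0 i j"
    proof (cases "i < N \<and> j < N")
      case False
      then have "ent (x ^ k * corner N) i j = 0" for k using pw[of k] by (auto simp: in_corner_ent)
      then show ?thesis by (simp add: eq del: sum.lessThan_Suc)
    next
      case True
      define r where "r = i * N + j"
      have rr: "r div N = i" "r mod N = j" using True by (auto simp: r_def)
      have "r < Suc i * N" using True by (simp add: r_def)
      also have "\<dots> \<le> D" unfolding D_def using True by (intro mult_le_mono1) auto
      finally have rD: "r < D" .
      have "(M *\<^sub>v v) $ r = (\<Sum>k<Suc D. ent (x ^ k * corner N) i j * v $ k)"
        using rD v(1) rr by (simp add: M_def scalar_prod_def lessThan_atLeast0 del: sum.lessThan_Suc sum.op_ivl_Suc)
      then have "(\<Sum>k<Suc D. ent (x ^ k * corner N) i j * v $ k) = 0" using v(3) rD by simp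
      then show ?thesis by (simp add: eq mult.commute del: sum.lessThan_Suc)
    qed
  qed
  ultimately show ?thesis by blast
qed

text \<open>In an annihilator of least degree a zero constant term would let the invertible
  \<open>x\<close> be cancelled, lowering the degree.\<close>

lemma ex_annihilator_nonzero:
  assumes x: "in_corner N (x :: 'a::field imat)" and y: "y * x = corner N"
  shows "\<exists>f. f \<noteq> 0 \<and> poly f 0 \<noteq> 0 \<and> peval f x * corner N = 0"
proof -
  obtain f where f: "f \<noteq> 0" "peval f x * corner N = 0"
    and min: "\<And>g. g \<noteq> 0 \<and> peval g x * corner N = 0 \<Longrightarrow> degree f \<le> degree g"
    using ex_has_least_nat[of "\<lambda>f. f \<noteq> 0 \<and> peval f x * corner N = 0" _ degree] ex_annihilator[OF x]
    by blast
  have "poly f 0 \<noteq> 0"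
  proof
    assume "poly f 0 = 0"
    then obtain g where g: "f = pCons 0 g" by (cases f) auto
    then have g0: "g \<noteq> 0" using f by auto
    have "x * (peval g x * corner N) = 0" using f(2) by (simp add: g peval_pCons mult.assoc)
    then have "(y * x) * (peval g x * corner N) = 0" by (simp add: mult.assoc)
    moreover have "corner N * peval g x = peval g x * corner N"
      by (rule peval_commute) (simp add: in_cornerD[OF x])
    ultimately have "peval g x * corner N = 0" using y
      by (metis corner_idem mult.assoc)
    then have "degree f \<le> degree g" using min g0 by blast
    then show False using g0 by (simp add: g)
  qed
  then show ?thesis using f by blast
qed

text \<open>Some \<open>f\<close> with nonzero constant term annihilates \<open>x\<close>; modulo
  \<open>f\<close> the indeterminate is a square, and evaluation at \<open>x\<close> turns this
  congruence into an equality.\<close>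

lemma ex_sqrt:
  fixes x :: "'a::field imat"
  assumes ac: "alg_closed_field TYPE('a)" and two: "(2::'a) \<noteq> 0"
    and x: "in_corner N x" and y: "y * x = corner N"
  shows "\<exists>p. (corner N * peval p x) * (corner N * peval p x) = x"
proof -
  obtain f where f: "f \<noteq> 0" "poly f 0 \<noteq> 0" "peval f x * corner N = 0"
    using ex_annihilator_nonzero[OF x y] by blast
  obtain p where "f dvd p * p - [:0, 1:]" using poly_sqrt_mod[OF ac two f(1,2)] by blast
  then obtain g where "p * p - [:0, 1:] = f * g" by blast
  then have "p * p = g * f + [:0, 1:]" by (simp add: algebra_simps)
  then have "peval p x * peval p x = peval g x * peval f x + x"
    by (simp add: peval_mult[symmetric] peval_add) (simp add: peval_mult peval_pCons)
  then have "(peval p x * peval p x) * corner N = x * corner N"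
    using f(3) by (simp add: distrib_right mult.assoc)
  moreover have "corner N * peval p x = peval p x * corner N"
    by (rule peval_commute) (simp add: in_cornerD[OF x])
  then have "(corner N * peval p x) * (corner N * peval p x) = (peval p x * peval p x) * corner N"
    by (metis corner_idem mult.assoc)
  ultimately show ?thesis using in_cornerD[OF x] by auto
qed

text \<open>The involution reverses products, but the powers of \<open>x\<close> commute with each
  other, so the reversal has no effect.\<close>

lemma star_peval:
  assumes "in_corner (msize A n) x" "star A n x = x"
  shows "star A n (corner (msize A n) * peval p x) = corner (msize A n) * peval p x"
proof (induction p rule: pCons_induct)
  case 0 then show ?case by (simp add: star_simps)
next
  case (pCons a p)
  let ?c = "corner (msize A n)"
  have cx: "?c * x = x * ?c" using in_cornerD[OF assms(1)] by simp
  have cp: "?c * peval p x = peval p x * ?c" by (rule peval_commute[OF cx])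
  have ic: "in_corner (msize A n) (?c * peval p x)"
    by (simp add: in_corner_def mult.assoc cp[symmetric]) (simp add: mult.assoc[symmetric])
  have eq: "?c * peval (pCons a p) x = sc a * ?c + x * (?c * peval p x)"
    by (simp add: peval_pCons distrib_left sc_commute) (simp add: cx mult.assoc[symmetric])
  have xp: "(?c * peval p x) * x = x * (?c * peval p x)"
    using peval_commute[OF refl, of x p] cx by (metis mult.assoc)
  show ?case unfolding eq
    by (simp add: star_simps star_corner star_mult[OF assms(1) ic] pCons.IH assms(2) xp)
qed

text \<open>Applying the involution to the intertwining relation shows that
  \<open>t = star A n Q * Q\<close> commutes with every \<open>\<phi> x\<close>; hence so does its
  square root \<open>S\<close>, being a polynomial in \<open>t\<close>, and division by
  \<open>S\<close> preserves the relation. The product of \<open>U\<close> with its image under the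
  involution is \<open>Q\<close> times the inverse of \<open>t\<close> times
  \<open>star A n Q\<close>, which is the identity.\<close>

lemma isometric_intertwiner:
  fixes Q R :: "'a::field imat"
  assumes ac: "alg_closed_field TYPE('a)" and two: "(2::'a) \<noteq> 0"
    and Q: "in_corner (msize A n) Q" "in_corner (msize A n) R"
    and QR: "Q * R = corner (msize A n)" "R * Q = corner (msize A n)"
    and X: "\<And>x. x \<in> X \<Longrightarrow> Q * \<phi> x = \<psi> x * Q"
      "\<And>x. x \<in> X \<Longrightarrow> \<phi> x \<in> ialg A n" "\<And>x. x \<in> X \<Longrightarrow> \<psi> x \<in> ialg A n" and A: "A \<noteq> Full"
  shows "\<exists>U. in_corner (msize A n) U \<and> U * star A n U = corner (msize A n)
    \<and> star A n U * U = corner (msize A n) \<and> (\<forall>x\<in>X. U * \<phi> x = \<psi> x * U)"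
proof -
  let ?c = "corner (msize A n) :: 'a imat"
  let ?s = "star A n :: 'a imat \<Rightarrow> 'a imat"
  note cm = in_corner_mult and cs = in_corner_star
  have sQ: "in_corner (msize A n) (?s Q)" "in_corner (msize A n) (?s R)" using Q cs by auto
  have sQR: "?s R * ?s Q = ?c" "?s Q * ?s R = ?c"
    using star_mult[OF Q] star_mult[OF Q(2,1)] QR star_corner by metis+
  define t where "t = ?s Q * Q"
  define t' where "t' = R * ?s R"
  have t: "in_corner (msize A n) t" "in_corner (msize A n) t'" unfolding t_def t'_def using Q sQ cm by blast+
  have st: "?s t = t" unfolding t_def using star_mult[OF sQ(1) Q(1)] star_star[OF Q(1)] by simp
  have "t' * t = R * (?s R * ?s Q) * Q" "t * t' = ?s Q * (Q * R) * ?s R"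
    by (simp_all only: t_def t'_def mult.assoc)
  then have tt': "t' * t = ?c" "t * t' = ?c"
    using QR sQR in_cornerD[OF Q(2)] in_cornerD[OF sQ(1)] by simp_all
  obtain p where p: "(?c * peval p t) * (?c * peval p t) = t"
    using ex_sqrt[OF ac two t(1) tt'(1)] by blast
  define S where "S = ?c * peval p t"
  have ct: "?c * t = t * ?c" using in_cornerD[OF t(1)] by simp
  have cp: "?c * peval p t = peval p t * ?c" by (rule peval_commute[OF ct])
  have S: "in_corner (msize A n) S" unfolding S_def
    by (simp add: in_corner_def mult.assoc cp[symmetric]) (simp add: mult.assoc[symmetric])
  have SS: "S * S = t" using p by (simp add: S_def)
  have sS: "?s S = S" unfolding S_def by (rule star_peval[OF t(1) st])
  have Scomm: "y * S = S * y" if "y * t = t * y" "in_corner (msize A n) y" for y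
  proof -
    have "y * S = y * peval p t" unfolding S_def using in_cornerD[OF that(2)] by (simp add: mult.assoc[symmetric])
    also have "\<dots> = peval p t * y" by (rule peval_commute[OF that(1)])
    also have "\<dots> = S * y" unfolding S_def cp using in_cornerD[OF that(2)] by (simp add: mult.assoc)
    finally show ?thesis .
  qed
  have tS: "t' * S = S * t'" using Scomm[OF _ t(2)] tt' by simp
  define S' where "S' = S * t'"
  have S': "in_corner (msize A n) S'" unfolding S'_def using S t cm by blast
  have "S * S' = S * S * t'" "S' * S = S * (t' * S)" by (simp_all only: S'_def mult.assoc)
  then have SS': "S * S' = ?c" "S' * S = ?c" using SS tt' by (simp_all add: tS mult.assoc[symmetric])
  have "S' * S' = S * (t' * S) * t'" by (simp only: S'_def mult.assoc)
  also have "\<dots> = (S * S) * t' * t'" by (simp only: tS mult.assoc)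
  also have "\<dots> = t'" using SS tt' in_cornerD[OF t(2)] by simp
  finally have S'S': "S' * S' = t'" .
  have sS'S: "?s S' * S = ?c" "S * ?s S' = ?c"
    using star_mult[OF S S'] star_mult[OF S' S] SS' sS star_corner by metis+
  have "?s S' = ?s S' * (S * S')" using SS' in_cornerD[OF cs[OF S']] by simp
  also have "\<dots> = (?s S' * S) * S'" by (simp only: mult.assoc)
  also have "\<dots> = S'" using sS'S in_cornerD[OF S'] by simp
  finally have sS': "?s S' = S'" .
  define U where "U = Q * S'"
  have U: "in_corner (msize A n) U" unfolding U_def using Q S' cm by blast
  have sU: "?s U = S' * ?s Q" unfolding U_def using star_mult[OF Q(1) S'] sS' by simp
  have "U * ?s U = Q * (S' * S') * ?s Q" unfolding sU by (simp only: U_def mult.assoc)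
  also have "\<dots> = (Q * R) * (?s R * ?s Q)" unfolding S'S' t'_def by (simp only: mult.assoc)
  also have "\<dots> = ?c" by (simp add: QR sQR)
  finally have 1: "U * ?s U = ?c" .
  have "?s U * U = S' * t * S'" unfolding sU by (simp only: U_def t_def mult.assoc)
  also have "\<dots> = (S' * S) * (S * S')" unfolding SS[symmetric] by (simp only: mult.assoc)
  also have "\<dots> = ?c" by (simp add: SS')
  finally have 2: "?s U * U = ?c" .
  have 3: "U * \<phi> x = \<psi> x * U" if x: "x \<in> X" for x
  proof -
    have c: "in_corner (msize A n) (\<phi> x)" "in_corner (msize A n) (\<psi> x)"
      and s: "?s (\<phi> x) = \<phi> x" "?s (\<psi> x) = \<psi> x"
      using X(2,3)[OF x] A by (auto simp: ialg_def)
    have "?s (Q * \<phi> x) = ?s (\<psi> x * Q)" using X(1)[OF x] by simp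
    then have e: "\<phi> x * ?s Q = ?s Q * \<psi> x" using star_mult Q(1) c s by metis
    have "\<phi> x * t = (\<phi> x * ?s Q) * Q" by (simp only: t_def mult.assoc)
    also have "\<dots> = ?s Q * (\<psi> x * Q)" by (simp only: e mult.assoc)
    also have "\<dots> = t * \<phi> x" by (simp only: X(1)[OF x, symmetric] t_def mult.assoc)
    finally have xt: "\<phi> x * t = t * \<phi> x" .
    have xS: "\<phi> x * S = S * \<phi> x" by (rule Scomm[OF xt c(1)])
    have "S' * \<phi> x = S' * (\<phi> x * (S * S'))" using SS' in_cornerD[OF c(1)] by simp
    also have "\<dots> = S' * (\<phi> x * S) * S'" by (simp only: mult.assoc)
    also have "\<dots> = (S' * S) * \<phi> x * S'" by (simp only: xS mult.assoc)
    also have "\<dots> = \<phi> x * S'" using SS' in_cornerD[OF c(1)] by simp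
    finally have "U * \<phi> x = (Q * \<phi> x) * S'" by (simp only: U_def mult.assoc)
    then show ?thesis by (simp only: X(1)[OF x] U_def mult.assoc)
  qed
  show ?thesis using U 1 2 3 by blast
qed

section \<open>Rank invariants\<close>

definition mrep :: "nat \<Rightarrow> (nat \<Rightarrow> nat \<Rightarrow> 'a::field imat) \<Rightarrow> 'a imat \<Rightarrow> 'a imat" where
  "mrep m g x = (\<Sum>i<m. \<Sum>j<m. sc (ent x i j) * g i j)"

lemma mrep_mult:
  fixes g :: "nat \<Rightarrow> nat \<Rightarrow> 'a::field imat"
  assumes g: "\<And>i j k l. i < m \<Longrightarrow> j < m \<Longrightarrow> k < m \<Longrightarrow> l < m \<Longrightarrow> g i j * g k l = (if j = k then g i l else 0)"
    and x: "in_corner m x"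
  shows "mrep m g x * mrep m g y = mrep m g (x * y)"
proof -
  have 1: "mrep m g x * g k l = (\<Sum>i<m. sc (ent x i k) * g i l)" if kl: "k < m" "l < m" for k l
  proof -
    have "mrep m g x * g k l = (\<Sum>i<m. \<Sum>j<m. sc (ent x i j) * (g i j * g k l))"
      by (simp add: mrep_def sum_distrib_right mult.assoc)
    also have "\<dots> = (\<Sum>i<m. \<Sum>j<m. if k = j then sc (ent x i j) * g i l else 0)"
      using kl g by (intro sum.cong) auto
    also have "\<dots> = (\<Sum>i<m. sc (ent x i k) * g i l)" using kl by (simp add: sum.delta)
    finally show ?thesis .
  qed
  have "ent (x * y) i l = (\<Sum>k<m. ent x i k * ent y k l)" for i l
    by (rule ent_mult_row) (use x in \<open>auto simp: in_corner_ent\<close>)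
  then have exy: "ent (x * y) i l = (\<Sum>k<m. ent y k l * ent x i k)" for i l
    by (simp add: mult.commute)
  have "mrep m g x * mrep m g y = (\<Sum>k<m. \<Sum>l<m. sc (ent y k l) * (mrep m g x * g k l))"
    by (subst (2) mrep_def) (simp add: sum_distrib_left sc_left_commute)
  also have "\<dots> = (\<Sum>k<m. \<Sum>l<m. \<Sum>i<m. sc (ent y k l * ent x i k) * g i l)"
    by (intro sum.cong refl) (simp add: 1 sum_distrib_left sc_mult mult.assoc)
  also have "\<dots> = (\<Sum>k<m. \<Sum>i<m. \<Sum>l<m. sc (ent y k l * ent x i k) * g i l)"
    by (intro sum.cong refl sum.swap)
  also have "\<dots> = (\<Sum>i<m. \<Sum>k<m. \<Sum>l<m. sc (ent y k l * ent x i k) * g i l)"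
    by (rule sum.swap)
  also have "\<dots> = (\<Sum>i<m. \<Sum>l<m. \<Sum>k<m. sc (ent y k l * ent x i k) * g i l)"
    by (intro sum.cong refl sum.swap)
  also have "\<dots> = mrep m g (x * y)"
  proof -
    have "sc (sum f A) = (\<Sum>k\<in>A. sc (f k))" for f :: "nat \<Rightarrow> 'a" and A
      by (induction A rule: infinite_finite_induct) (auto simp: sc_add)
    then show ?thesis by (simp add: mrep_def exy sum_distrib_right)
  qed
  finally show ?thesis .
qed

lemma mrep_orth:
  fixes g h :: "nat \<Rightarrow> nat \<Rightarrow> 'a::field imat"
  assumes "\<And>i j k l. i < m \<Longrightarrow> j < m \<Longrightarrow> k < m \<Longrightarrow> l < m \<Longrightarrow> g i j * h k l = 0"
  shows "mrep m g x * mrep m h y = 0"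
proof -
  have "mrep m g x * h k l = 0" if "k < m" "l < m" for k l
    using that assms by (simp add: mrep_def sum_distrib_right mult.assoc)
  then show ?thesis
    by (subst (2) mrep_def) (simp add: sum_distrib_left sc_left_commute)
qed

lemma mrep_zero [simp]: "mrep m g 0 = 0"
  by (simp add: mrep_def)

lemma mrep_unit: "i < m \<Longrightarrow> j < m \<Longrightarrow> mrep m g (E i j) = g i j"
proof -
  assume "i < m" "j < m"
  have "mrep m g (E i j) = (\<Sum>k<m. \<Sum>l<m. if i = k then (if j = l then g k l else 0) else 0)"
    unfolding mrep_def by (auto intro!: sum.cong)
  also have "\<dots> = (\<Sum>k<m. if i = k then (\<Sum>l<m. if j = l then g k l else 0) else 0)"
    by (intro sum.cong) auto
  finally have "mrep m g (E i j) = (\<Sum>k<m. if i = k then (\<Sum>l<m. if j = l then g k l else 0) else 0)" .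
  then show ?thesis using \<open>i < m\<close> \<open>j < m\<close> by (simp add: sum.delta)
qed

text \<open>On \<open>F_m\<^sup>(\<^sup>+\<^sup>)\<close> a Jordan homomorphism is the sum of a homomorphism and an antihomomorphism
  with orthogonal images; \<open>franks\<close> records the ranks of the images of \<open>E 0 0\<close> under the two.\<close>

definition franks :: "('a::field imat \<Rightarrow> 'a imat) \<Rightarrow> nat \<Rightarrow> nat \<Rightarrow> bool" where
  "franks \<phi> l k \<longleftrightarrow> rk (\<phi> (E 0 0) * \<phi> (E 0 1) * \<phi> (E 1 0)) l \<and> rk (\<phi> (E 0 0) * \<phi> (E 1 0) * \<phi> (E 0 1)) k"

lemma franks_unique: "franks \<phi> l k \<Longrightarrow> franks \<phi> l' k' \<Longrightarrow> l = l' \<and> k = k'"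
  unfolding franks_def using rk_unique by blast

lemma franks_tr_pre: "franks \<phi> l k \<Longrightarrow> franks (\<lambda>x. \<phi> (tr x)) k l"
  by (simp add: franks_def)

lemma franks_id: "franks (\<lambda>x::'a::field imat. x) 1 0"
proof -
  have "E 0 0 * E 0 1 * E 1 0 = (E 0 0 :: 'a imat)" "E 0 0 * E 1 0 * E 0 1 = (0 :: 'a imat)"
    by (simp_all add: unit_mat_mult)
  then show ?thesis unfolding franks_def by (metis rk_unit rk_0)
qed

lemma rk_conj:
  assumes "rk p r" "in_corner N p" "R * Q = corner N"
  shows "rk (Q * p * R) r"
proof -
  have p: "p * p = p" using assms(1) mvn_idem(1) by (auto simp: rk_def idem_def)
  have c: "p * R * (Q * p) = p"
  proof -
    have "p * R * (Q * p) = p * (R * Q) * p" by (simp only: mult.assoc)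
    then show ?thesis using assms in_cornerD[OF assms(2)] p by simp
  qed
  have "Q * p * (p * R) = Q * (p * p) * R" by (simp only: mult.assoc)
  then have 2: "Q * p * (p * R) = Q * p * R" using p by simp
  have "Q * p * R * (Q * p * R) = Q * (p * R * (Q * p)) * R" by (simp only: mult.assoc)
  then have "idem (Q * p * R)" using c by (simp add: idem_def)
  then have "mvn p (Q * p * R)"
    using c 2 p by (intro mvnI[of _ _ "p * R" "Q * p"]) (auto simp: idem_def)
  then show ?thesis using assms(1) mvn_rk by blast
qed

text \<open>On \<open>E i j\<close> the two summands of \<open>u_eq_G\<close> carry the indices in
  the orders \<open>i j\<close> and \<open>j i\<close>; the second order accounts for the
  transpose.\<close>

lemma (in jordan_hom) Full_split:
  assumes "T = Full" "x \<in> ialg T m"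
  shows "\<phi> x = mrep m (\<lambda>i j. G (i, False) (j, False)) x + mrep m (\<lambda>i j. G (i, True) (j, True)) (tr x)"
proof -
  have x: "in_corner m x" using ialg_corner[OF assms(2)] assms(1) by simp
  have E: "E i j \<in> (ialg T m :: 'a imat set)" if "i < m" "j < m" for i j
    using that assms(1) by (auto simp: ialg_def intro: in_corner_intros)
  have unit: "\<phi> (E i j) = G (i, False) (j, False) + G (j, True) (i, True)" if ij: "i < m" "j < m" for i j
  proof (cases "i = j")
    case True
    have "\<phi> (E i i) = e i" unfolding e_def using assms(1) by simp
    then show ?thesis using e_eq_sum_G[OF ij(1)] assms(1) True by (simp add: UNIV_bool add.commute)
  next
    case False
    have l: "linked_idx T m (i, False) (j, False)" using ij assms(1) by (simp add: linked_idx_def)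
    have "\<phi> (E i j) = u (i, False) (j, False)" unfolding u_def using assms(1) by simp
    then show ?thesis using u_eq_G[OF l] False assms(1) by simp
  qed
  have "\<phi> x = \<phi> (\<Sum>i<m. \<Sum>j<m. sc (ent x i j) * E i j)"
    using imat_eq_sum[OF x] by simp
  also have "\<dots> = (\<Sum>i<m. \<Sum>j<m. sc (ent x i j) * \<phi> (E i j))"
  proof -
    have sE: "sc c * E i j \<in> (ialg T m :: 'a imat set)" if "i < m" "j < m" for c i j
      using E[OF that] by (rule ialg_intros(4))
    have "\<phi> (\<Sum>j<m. sc (ent x i j) * E i j) = (\<Sum>j<m. sc (ent x i j) * \<phi> (E i j))" if "i < m" for i
      using sE[OF that] E[OF that] by (subst phi_sum) (auto simp: phi_sc)
    then show ?thesis using sE by (subst phi_sum) (auto intro!: ialg_sum)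
  qed
  also have "\<dots> = (\<Sum>i<m. \<Sum>j<m. sc (ent x i j) * G (i, False) (j, False))
      + (\<Sum>i<m. \<Sum>j<m. sc (ent x i j) * G (j, True) (i, True))"
    by (simp add: unit distrib_left sum.distrib)
  also have "(\<Sum>i<m. \<Sum>j<m. sc (ent x i j) * G (j, True) (i, True))
      = mrep m (\<lambda>i j. G (i, True) (j, True)) (tr x)"
    unfolding mrep_def by (subst sum.swap) simp
  finally show ?thesis by (simp add: mrep_def)
qed

section \<open>The two ranks under composition with transposes and conjugations\<close>

context jordan_hom
begin

abbreviation "homF \<equiv> mrep m (\<lambda>i j. G (i, False) (j, False))"
abbreviation "homT \<equiv> mrep m (\<lambda>i j. G (i, True) (j, True))"

lemma homFT_mult:
  assumes "T = Full" "in_corner m x"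
  shows "homF x * homF y = homF (x * y)" "homT x * homT y = homT (x * y)"
    "homF z * homT w = 0" "homT z * homF w = 0"
proof -
  have l: "linked_idx T m (i, a) (j, a)" if "i < m" "j < m" for i j a
    using that assms(1) by (simp add: linked_idx_def)
  have g: "G (i, a) (j, a) * G (k, b) (r, b) = (if a = b \<and> j = k then G (i, a) (r, b) else 0)"
    if "i < m" "j < m" "k < m" "r < m" for i j k r a b
    using G_mult_eq[OF l[of i j a] l[of j r a]] G_mult_zero[OF l[of i j a] l[of k r b]] that by auto
  show "homF x * homF y = homF (x * y)" "homT x * homT y = homT (x * y)"
    using assms(2) g by (intro mrep_mult; simp)+
  show "homF z * homT w = 0" "homT z * homF w = 0"
    using g by (intro mrep_orth; simp)+
qed

text \<open>The images of \<open>homF\<close> and \<open>homT\<close> annihilate each other, so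
  mixed terms vanish; the antihomomorphic part sees the factors in reverse order.\<close>

lemma triple_product:
  assumes "T = Full" "in_corner m x" "in_corner m y" "in_corner m z"
  shows "\<phi> x * \<phi> y * \<phi> z = homF (x * y * z) + homT (tr (z * y * x))"
proof -
  have i: "x \<in> ialg T m" "y \<in> ialg T m" "z \<in> ialg T m" using assms by (auto simp: ialg_def)
  have c: "in_corner m (tr x)" "in_corner m (x * y)" "in_corner m (tr x * tr y)"
    using assms by (auto intro!: in_corner_mult in_corner_intros(7))
  have "\<phi> x * \<phi> y = homF (x * y) + homT (tr x * tr y)"
    using homFT_mult[OF assms(1,2)] homFT_mult[OF assms(1) c(1)]
    by (simp add: Full_split[OF assms(1) i(1)] Full_split[OF assms(1) i(2)] distrib_left distrib_right)
  then have "\<phi> x * \<phi> y * \<phi> z = (homF (x * y) + homT (tr x * tr y)) * (homF z + homT (tr z))"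
    by (simp add: Full_split[OF assms(1) i(3)])
  also have "\<dots> = homF (x * y * z) + homT (tr x * tr y * tr z)"
    using homFT_mult[OF assms(1) c(2)] homFT_mult[OF assms(1) c(3)]
    by (simp add: distrib_left distrib_right)
  finally show ?thesis by (simp add: tr_mult mult.assoc)
qed

text \<open>The word \<open>E 0 0 * E 0 1 * E 1 0\<close> is \<open>E 0 0\<close> while its reversal
  is 0, so it sees the homomorphic part alone; the other word sees only the antihomomorphic
  part.\<close>

lemma franks_iff:
  assumes "T = Full"
  shows "franks \<phi> l k \<longleftrightarrow> rk (homF (E 0 0)) l \<and> rk (homT (E 0 0)) k"
    and "franks \<phi> l k \<longleftrightarrow> rk (comp False) l \<and> rk (comp True) k"
proof -
  have c: "in_corner m (E i j :: 'a imat)" if "i < 2" "j < 2" for i j using m3 that by (intro in_corner_intros) auto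
  show "franks \<phi> l k \<longleftrightarrow> rk (homF (E 0 0)) l \<and> rk (homT (E 0 0)) k"
    unfolding franks_def
    by (simp add: triple_product[OF assms] c unit_mat_mult del: One_nat_def)
  show "franks \<phi> l k \<longleftrightarrow> rk (comp False) l \<and> rk (comp True) k"
    unfolding franks_def comp_Full[OF assms] ..
qed

text \<open>Transposing the values reverses each word, which exchanges the two parts; the rank of an
  idempotent survives the transposition.\<close>

lemma franks_tr_post:
  assumes "T = Full" "franks \<phi> l k"
  shows "franks (\<lambda>x. tr (\<phi> x)) k l"
proof -
  have c: "in_corner m (E i j :: 'a imat)" if "i < 2" "j < 2" for i j using m3 that by (intro in_corner_intros) auto
  have "\<phi> (E 1 0) * \<phi> (E 0 1) * \<phi> (E 0 0) = homT (E 0 0)"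
    "\<phi> (E 0 1) * \<phi> (E 1 0) * \<phi> (E 0 0) = homF (E 0 0)"
    by (simp_all add: triple_product[OF assms(1)] c unit_mat_mult del: One_nat_def)
  then have "tr (\<phi> (E 0 0)) * tr (\<phi> (E 0 1)) * tr (\<phi> (E 1 0)) = tr (homT (E 0 0))"
    "tr (\<phi> (E 0 0)) * tr (\<phi> (E 1 0)) * tr (\<phi> (E 0 1)) = tr (homF (E 0 0))"
    by (simp_all add: tr_mult[symmetric] mult.assoc)
  moreover have "rk (homF (E 0 0)) l" "rk (homT (E 0 0)) k"
    using assms(2) franks_iff(1)[OF assms(1)] by auto
  ultimately show ?thesis unfolding franks_def by (simp add: rk_tr)
qed

lemma franks_conj_post:
  assumes "T = Full" "franks \<phi> l k" "R * Q = corner N"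
  shows "franks (\<lambda>x. Q * \<phi> x * R) l k"
proof -
  have "E i j \<in> (ialg T m :: 'a imat set)" if "i < 2" "j < 2" for i j
    using m3 that assms(1) by (auto simp: ialg_def intro: in_corner_intros)
  then have c: "in_corner N (\<phi> (E i j))" if "i < 2" "j < 2" for i j using that phi_corner by blast
  have eq: "Q * x * R * (Q * y * R) * (Q * z * R) = Q * (x * y * z) * R" if "in_corner N x" "in_corner N y" for x y z
  proof -
    have "Q * x * R * (Q * y * R) * (Q * z * R) = Q * x * (R * Q) * y * (R * Q) * z * R"
      by (simp only: mult.assoc)
    also have "\<dots> = Q * (x * corner N) * (y * corner N) * z * R" by (simp only: assms(3) mult.assoc)
    finally show ?thesis using in_cornerD[OF that(1)] in_cornerD[OF that(2)] by (simp add: mult.assoc)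
  qed
  show ?thesis using assms(2) unfolding franks_def
    by (auto simp: eq c intro!: rk_conj[OF _ _ assms(3)] in_corner_mult)
qed

text \<open>Among \<open>m\<close> by \<open>m\<close> matrices \<open>P * E 0 0 * P'\<close> is
  equivalent to \<open>E 0 0\<close>, with witnesses \<open>P * E 0 0\<close> and
  \<open>E 0 0 * P'\<close>; both \<open>homF\<close> and, after transposing, \<open>homT\<close>
  carry this to an equivalence of the images.\<close>

lemma franks_conj_pre:
  assumes T: "T = Full" and "franks \<phi> l k" and P: "in_corner m P" "in_corner m P'" "P' * P = corner m"
  shows "franks (\<lambda>x. \<phi> (P * x * P')) l k"
proof -
  have c: "in_corner m (E i j :: 'a imat)" if "i < 2" "j < 2" for i j using m3 that by (intro in_corner_intros) auto
  have cP: "in_corner m (P * E i j * P')" if "i < 2" "j < 2" for i j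
    using P c[OF that] in_corner_mult by blast
  have pr: "(P * x * P') * (P * y * P') * (P * z * P') = P * (x * y * z) * P'"
    if "in_corner m x" "in_corner m y" for x y z
  proof -
    have "(P * x * P') * (P * y * P') * (P * z * P') = P * x * (P' * P) * y * (P' * P) * z * P'"
      by (simp only: mult.assoc)
    also have "\<dots> = P * (x * corner m) * (y * corner m) * z * P'" by (simp only: P(3) mult.assoc)
    finally show ?thesis using in_cornerD[OF that(1)] in_cornerD[OF that(2)] by (simp add: mult.assoc)
  qed
  have "\<phi> (P * E 0 0 * P') * \<phi> (P * E 0 1 * P') * \<phi> (P * E 1 0 * P') = homF (P * E 0 0 * P')"
    "\<phi> (P * E 0 0 * P') * \<phi> (P * E 1 0 * P') * \<phi> (P * E 0 1 * P') = homT (tr (P * E 0 0 * P'))"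
    by (simp_all add: triple_product[OF T] cP pr c unit_mat_mult del: One_nat_def)
  moreover have idE: "E 0 0 * E 0 0 = (E 0 0 :: 'a imat)" by (simp add: unit_mat_mult)
  have PE: "E 0 0 * P' * (P * E 0 0) = E 0 0" "P * E 0 0 * (E 0 0 * P') = P * E 0 0 * P'"
  proof -
    have "E 0 0 * P' * (P * E 0 0) = E 0 0 * (P' * P) * E 0 0" by (simp only: mult.assoc)
    then show "E 0 0 * P' * (P * E 0 0) = E 0 0" using in_cornerD[OF c[of 0 0]] P(3) idE by simp
    have "P * E 0 0 * (E 0 0 * P') = P * (E 0 0 * E 0 0) * P'" by (simp only: mult.assoc)
    then show "P * E 0 0 * (E 0 0 * P') = P * E 0 0 * P'" using idE by simp
  qed
  have cc: "in_corner m (E 0 0 * P')" "in_corner m (P * E 0 0)" using c[of 0 0] P in_corner_mult by auto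
  have idm: "idem (homF (E 0 0))" "idem (homT (E 0 0))"
    using assms(2) mvn_idem(1) unfolding franks_iff(1)[OF T] rk_def by auto
  have sq: "P * E 0 0 * P' * (P * E 0 0 * P') = P * E 0 0 * P'"
  proof -
    have "P * E 0 0 * P' * (P * E 0 0 * P') = P * (E 0 0 * P' * (P * E 0 0)) * P'" by (simp only: mult.assoc)
    then show ?thesis using PE by simp
  qed
  have "mvn (homF (E 0 0)) (homF (P * E 0 0 * P'))"
    using idm PE sq
    by (intro mvnI[of _ _ "homF (E 0 0 * P')" "homF (P * E 0 0)"])
      (auto simp: homFT_mult(1)[OF T] cc idem_def cP[of 0 0])
  moreover have "mvn (homT (E 0 0)) (homT (tr (P * E 0 0 * P')))"
  proof (rule mvnI[of _ _ "homT (tr (P * E 0 0))" "homT (tr (E 0 0 * P'))"])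
    show "idem (homT (tr (P * E 0 0 * P')))"
      using homFT_mult(2)[OF T in_corner_intros(7)[OF cP[of 0 0]]]
      by (simp add: idem_def tr_mult[symmetric] sq del: tr_unit)
    show "homT (tr (P * E 0 0)) * homT (tr (E 0 0 * P')) = homT (E 0 0)"
      using homFT_mult(2)[OF T in_corner_intros(7)[OF cc(2)]] arg_cong[OF PE(1), of tr]
      by (simp add: tr_mult mult.assoc)
    show "homT (tr (E 0 0 * P')) * homT (tr (P * E 0 0)) = homT (tr (P * E 0 0 * P'))"
      using homFT_mult(2)[OF T in_corner_intros(7)[OF cc(1)]] arg_cong[OF PE(2), of tr]
      by (simp add: tr_mult mult.assoc)
  qed (rule idm)
  moreover have "rk (homF (E 0 0)) l" "rk (homT (E 0 0)) k"
    using assms(2) franks_iff(1)[OF T] by auto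
  ultimately show ?thesis
    unfolding franks_def by (auto intro: mvn_rk simp del: One_nat_def)
qed

lemma ex_franks: "T = Full \<Longrightarrow> \<exists>l k. franks \<phi> l k"
  unfolding franks_iff(2) using ex_rk[OF comp_corner comp_idem] by (metis UNIV_I flags.simps(2))

lemma rk_franks: "T = Full \<Longrightarrow> franks \<phi> l k \<Longrightarrow> rk unit_image (m * (l + k))"
  using rk_unit_image_Full franks_iff(2) by blast

lemma ex_rk_not_Full: "T \<noteq> Full \<Longrightarrow> \<exists>r. rk (comp False) r \<and> rk unit_image (msize T m * r)"
proof -
  assume T: "T \<noteq> Full"
  have "False \<in> flags T" by (cases T) auto
  then show ?thesis using ex_rk[OF comp_corner comp_idem] rk_unit_image_not_Full[OF T] by blast
qed

text \<open>The involution of the ambient algebra fixes every \<open>\<phi> (E i j)\<close> and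
  reverses words, so it maps \<open>homF (E 0 0)\<close> to \<open>homT (E 0 0)\<close>; it also
  preserves ranks.\<close>

lemma franks_symmetric:
  assumes T: "T = Full" and A: "A \<noteq> Full" "N = msize A n" "\<And>x. x \<in> ialg T m \<Longrightarrow> \<phi> x \<in> ialg A n"
    and f: "franks \<phi> l k"
  shows "l = k"
proof -
  have c: "in_corner m (E i j :: 'a imat)" if "i < 2" "j < 2" for i j using m3 that by (intro in_corner_intros) auto
  then have "E i j \<in> (ialg T m :: 'a imat set)" if "i < 2" "j < 2" for i j using that T by (auto simp: ialg_def)
  then have i: "\<phi> (E i j) \<in> ialg A n" if "i < 2" "j < 2" for i j using that A(3) by blast
  have s: "star A n (\<phi> (E i j)) = \<phi> (E i j)" "in_corner (msize A n) (\<phi> (E i j))" if "i < 2" "j < 2" for i j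
    using i[OF that] A(1) by (auto simp: ialg_def)
  have F: "homF (E 0 0) = \<phi> (E 0 0) * \<phi> (E 0 1) * \<phi> (E 1 0)" "\<phi> (E 1 0) * \<phi> (E 0 1) * \<phi> (E 0 0) = homT (E 0 0)"
    by (simp_all add: triple_product[OF T] c unit_mat_mult del: One_nat_def)
  have "star A n (homF (E 0 0)) = \<phi> (E 1 0) * (\<phi> (E 0 1) * \<phi> (E 0 0))"
    unfolding F(1) by (simp add: star_mult in_corner_mult s del: One_nat_def)
  then have "star A n (homF (E 0 0)) = homT (E 0 0)" using F(2) by (simp add: mult.assoc)
  moreover have "in_corner (msize A n) (homF (E 0 0))" unfolding F(1) by (intro in_corner_mult s) auto
  ultimately have "rk (homT (E 0 0)) l" using f star_rk unfolding franks_iff(1)[OF T] by metis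
  then show ?thesis using f rk_unique unfolding franks_iff(1)[OF T] by blast
qed

end

text \<open>Outside \<open>Full\<close> the rank of the image of the identity is
  \<open>msize T m\<close> times the common rank of the base idempotents and therefore determines
  it.\<close>

lemma jhom_conjugate_rank:
  fixes \<phi> \<psi> :: "'a::field imat \<Rightarrow> 'a imat"
  assumes "jordan_hom T m N \<phi>" and "jordan_hom T m N \<psi>"
    and "T \<noteq> Full \<Longrightarrow> \<exists>s. rk (\<phi> (corner (msize T m))) s \<and> rk (\<psi> (corner (msize T m))) s"
    and "T = Full \<Longrightarrow> \<exists>l k. franks \<phi> l k \<and> franks \<psi> l k"
  shows "\<exists>Q R. in_corner N Q \<and> in_corner N R \<and> Q * R = corner N \<and> R * Q = corner N
    \<and> (\<forall>x\<in>ialg T m. Q * \<phi> x = \<psi> x * Q)"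
proof (rule jhom_conjugate[OF assms(1,2)])
  interpret A: jordan_hom T m N \<phi> by fact
  interpret B: jordan_hom T m N \<psi> by fact
  fix \<alpha> assume \<alpha>: "\<alpha> \<in> flags T"
  show "mvn (A.comp \<alpha>) (B.comp \<alpha>)"
  proof (cases "T = Full")
    case True
    then obtain l k where "franks \<phi> l k" "franks \<psi> l k" using assms(4) by blast
    then have "rk (A.comp False) l \<and> rk (A.comp True) k" "rk (B.comp False) l \<and> rk (B.comp True) k"
      using A.franks_iff(2)[OF True] B.franks_iff(2)[OF True] by auto
    then show ?thesis by (cases \<alpha>) (auto intro: rk_mvn)
  next
    case False
    obtain r r' where r: "rk (A.comp False) r" "rk A.unit_image (msize T m * r)"
      and r': "rk (B.comp False) r'" "rk B.unit_image (msize T m * r')"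
      using A.ex_rk_not_Full[OF False] B.ex_rk_not_Full[OF False] by blast
    obtain s where "rk A.unit_image s" "rk B.unit_image s"
      using assms(3)[OF False] by (auto simp: A.unit_image_def B.unit_image_def)
    then have "msize T m * r = msize T m * r'" using rk_unique r(2) r'(2) by metis
    moreover have "msize T m > 0" using A.m3 by (cases T) auto
    ultimately have "r = r'" by simp
    then have "mvn (A.comp False) (B.comp False)" using rk_mvn[OF r(1)] r'(1) by simp
    then show ?thesis
      by (intro mvn_trans[OF mvn_sym[OF A.comp_mvn[OF False \<alpha>]]] mvn_trans[OF _ B.comp_mvn[OF False \<alpha>]])
  qed
qed

text \<open>\<open>\<psi>\<close> is compared with the identity map, which for \<open>Full\<close>
  has ranks 1 and 0, and with the transpose, which has ranks 0 and 1. Preservation of the unit gives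
  \<open>n * (l + k) = n\<close>, so one of the two fits. The element \<open>Q\<close> is merely
  known to be invertible, which is enough for comparing ranks.\<close>

lemma automorphism_form:
  fixes \<psi> :: "'a::field imat \<Rightarrow> 'a imat"
  assumes "jordan_hom A n (msize A n) \<psi>" and u: "\<psi> (corner (msize A n)) = corner (msize A n)"
  shows "\<exists>Q R. in_corner (msize A n) Q \<and> in_corner (msize A n) R
    \<and> Q * R = corner (msize A n) \<and> R * Q = corner (msize A n)
    \<and> ((\<forall>x\<in>ialg A n. \<psi> x = Q * x * R) \<or> A = Full \<and> (\<forall>x\<in>ialg A n. \<psi> x = Q * tr x * R))"
proof -
  let ?N = "msize A n"
  interpret P: jordan_hom A n ?N \<psi> by fact
  interpret I: jordan_hom A n ?N "\<lambda>x. x :: 'a imat"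
    using P.char2 P.m3 by unfold_locales (auto simp: jhom_def ialg_corner)
  have fin: "\<psi> x = Q * f x * R" if "Q * f x = \<psi> x * Q" "Q * R = corner ?N" "x \<in> ialg A n" for Q R f x
  proof -
    have "Q * f x * R = \<psi> x * (Q * R)" using that(1) by (simp add: mult.assoc)
    then show ?thesis using that(2) in_cornerD[OF P.phi_corner[OF that(3)]] by simp
  qed
  show ?thesis
  proof (cases "A = Full")
    case False
    have "\<exists>Q R. in_corner ?N Q \<and> in_corner ?N R \<and> Q * R = corner ?N \<and> R * Q = corner ?N
      \<and> (\<forall>x\<in>ialg A n. Q * x = \<psi> x * Q)"
      by (rule jhom_conjugate_rank[OF I.jordan_hom_axioms P.jordan_hom_axioms])
        (use False u rk_corner in auto)
    then obtain Q R where h: "in_corner ?N Q" "in_corner ?N R" "Q * R = corner ?N" "R * Q = corner ?N"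
      and i: "\<forall>x\<in>ialg A n. Q * x = \<psi> x * Q" by (elim exE conjE)
    have d: "(\<forall>x\<in>ialg A n. \<psi> x = Q * x * R) \<or> A = Full \<and> (\<forall>x\<in>ialg A n. \<psi> x = Q * tr x * R)"
      by (rule disjI1) (use i in \<open>blast intro: fin[where f = "\<lambda>x. x", OF _ h(3)]\<close>)
    show ?thesis by (intro exI[of _ Q] exI[of _ R] conjI h d)
  next
    case True
    note idf = franks_id[where 'a='a]
    obtain l k where lk: "franks \<psi> l k" using P.ex_franks[OF True] by (elim exE)
    have "P.unit_image = corner n" unfolding P.unit_image_def using u True by simp
    then have "rk (corner n :: 'a imat) (n * (l + k))"
      using P.rk_franks[OF True lk] by simp
    then have "n * (l + k) = n" by (rule rk_unique[OF _ rk_corner])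
    then have "l + k = 1" using P.m3 by simp
    then have "l = 1 \<and> k = 0 \<or> l = 0 \<and> k = 1" by arith
    then consider "l = 1" "k = 0" | "l = 0" "k = 1" by blast
    then show ?thesis
    proof cases
      case 1
      have "\<exists>Q R. in_corner ?N Q \<and> in_corner ?N R \<and> Q * R = corner ?N \<and> R * Q = corner ?N
        \<and> (\<forall>x\<in>ialg A n. Q * x = \<psi> x * Q)"
      proof (rule jhom_conjugate_rank[OF I.jordan_hom_axioms P.jordan_hom_axioms])
        show "\<exists>l k. franks (\<lambda>x::'a imat. x) l k \<and> franks \<psi> l k"
          using lk 1 by (intro exI[of _ 1] exI[of _ 0] conjI idf) simp
      qed (use True in simp)
      then obtain Q R where h: "in_corner ?N Q" "in_corner ?N R" "Q * R = corner ?N" "R * Q = corner ?N"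
      and i: "\<forall>x\<in>ialg A n. Q * x = \<psi> x * Q" by (elim exE conjE)
    have d: "(\<forall>x\<in>ialg A n. \<psi> x = Q * x * R) \<or> A = Full \<and> (\<forall>x\<in>ialg A n. \<psi> x = Q * tr x * R)"
      by (rule disjI1) (use i in \<open>blast intro: fin[where f = "\<lambda>x. x", OF _ h(3)]\<close>)
    show ?thesis by (intro exI[of _ Q] exI[of _ R] conjI h d)
    next
      case 2
      interpret J: jordan_hom A n ?N "tr :: 'a imat \<Rightarrow> 'a imat"
        using P.char2 P.m3 True
        by unfold_locales (auto simp: jhom_def ialg_def tr_add tr_mult sc_commute add.commute intro: in_corner_intros)
      have idt: "franks (tr :: 'a imat \<Rightarrow> 'a imat) 0 1" using franks_tr_pre[OF idf] by simp
      have "\<exists>Q R. in_corner ?N Q \<and> in_corner ?N R \<and> Q * R = corner ?N \<and> R * Q = corner ?N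
        \<and> (\<forall>x\<in>ialg A n. Q * tr x = \<psi> x * Q)"
      proof (rule jhom_conjugate_rank[OF J.jordan_hom_axioms P.jordan_hom_axioms])
        show "\<exists>l k. franks (tr :: 'a imat \<Rightarrow> 'a imat) l k \<and> franks \<psi> l k"
          using lk 2 by (intro exI[of _ 0] exI[of _ 1] conjI idt) simp
      qed (use True in simp)
      then obtain Q R where h: "in_corner ?N Q" "in_corner ?N R" "Q * R = corner ?N" "R * Q = corner ?N"
      and i: "\<forall>x\<in>ialg A n. Q * tr x = \<psi> x * Q" by (elim exE conjE)
    have d: "(\<forall>x\<in>ialg A n. \<psi> x = Q * x * R) \<or> A = Full \<and> (\<forall>x\<in>ialg A n. \<psi> x = Q * tr x * R)"
      by (intro disjI2 conjI True ballI, rule fin[where f = tr, OF bspec[OF i] h(3)])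
    show ?thesis by (intro exI[of _ Q] exI[of _ R] conjI h d)
    qed
  qed
qed

lemma automorphism_rk:
  assumes "jordan_hom A n (msize A n) \<psi>" "\<psi> (corner (msize A n)) = corner (msize A n)"
    and p: "p \<in> ialg A n" "rk p r"
  shows "rk (\<psi> p) r"
proof -
  have c: "in_corner (msize A n) p" "in_corner (msize A n) (tr p)"
    using ialg_corner[OF p(1)] in_corner_intros(7)[OF ialg_corner[OF p(1)]] by blast+
  obtain Q R where RQ: "R * Q = corner (msize A n)"
    and "(\<forall>x\<in>ialg A n. \<psi> x = Q * x * R) \<or> A = Full \<and> (\<forall>x\<in>ialg A n. \<psi> x = Q * tr x * R)"
    using automorphism_form[OF assms(1,2)] by (elim exE conjE)
  then have "\<psi> p = Q * p * R \<or> \<psi> p = Q * tr p * R" using p(1) by auto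
  then show ?thesis
    using rk_conj[OF p(2) c(1) RQ] rk_conj[OF rk_tr[OF p(2)] c(2) RQ] by metis
qed

section \<open>From matrices to infinite matrices\<close>

lemma ent_star_Sympl:
  assumes "i < m" "j < m"
  shows "ent (star Sympl m x) i j = ent x (m + j) (m + i)"
    "ent (star Sympl m x) i (m + j) = - ent x j (m + i)"
    "ent (star Sympl m x) (m + i) j = - ent x (m + j) i"
    "ent (star Sympl m x) (m + i) (m + j) = ent x j i"
proof -
  have l1: "ent (form Sympl m * z) i k = ent z (m + i) k" if "i < m" for z :: "'a imat" and i k
    by (subst ent_mult_row[of "{m + i}"]) (use that in \<open>auto simp: ent_form_Sympl simp del: form.simps(1)\<close>)
  have l2: "ent (form Sympl m * z) (m + i) k = - ent z i k" if "i < m" for z :: "'a imat" and i k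
    by (subst ent_mult_row[of "{i}"]) (use that in \<open>auto simp: ent_form_Sympl simp del: form.simps(1)\<close>)
  have r1: "ent (z * tr (form Sympl m)) k j = ent z k (m + j)" if "j < m" for z :: "'a imat" and j k
    by (subst ent_mult_col[of "{m + j}"]) (use that in \<open>auto simp: ent_form_Sympl simp del: form.simps(1)\<close>)
  have r2: "ent (z * tr (form Sympl m)) k (m + j) = - ent z k j" if "j < m" for z :: "'a imat" and j k
    by (subst ent_mult_col[of "{j}"]) (use that in \<open>auto simp: ent_form_Sympl simp del: form.simps(1)\<close>)
  show "ent (star Sympl m x) i j = ent x (m + j) (m + i)"
    "ent (star Sympl m x) i (m + j) = - ent x j (m + i)"
    "ent (star Sympl m x) (m + i) j = - ent x (m + j) i"
    "ent (star Sympl m x) (m + i) (m + j) = ent x j i"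
    using assms by (simp_all add: star_def l1 l2 r1 r2 del: form.simps(1))
qed

lemma ialg_Sympl_iff:
  assumes x: "in_corner (2 * m) x"
  shows "x \<in> ialg Sympl m \<longleftrightarrow> (\<forall>i<m. \<forall>j<m. ent x (m + i) (m + j) = ent x j i
    \<and> ent x j (m + i) = - ent x i (m + j) \<and> ent x (m + j) i = - ent x (m + i) j)"
proof
  assume "x \<in> ialg Sympl m"
  then have s: "star Sympl m x = x" by (simp add: ialg_def)
  show "\<forall>i<m. \<forall>j<m. ent x (m + i) (m + j) = ent x j i
    \<and> ent x j (m + i) = - ent x i (m + j) \<and> ent x (m + j) i = - ent x (m + i) j"
  proof (intro allI impI)
    fix i j assume "i < m" "j < m"
    then show "ent x (m + i) (m + j) = ent x j i
      \<and> ent x j (m + i) = - ent x i (m + j) \<and> ent x (m + j) i = - ent x (m + i) j"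
      using ent_star_Sympl[of i m j x] unfolding s by simp
  qed
next
  assume a: "\<forall>i<m. \<forall>j<m. ent x (m + i) (m + j) = ent x j i
    \<and> ent x j (m + i) = - ent x i (m + j) \<and> ent x (m + j) i = - ent x (m + i) j"
  then have a1: "ent x (m + i) (m + j) = ent x j i" and a2: "ent x j (m + i) = - ent x i (m + j)"
    and a3: "ent x (m + j) i = - ent x (m + i) j" if "i < m" "j < m" for i j
    using that by blast+
  have "star Sympl m x = x"
  proof (rule imat_eqI)
    fix i j
    consider "i \<ge> 2 * m \<or> j \<ge> 2 * m" | "i < m" "j < m" | "i < m" "m \<le> j" "j < 2 * m"
      | "m \<le> i" "i < 2 * m" "j < m" | "m \<le> i" "i < 2 * m" "m \<le> j" "j < 2 * m" by linarith
    then show "ent (star Sympl m x) i j = ent x i j"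
    proof cases
      case 1
      have "in_corner (2 * m) (star Sympl m x)" using in_corner_star[of Sympl m x] x by simp
      then have "ent (star Sympl m x) i j = 0" "ent x i j = 0"
        using 1 x unfolding in_corner_ent by (meson not_less)+
      then show ?thesis by simp
    next
      case 2
      then show ?thesis using ent_star_Sympl(1)[OF 2, of x] a1[OF 2(2,1)] by simp
    next
      case 3
      define k where "k = j - m"
      have k: "k < m" "j = m + k" using 3 by (auto simp: k_def)
      show ?thesis unfolding k(2) using ent_star_Sympl(2)[OF 3(1) k(1), of x] a2[OF 3(1) k(1)] by simp
    next
      case 4
      define k where "k = i - m"
      have k: "k < m" "i = m + k" using 4 by (auto simp: k_def)
      show ?thesis unfolding k(2) using ent_star_Sympl(3)[OF k(1) 4(3), of x] a3[OF k(1) 4(3)] by simp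
    next
      case 5
      define k where "k = i - m"
      have k: "k < m" "i = m + k" using 5 by (auto simp: k_def)
      define r where "r = j - m"
      have r: "r < m" "j = m + r" using 5 by (auto simp: r_def)
      show ?thesis unfolding k(2) r(2) using ent_star_Sympl(4)[OF k(1) r(1), of x] a1[OF k(1) r(1)] by simp
    qed
  qed
  then show "x \<in> ialg Sympl m" using x by (simp add: ialg_def)
qed

lemma skew_iff: "B \<in> carrier_mat m m \<Longrightarrow> skew B \<longleftrightarrow> (\<forall>i<m. \<forall>j<m. B $$ (j, i) = - B $$ (i, j))"
proof -
  assume B: "B \<in> carrier_mat m m"
  show ?thesis unfolding skew_def
  proof
    assume t: "transpose_mat B = - B"
    show "\<forall>i<m. \<forall>j<m. B $$ (j, i) = - B $$ (i, j)"
    proof (intro allI impI)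
      fix i j assume "i < m" "j < m"
      then show "B $$ (j, i) = - B $$ (i, j)"
        using B arg_cong[OF t, of "\<lambda>M. M $$ (i, j)"] by simp
    qed
  next
    assume a: "\<forall>i<m. \<forall>j<m. B $$ (j, i) = - B $$ (i, j)"
    show "transpose_mat B = - B"
    proof (rule eq_matI)
      fix i j assume "i < dim_row (- B)" "j < dim_col (- B)"
      then have ij: "i < m" "j < m" using B by auto
      then have "B $$ (j, i) = - B $$ (i, j)" using a by blast
      then show "transpose_mat B $$ (i, j) = (- B) $$ (i, j)" using B ij by simp
    qed (use B in auto)
  qed
qed

text \<open>For \<open>Sympl\<close>, being fixed by the involution says that the diagonal blocks
  are transposes of each other and the other two blocks are skew.\<close>

lemma alg_iff: "X \<in> alg T m \<longleftrightarrow> X \<in> carrier_mat (msize T m) (msize T m) \<and> emb X \<in> ialg T m"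
proof (cases T)
  case Full
  then show ?thesis by (auto simp: ialg_def in_corner_emb)
next
  case Sym
  have "star Sym m (emb X) = emb X \<longleftrightarrow> transpose_mat X = X" if X: "X \<in> carrier_mat m m"
  proof -
    have "star Sym m (emb X) = emb (transpose_mat X)"
      using in_cornerD[OF in_corner_emb[of "transpose_mat X" m]] X
      by (simp add: star_def emb_transpose)
    then show ?thesis using X emb_inj[of "transpose_mat X" m X] by auto
  qed
  then show ?thesis using Sym by (auto simp: ialg_def in_corner_emb)
next
  case Sympl
  show ?thesis
  proof
    assume "X \<in> alg T m"
    then obtain A B C where A: "A \<in> carrier_mat m m" and B: "B \<in> carrier_mat m m" "skew B"
      and C: "C \<in> carrier_mat m m" "skew C" and X: "X = four_block_mat A B C (transpose_mat A)"
      using Sympl by auto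
    have XC: "X \<in> carrier_mat (2 * m) (2 * m)" unfolding X mult_2 using A by (intro four_block_carrier_mat) auto
    have "emb X \<in> ialg Sympl m"
      unfolding ialg_Sympl_iff[OF in_corner_emb[OF XC]]
    proof (intro allI impI)
      fix i j assume ij: "i < m" "j < m"
      have "B $$ (j, i) = - B $$ (i, j)" "C $$ (j, i) = - C $$ (i, j)"
        using B C ij skew_iff by blast+
      then show "ent (emb X) (m + i) (m + j) = ent (emb X) j i \<and> ent (emb X) j (m + i) = - ent (emb X) i (m + j)
        \<and> ent (emb X) (m + j) i = - ent (emb X) (m + i) j"
        using A B C ij by (simp add: X)
    qed
    then show "X \<in> carrier_mat (msize T m) (msize T m) \<and> emb X \<in> ialg T m"
      using XC Sympl by simp
  next
    assume "X \<in> carrier_mat (msize T m) (msize T m) \<and> emb X \<in> ialg T m"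
    then have XC: "X \<in> carrier_mat (2 * m) (2 * m)" and x: "emb X \<in> ialg Sympl m" using Sympl by auto
    have e: "X $$ (m + i, m + j) = X $$ (j, i)" "X $$ (j, m + i) = - X $$ (i, m + j)"
      "X $$ (m + j, i) = - X $$ (m + i, j)" if "i < m" "j < m" for i j
    proof -
      have "ent (emb X) (m + i) (m + j) = ent (emb X) j i" "ent (emb X) j (m + i) = - ent (emb X) i (m + j)"
        "ent (emb X) (m + j) i = - ent (emb X) (m + i) j"
        using x that unfolding ialg_Sympl_iff[OF in_corner_emb[OF XC]] by blast+
      then show "X $$ (m + i, m + j) = X $$ (j, i)" "X $$ (j, m + i) = - X $$ (i, m + j)"
        "X $$ (m + j, i) = - X $$ (m + i, j)"
        using XC that by simp_all
    qed
    define A where "A = mat m m (\<lambda>(i, j). X $$ (i, j))"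
    define B where "B = mat m m (\<lambda>(i, j). X $$ (i, m + j))"
    define C where "C = mat m m (\<lambda>(i, j). X $$ (m + i, j))"
    have c: "A \<in> carrier_mat m m" "B \<in> carrier_mat m m" "C \<in> carrier_mat m m"
      by (auto simp: A_def B_def C_def)
    have "B $$ (j, i) = - B $$ (i, j)" "C $$ (j, i) = - C $$ (i, j)" if ij: "i < m" "j < m" for i j
      using e(2,3)[OF ij] ij by (simp_all add: B_def C_def)
    then have "skew B" "skew C" unfolding skew_iff[OF c(2)] skew_iff[OF c(3)] by blast+
    moreover have "X = four_block_mat A B C (transpose_mat A)"
    proof (rule eq_matI)
      fix i j
      assume "i < dim_row (four_block_mat A B C (transpose_mat A))" "j < dim_col (four_block_mat A B C (transpose_mat A))"
      then have ij: "i < 2 * m" "j < 2 * m" using c by auto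
      have "X $$ (i, j) = X $$ (j - m, i - m)" if "m \<le> i" "m \<le> j"
        using e(1)[of "i - m" "j - m"] that ij by simp
      then show "X $$ (i, j) = four_block_mat A B C (transpose_mat A) $$ (i, j)"
        using ij by (auto simp: A_def B_def C_def)
    qed (use c XC in auto)
    ultimately show "X \<in> alg T m" using Sympl c by auto
  qed
qed

lemma alg_carrier: "X \<in> alg T m \<Longrightarrow> X \<in> carrier_mat (msize T m) (msize T m)"
  by (simp add: alg_iff)

lemma emb_jprod:
  assumes "X \<in> carrier_mat N N" "Y \<in> carrier_mat N N"
  shows "emb (jprod X Y) = sc (1 / 2) * (emb X * emb Y + emb Y * emb X)"
proof -
  have "emb (X * Y + Y * X) = emb (X * Y) + emb (Y * X)"
    by (rule emb_add[of _ N N]) (use assms in auto)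
  then show ?thesis
    by (simp add: jprod_def emb_smult emb_mult[OF assms] emb_mult[OF assms(2,1)])
qed

lemma alg_closed:
  "X \<in> alg T m \<Longrightarrow> Y \<in> alg T m \<Longrightarrow> X + Y \<in> alg T m"
  "X \<in> alg T m \<Longrightarrow> c \<cdot>\<^sub>m X \<in> alg T m"
  "X \<in> alg T m \<Longrightarrow> Y \<in> alg T m \<Longrightarrow> jprod X Y \<in> alg T m"
  "1\<^sub>m (msize T m) \<in> alg T m"
  unfolding alg_iff
  by (auto simp: emb_add[of _ "msize T m" "msize T m"] emb_smult emb_jprod[of _ "msize T m"] emb_one
      intro: ialg_intros) (auto simp: jprod_def)

lemma jprod_commute: "X \<in> carrier_mat N N \<Longrightarrow> Y \<in> carrier_mat N N \<Longrightarrow> jprod X Y = jprod Y X"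
  unfolding jprod_def by (subst comm_add_mat[of _ N N]) auto

lemma jsubalg_alg: "jsubalg (alg T m) (alg T m)"
  using alg_closed unfolding jsubalg_def by blast

section \<open>Jordan isomorphisms of matrix algebras and their lifts\<close>

lemma jiso_sym:
  assumes "jiso J1 J2 \<phi>" "jsubalg S J1"
  shows "jiso J2 J1 (inv_into J1 \<phi>)"
proof -
  let ?g = "inv_into J1 \<phi>"
  have b: "bij_betw \<phi> J1 J2" using assms(1) by (simp add: jiso_def)
  have g: "?g y \<in> J1" "\<phi> (?g y) = y" if "y \<in> J2" for y
    using that b by (meson bij_betw_apply bij_betw_inv_into, metis bij_betw_inv_into_right)
  have l: "?g (\<phi> x) = x" if "x \<in> J1" for x using b that by (rule bij_betw_inv_into_left)
  have c: "\<And>X Y. X \<in> J1 \<Longrightarrow> Y \<in> J1 \<Longrightarrow> X + Y \<in> J1" "\<And>c X. X \<in> J1 \<Longrightarrow> c \<cdot>\<^sub>m X \<in> J1"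
    "\<And>X Y. X \<in> J1 \<Longrightarrow> Y \<in> J1 \<Longrightarrow> jprod X Y \<in> J1"
    using assms(2) unfolding jsubalg_def by auto
  have h: "\<And>X Y. X \<in> J1 \<Longrightarrow> Y \<in> J1 \<Longrightarrow> \<phi> (X + Y) = \<phi> X + \<phi> Y" "\<And>c X. X \<in> J1 \<Longrightarrow> \<phi> (c \<cdot>\<^sub>m X) = c \<cdot>\<^sub>m \<phi> X"
    "\<And>X Y. X \<in> J1 \<Longrightarrow> Y \<in> J1 \<Longrightarrow> \<phi> (jprod X Y) = jprod (\<phi> X) (\<phi> Y)"
    using assms(1) unfolding jiso_def by auto
  show ?thesis unfolding jiso_def
  proof (intro conjI ballI allI)
    show "bij_betw ?g J2 J1" by (rule bij_betw_inv_into[OF b])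
    fix X Y assume XY: "X \<in> J2" "Y \<in> J2"
    show "?g (X + Y) = ?g X + ?g Y"
      using l[OF c(1)[OF g(1)[OF XY(1)] g(1)[OF XY(2)]]] h(1)[OF g(1)[OF XY(1)] g(1)[OF XY(2)]] g(2) XY by simp
    show "?g (jprod X Y) = jprod (?g X) (?g Y)"
      using l[OF c(3)[OF g(1)[OF XY(1)] g(1)[OF XY(2)]]] h(3)[OF g(1)[OF XY(1)] g(1)[OF XY(2)]] g(2) XY by simp
  next
    fix a X assume X: "X \<in> J2"
    show "?g (a \<cdot>\<^sub>m X) = a \<cdot>\<^sub>m ?g X"
      using l[OF c(2)[OF g(1)[OF X]]] h(2)[OF g(1)[OF X]] g(2) X by simp
  qed
qed

lemma jiso_trans: "jiso J1 J2 \<phi> \<Longrightarrow> jiso J2 J3 \<psi> \<Longrightarrow> jiso J1 J3 (\<psi> \<circ> \<phi>)"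
  unfolding jiso_def using bij_betw_trans bij_betw_apply by (auto simp: bij_betw_apply)

lemma jiso_image: "jiso J1 J2 \<phi> \<Longrightarrow> \<phi> ` J1 = J2"
  by (simp add: jiso_def bij_betw_def)

lemma jiso_restrict: "jiso S S' \<phi> \<Longrightarrow> J \<subseteq> S \<Longrightarrow> jiso J (\<phi> ` J) \<phi>"
  unfolding jiso_def using bij_betw_subset[of \<phi> S S' J] by (simp add: subset_iff)

definition lift :: "jkind \<Rightarrow> nat \<Rightarrow> ('a::field mat \<Rightarrow> 'a mat) \<Rightarrow> 'a imat \<Rightarrow> 'a imat" where
  "lift T m \<theta> x = emb (\<theta> (unemb (msize T m) x))"

lemma unemb_alg:
  assumes "x \<in> ialg T m"
  shows "unemb (msize T m) x \<in> alg T m"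
  unfolding alg_iff using emb_unemb[OF ialg_corner[OF assms]] assms by simp

lemma lift_emb: "X \<in> alg T m \<Longrightarrow> lift T m \<theta> (emb X) = emb (\<theta> X)"
  by (simp add: lift_def unemb_emb[OF alg_carrier])

lemma lift_jhom:
  fixes \<theta> :: "'a::field mat \<Rightarrow> 'a mat"
  assumes two: "(2::'a) \<noteq> 0" and \<theta>: "jiso (alg T m) J \<theta>" and J: "J \<subseteq> carrier_mat N N"
  shows "jhom T m N (lift T m \<theta>)"
proof -
  let ?M = "msize T m"
  have h: "\<And>X Y. X \<in> alg T m \<Longrightarrow> Y \<in> alg T m \<Longrightarrow> \<theta> (X + Y) = \<theta> X + \<theta> Y"
    "\<And>c X. X \<in> alg T m \<Longrightarrow> \<theta> (c \<cdot>\<^sub>m X) = c \<cdot>\<^sub>m \<theta> X"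
    "\<And>X Y. X \<in> alg T m \<Longrightarrow> Y \<in> alg T m \<Longrightarrow> \<theta> (jprod X Y) = jprod (\<theta> X) (\<theta> Y)"
    using \<theta> unfolding jiso_def by auto
  have c: "\<theta> X \<in> carrier_mat N N" if "X \<in> alg T m" for X using jiso_image[OF \<theta>] J that by blast
  have ex: "\<exists>X\<in>alg T m. x = emb X" if "x \<in> ialg T m" for x :: "'a imat"
    using unemb_alg[OF that] emb_unemb[OF ialg_corner[OF that]] by metis
  have l: "lift T m \<theta> (emb X) = emb (\<theta> X)" if "X \<in> alg T m" for X by (rule lift_emb[OF that])
  show ?thesis unfolding jhom_def
  proof (intro conjI ballI allI)
    fix x :: "'a imat" assume "x \<in> ialg T m"
    then obtain X where X: "X \<in> alg T m" "x = emb X" using ex by blast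
    show "in_corner N (lift T m \<theta> x)" using in_corner_emb[OF c[OF X(1)]] X l by simp
    fix a :: 'a
    have "sc a * x = emb (a \<cdot>\<^sub>m X)" by (simp add: X emb_smult)
    then show "lift T m \<theta> (sc a * x) = sc a * lift T m \<theta> x"
      using l[OF alg_closed(2)[OF X(1)], of a] l[OF X(1)] h(2)[OF X(1), of a] X(2) by (simp add: emb_smult)
  next
    fix x y :: "'a imat" assume "x \<in> ialg T m" "y \<in> ialg T m"
    then obtain X Y where X: "X \<in> alg T m" "x = emb X" and Y: "Y \<in> alg T m" "y = emb Y" using ex by blast
    note cX = alg_carrier[OF X(1)] and cY = alg_carrier[OF Y(1)]
    have "x + y = emb (X + Y)" using X Y emb_add[OF cX cY] by simp
    then show "lift T m \<theta> (x + y) = lift T m \<theta> x + lift T m \<theta> y"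
      using l[OF alg_closed(1)[OF X(1) Y(1)]] l[OF X(1)] l[OF Y(1)] h(1)[OF X(1) Y(1)] X(2) Y(2)
        emb_add[OF c[OF X(1)] c[OF Y(1)]] by simp
    have cancel: "sc 2 * (sc (1 / 2) * z) = z" for z :: "'a imat" using sc_inverse[OF two] by simp
    have "x * y + y * x = emb (2 \<cdot>\<^sub>m jprod X Y)"
      using X Y emb_jprod[OF cX cY] by (simp add: emb_smult cancel)
    then have "lift T m \<theta> (x * y + y * x) = emb (\<theta> (2 \<cdot>\<^sub>m jprod X Y))"
      using l[OF alg_closed(2)[OF alg_closed(3)[OF X(1) Y(1)]], of 2] by simp
    also have "\<dots> = sc 2 * emb (jprod (\<theta> X) (\<theta> Y))"
      using h(2)[OF alg_closed(3)[OF X(1) Y(1)], of 2] h(3)[OF X(1) Y(1)] by (simp add: emb_smult)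
    also have "\<dots> = emb (\<theta> X) * emb (\<theta> Y) + emb (\<theta> Y) * emb (\<theta> X)"
      by (simp add: emb_jprod[OF c[OF X(1)] c[OF Y(1)]] cancel)
    finally show "lift T m \<theta> (x * y + y * x) = lift T m \<theta> x * lift T m \<theta> y + lift T m \<theta> y * lift T m \<theta> x"
      using l[OF X(1)] l[OF Y(1)] X(2) Y(2) by simp
  qed
qed

lemma lift_jordan_hom:
  fixes \<theta> :: "'a::field mat \<Rightarrow> 'a mat"
  assumes "(2::'a) \<noteq> 0" "3 \<le> m" "jiso (alg T m) J \<theta>" "J \<subseteq> carrier_mat N N"
  shows "jordan_hom T m N (lift T m \<theta>)"
  using assms lift_jhom by unfold_locales auto

lemma jaut_of_conj:
  fixes f g :: "'a::field imat \<Rightarrow> 'a imat"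
  assumes lin: "\<And>x y. f (x + y) = f x + f y" "\<And>c x. f (sc c * x) = sc c * f x"
    and mult: "\<And>x y. x \<in> ialg A n \<Longrightarrow> y \<in> ialg A n \<Longrightarrow> f (x * y + y * x) = f x * f y + f y * f x"
    and f: "\<And>x. x \<in> ialg A n \<Longrightarrow> f x \<in> ialg A n" and g: "\<And>x. x \<in> ialg A n \<Longrightarrow> g x \<in> ialg A n"
    and fg: "\<And>x. x \<in> ialg A n \<Longrightarrow> f (g x) = x" "\<And>x. x \<in> ialg A n \<Longrightarrow> g (f x) = x"
  shows "jaut (alg A n) (\<lambda>X. unemb (msize A n) (f (emb X)))" (is "jaut _ ?F")
proof -
  let ?N = "msize A n"
  have a: "emb X \<in> ialg A n" if "X \<in> alg A n" for X :: "'a mat" using that by (simp add: alg_iff)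
  define F where "F = ?F"
  define G where "G X = unemb ?N (g (emb X))" for X
  have F: "F X \<in> alg A n" "emb (F X) = f (emb X)" if "X \<in> alg A n" for X
    unfolding F_def using unemb_alg[OF f[OF a[OF that]]] emb_unemb[OF ialg_corner[OF f[OF a[OF that]]]] by auto
  have G: "G X \<in> alg A n" "emb (G X) = g (emb X)" if "X \<in> alg A n" for X
    unfolding G_def using unemb_alg[OF g[OF a[OF that]]] emb_unemb[OF ialg_corner[OF g[OF a[OF that]]]] by auto
  have inj: "X = Y" if "X \<in> alg A n" "Y \<in> alg A n" "emb X = emb Y" for X Y :: "'a mat"
    using emb_inj[OF alg_carrier[OF that(1)] alg_carrier[OF that(2)] that(3)] .
  have FG: "F (G X) = X" "G (F X) = X" if "X \<in> alg A n" for X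
    using that by (auto intro!: inj simp: F G fg a)
  show ?thesis unfolding jaut_def jiso_def F_def[symmetric]
  proof (intro conjI ballI allI)
    show "bij_betw F (alg A n) (alg A n)"
      by (rule bij_betw_byWitness[where f' = G]) (use F(1) G(1) FG in auto)
    fix X Y :: "'a mat" assume XY: "X \<in> alg A n" "Y \<in> alg A n"
    note cX = alg_carrier[OF XY(1)] and cY = alg_carrier[OF XY(2)]
    note FX = alg_carrier[OF F(1)[OF XY(1)]] and FY = alg_carrier[OF F(1)[OF XY(2)]]
    show "F (X + Y) = F X + F Y"
      by (rule inj) (simp_all add: alg_closed XY F emb_add[OF FX FY] emb_add[OF cX cY] lin)
    show "F (jprod X Y) = jprod (F X) (F Y)"
      by (rule inj) (simp_all add: alg_closed XY F emb_jprod[OF FX FY] emb_jprod[OF cX cY] lin(2) mult a)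
  next
    fix c and X :: "'a mat" assume X: "X \<in> alg A n"
    show "F (c \<cdot>\<^sub>m X) = c \<cdot>\<^sub>m F X"
      by (rule inj) (simp_all add: alg_closed X F emb_smult lin)
  qed
qed

text \<open>Conjugation by \<open>Q\<close> preserves the ambient algebra: any invertible
  \<open>Q\<close> does so for \<open>Full\<close>, an isometry for the others. The intertwining
  relation makes it carry each \<open>\<theta> X\<close> to \<open>\<theta>' X\<close>.\<close>

lemma conj_class_lift:
  fixes Q R :: "'a::field imat"
  assumes \<theta>: "jiso (alg T m) J \<theta>" and \<theta>': "jiso (alg T m) J' \<theta>'"
    and J: "J \<subseteq> alg A n" and J': "jsubalg (alg A n) J'"
    and Q: "in_corner (msize A n) Q" "in_corner (msize A n) R" "Q * R = corner (msize A n)" "R * Q = corner (msize A n)"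
    and int: "\<And>x. x \<in> ialg T m \<Longrightarrow> Q * lift T m \<theta> x = lift T m \<theta>' x * Q"
    and A: "A \<noteq> Full \<Longrightarrow> star A n Q = R"
  shows "J' \<in> conj_class (alg A n) J"
proof -
  let ?N = "msize A n"
  let ?f = "\<lambda>x. Q * x * R" and ?g = "\<lambda>x. R * x * Q"
  have mem: "?f x \<in> ialg A n" "?g x \<in> ialg A n" if "x \<in> ialg A n" for x
  proof -
    have c: "in_corner ?N x" "in_corner ?N (Q * x)" "in_corner ?N (R * x)"
      using ialg_corner[OF that] Q in_corner_mult by auto
    have "star A n (?f x) = ?f x \<and> star A n (?g x) = ?g x" if n: "A \<noteq> Full"
    proof -
      have R: "star A n R = Q" using A[OF n] star_star[OF Q(1)] by auto
      have x: "star A n x = x" using \<open>x \<in> ialg A n\<close> n by (simp add: ialg_def)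
      have "star A n (?f x) = Q * (x * R)" "star A n (?g x) = R * (x * Q)"
        by (simp_all only: star_mult[OF c(2) Q(2)] star_mult[OF c(3) Q(1)] star_mult[OF Q(1) c(1)]
            star_mult[OF Q(2) c(1)] R A[OF n] x)
      then show ?thesis by (simp only: mult.assoc)
    qed
    moreover have "in_corner ?N (?f x)" "in_corner ?N (?g x)" using c Q in_corner_mult by auto
    ultimately show "?f x \<in> ialg A n" "?g x \<in> ialg A n" by (auto simp: ialg_def)
  qed
  have fg: "?f (?g x) = x" "?g (?f x) = x" if "x \<in> ialg A n" for x
  proof -
    have "?f (?g x) = (Q * R) * x * (Q * R)" "?g (?f x) = (R * Q) * x * (R * Q)" by (simp_all only: mult.assoc)
    then show "?f (?g x) = x" "?g (?f x) = x" using Q in_cornerD[OF ialg_corner[OF that]] by simp_all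
  qed
  have mult: "?f (x * y) = ?f x * ?f y" if "x \<in> ialg A n" for x y
  proof -
    have "?f x * ?f y = Q * x * (R * Q) * y * R" by (simp only: mult.assoc)
    also have "\<dots> = Q * (x * corner ?N) * y * R" by (simp only: Q(4) mult.assoc)
    finally show ?thesis using in_cornerD[OF ialg_corner[OF that]] by (simp add: mult.assoc)
  qed
  let ?F = "\<lambda>X. unemb ?N (?f (emb X))"
  have aut: "jaut (alg A n) ?F"
  proof (rule jaut_of_conj[where g = ?g])
    show "?f (x * y + y * x) = ?f x * ?f y + ?f y * ?f x" if "x \<in> ialg A n" "y \<in> ialg A n" for x y
      using mult that by (simp add: distrib_left distrib_right)
  qed (simp_all add: distrib_left distrib_right sc_left_commute mult.assoc mem[unfolded mult.assoc] fg[unfolded mult.assoc])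
  have "?F (\<theta> X) = \<theta>' X" if X: "X \<in> alg T m" for X
  proof -
    have x: "emb X \<in> ialg T m" using X by (simp add: alg_iff)
    have m: "\<theta>' X \<in> alg A n" using jiso_image[OF \<theta>'] X J' by (auto simp: jsubalg_def)
    have "Q * emb (\<theta> X) = emb (\<theta>' X) * Q" using int[OF x] by (simp add: lift_emb[OF X])
    then have "?f (emb (\<theta> X)) = emb (\<theta>' X) * (Q * R)" by (simp add: mult.assoc)
    also have "\<dots> = emb (\<theta>' X)" using Q(3) in_cornerD[OF in_corner_emb[OF alg_carrier[OF m]]] by simp
    finally show ?thesis by (simp add: unemb_emb[OF alg_carrier[OF m]])
  qed
  then have "?F ` J = J'"
    unfolding jiso_image[OF \<theta>, symmetric] jiso_image[OF \<theta>', symmetric] by (auto simp: image_image)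
  then show ?thesis using aut J' unfolding conj_class_def by blast
qed

section \<open>Identity elements\<close>

lemma jid_unique:
  assumes "is_jid J e" "is_jid J f" "J \<subseteq> carrier_mat N N"
  shows "e = f"
  using assms jprod_commute[of e N f] unfolding is_jid_def by (metis subsetD)

lemma jid_image: "jiso J J' \<phi> \<Longrightarrow> is_jid J e \<Longrightarrow> is_jid J' (\<phi> e)"
  unfolding is_jid_def jiso_def bij_betw_def by force

lemma one_jid: "(2::'a::field) \<noteq> 0 \<Longrightarrow> is_jid (alg T m) (1\<^sub>m (msize T m) :: 'a mat)"
proof -
  assume two: "(2::'a) \<noteq> 0"
  have "jprod (1\<^sub>m (msize T m)) X = X" if "X \<in> alg T m" for X :: "'a mat"
  proof -
    have "X \<in> carrier_mat (msize T m) (msize T m)" by (rule alg_carrier[OF that])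
    then show ?thesis using two unfolding jprod_def by (intro eq_matI) (auto simp: field_simps)
  qed
  then show ?thesis using alg_closed(4) by (simp add: is_jid_def)
qed

lemma jid_idem:
  fixes e :: "'a::field mat"
  assumes "(2::'a) \<noteq> 0" "is_jid J e" "J \<subseteq> carrier_mat N N"
  shows "e * e = e"
proof -
  have e: "e \<in> carrier_mat N N" "jprod e e = e" using assms unfolding is_jid_def by auto
  have "sc (1 / 2) * (emb e * emb e + emb e * emb e) = emb e"
    using emb_jprod[OF e(1) e(1)] e(2) by simp
  moreover have "sc (1 / 2) * (z + z) = z" for z :: "'a imat"
    using assms(1) by (intro imat_eqI) (simp add: field_simps)
  ultimately have "emb (e * e) = emb e" using emb_mult[OF e(1) e(1)] by simp
  then show ?thesis using e by (intro emb_inj[of _ N]) auto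
qed

section \<open>Block diagonal realizations\<close>

text \<open>The shift of the index set by \<open>d\<close>: \<open>up d * x * tr (up d)\<close>
  moves a block \<open>x\<close> down the diagonal by \<open>d\<close> places.\<close>

definition up :: "nat \<Rightarrow> 'a::field imat" where
  "up d = Abs_imat (\<lambda>i j. if i = d + j then 1 else 0)"

lemma ent_up [simp]: "ent (up d) i j = (if i = d + j then 1 else 0)"
proof -
  have "finite {j. (if i = d + j then 1 else 0 :: 'a) \<noteq> 0}" for i
    by (rule finite_subset[of _ "{..i}"]) auto
  then show ?thesis unfolding up_def by (subst ent_Abs) auto
qed

lemma ent_up_mult: "ent (up d * x) i j = (if d \<le> i then ent x (i - d) j else 0)"
  by (subst ent_mult_row[of "if d \<le> i then {i - d} else {}"]) (auto split: if_splits)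

lemma ent_mult_tr_up: "ent (x * tr (up d)) i j = (if d \<le> j then ent x i (j - d) else 0)"
  by (subst ent_mult_col[of "if d \<le> j then {j - d} else {}"]) (auto split: if_splits)

lemma up_add: "up a * up b = up (a + b)"
  by (rule imat_eqI) (auto simp: ent_up_mult)

lemma up_0 [simp]: "up 0 = 1"
  by (rule imat_eqI) auto

lemma tr_up_up: "tr (up d) * up d = 1"
  by (intro imat_eqI, subst ent_mult_col[of "{d + _}"]) auto

lemma up_unit: "up d * E i j = E (d + i) j" "E i j * tr (up d) = E i (d + j)"
  by (auto intro!: imat_eqI simp: ent_up_mult ent_mult_tr_up)

lemma corner_tr_up_up_corner:
  assumes "c \<noteq> d"
  shows "corner m * (tr (up (c * m)) * up (d * m)) * corner m = 0"
proof (rule imat_eqI)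
  fix i j
  have e: "ent (tr (up (c * m)) * up (d * m)) i j = (if c * m + i = d * m + j then 1 else 0)"
    by (subst ent_mult_row[of "{c * m + i}"]) auto
  \<comment> \<open>Division by \<open>m\<close> recovers the number of the block from a position in
    it.\<close>
  have "c * m + i \<noteq> d * m + j" if "i < m" "j < m"
  proof
    assume "c * m + i = d * m + j"
    then have "(c * m + i) div m = (d * m + j) div m" by simp
    then show False using that assms by simp
  qed
  then show "ent (corner m * (tr (up (c * m)) * up (d * m)) * corner m) i j = ent 0 i j"
    by (simp add: ent_mult_corner ent_corner_mult e)
qed

definition bsum :: "nat \<Rightarrow> nat \<Rightarrow> (nat \<Rightarrow> 'a::field imat) \<Rightarrow> 'a imat" where
  "bsum L m f = (\<Sum>c<L. up (c * m) * f c * tr (up (c * m)))"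

lemma bsum_add: "bsum L m (\<lambda>c. f c + g c) = bsum L m f + bsum L m g"
  by (simp add: bsum_def distrib_left distrib_right sum.distrib)

lemma bsum_sc: "bsum L m (\<lambda>c. sc a * f c) = sc a * bsum L m f"
  by (simp add: bsum_def sum_distrib_left sc_left_commute mult.assoc)

lemma bsum_mult:
  assumes f: "\<And>c. c < L \<Longrightarrow> in_corner m (f c)" and g: "\<And>c. c < L \<Longrightarrow> in_corner m (g c)"
  shows "bsum L m f * bsum L m g = bsum L m (\<lambda>c. f c * g c)"
  unfolding bsum_def sum_distrib_right
proof (intro sum.cong refl)
  fix c assume c: "c \<in> {..<L}"
  have "(up (c * m) * f c * tr (up (c * m))) * (up (d * m) * g d * tr (up (d * m)))
      = (if d = c then up (c * m) * (f c * g c) * tr (up (c * m)) else 0)" if d: "d < L" for d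
  proof (cases "d = c")
    case True
    have "(up (c * m) * f c * tr (up (c * m))) * (up (c * m) * g c * tr (up (c * m)))
        = up (c * m) * f c * (tr (up (c * m)) * up (c * m)) * g c * tr (up (c * m))"
      by (simp only: mult.assoc)
    then show ?thesis using True by (simp add: tr_up_up mult.assoc)
  next
    case False
    have fg: "f c * corner m = f c" "corner m * g d = g d"
      using in_cornerD(2)[OF f[of c]] in_cornerD(1)[OF g[of d]] c d by auto
    have "(up (c * m) * f c * tr (up (c * m))) * (up (d * m) * g d * tr (up (d * m)))
      = (up (c * m) * (f c * corner m) * tr (up (c * m))) * (up (d * m) * (corner m * g d) * tr (up (d * m)))"
      by (simp only: fg)
    also have "\<dots> = up (c * m) * f c * (corner m * (tr (up (c * m)) * up (d * m)) * corner m) * g d * tr (up (d * m))"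
      by (simp only: mult.assoc)
    also have "\<dots> = 0" by (simp add: corner_tr_up_up_corner[OF False[symmetric]])
    finally show ?thesis using False by simp
  qed
  then have "(\<Sum>d<L. (up (c * m) * f c * tr (up (c * m))) * (up (d * m) * g d * tr (up (d * m))))
      = (\<Sum>d<L. if d = c then up (c * m) * (f c * g c) * tr (up (c * m)) else 0)"
    by (intro sum.cong) auto
  then show "(up (c * m) * f c * tr (up (c * m))) * (\<Sum>d<L. up (d * m) * g d * tr (up (d * m)))
      = up (c * m) * (f c * g c) * tr (up (c * m))"
    using c by (simp add: sum_distrib_left)
qed

text \<open>The later blocks are shifted out of the first corner. This yields injectivity of the
  block maps, provided that there is a block at all.\<close>

lemma corner_bsum:
  assumes "0 < L" "in_corner m (f 0)"
  shows "corner m * bsum L m f * corner m = f 0"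
proof -
  have z: "corner m * (up (c * m) * y) = 0" if "c \<noteq> 0" for c and y :: "'a imat"
  proof (rule imat_eqI)
    fix i j
    have "m \<le> c * m" using that by simp
    then have "\<not> c * m \<le> i" if "i < m" using that by linarith
    then show "ent (corner m * (up (c * m) * y)) i j = ent 0 i j"
      by (simp add: ent_corner_mult ent_up_mult)
  qed
  have "corner m * bsum L m f = (\<Sum>c<L. corner m * (up (c * m) * (f c * tr (up (c * m)))))"
    by (simp add: bsum_def sum_distrib_left mult.assoc)
  also have "\<dots> = corner m * (up (0 * m) * (f 0 * tr (up (0 * m))))"
    by (rule sum_only_one) (use assms z in auto)
  finally have "corner m * bsum L m f = corner m * f 0" by simp
  then show ?thesis using in_cornerD[OF assms(2)] by simp
qed

lemma emb_four_block_diag: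
  assumes A: "A \<in> carrier_mat a a" and B: "B \<in> carrier_mat b b"
  shows "emb (four_block_mat A (0\<^sub>m a b) (0\<^sub>m b a) B) = emb A + up a * emb B * tr (up a)"
proof (rule imat_eqI)
  fix i j
  show "ent (emb (four_block_mat A (0\<^sub>m a b) (0\<^sub>m b a) B)) i j = ent (emb A + up a * emb B * tr (up a)) i j"
    using A B by (auto simp: ent_mult_tr_up ent_up_mult)
qed

lemma emb_diag_block_mat:
  assumes "\<And>M. M \<in> set Ms \<Longrightarrow> M \<in> carrier_mat m m"
  shows "emb (diag_block_mat (Ms @ [0\<^sub>m z z])) = bsum (length Ms) m (\<lambda>c. emb (Ms ! c))
    \<and> diag_block_mat (Ms @ [0\<^sub>m z z]) \<in> carrier_mat (length Ms * m + z) (length Ms * m + z)"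
  using assms
proof (induction Ms)
  case Nil
  have "emb (four_block_mat (0\<^sub>m z z) (0\<^sub>m z 0) (0\<^sub>m 0 z) (0\<^sub>m 0 0)) = (0 :: 'a imat)"
    by (subst emb_four_block_diag) auto
  then show ?case by (simp add: bsum_def Let_def)
next
  case (Cons A Ms)
  let ?B = "diag_block_mat (Ms @ [0\<^sub>m z z])"
  let ?b = "length Ms * m + z"
  have A: "A \<in> carrier_mat m m" using Cons.prems by simp
  have B: "?B \<in> carrier_mat ?b ?b" and e: "emb ?B = bsum (length Ms) m (\<lambda>c. emb (Ms ! c))"
    using Cons by auto
  have eq: "diag_block_mat ((A # Ms) @ [0\<^sub>m z z]) = four_block_mat A (0\<^sub>m m ?b) (0\<^sub>m ?b m) ?B"
    using A B by (simp add: Let_def)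
  have "emb (diag_block_mat ((A # Ms) @ [0\<^sub>m z z])) = emb A + up m * bsum (length Ms) m (\<lambda>c. emb (Ms ! c)) * tr (up m)"
    unfolding eq emb_four_block_diag[OF A B] e ..
  also have "up m * bsum (length Ms) m (\<lambda>c. emb (Ms ! c)) * tr (up m)
      = (\<Sum>c<length Ms. (up m * up (c * m)) * emb (Ms ! c) * tr (up m * up (c * m)))"
    by (simp add: bsum_def sum_distrib_left sum_distrib_right tr_mult mult.assoc)
  also have "emb A + \<dots> = bsum (length (A # Ms)) m (\<lambda>c. emb ((A # Ms) ! c))"
    unfolding bsum_def length_Cons sum.lessThan_Suc_shift by (simp add: up_add)
  finally show ?case
    unfolding eq using four_block_carrier_mat[OF A B] by (simp add: add.assoc)
qed

text \<open>One parametrization for both canonical families inside \<open>Full\<close>: with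
  \<open>k = 0\<close> and \<open>X\<close> in \<open>alg Sympl m\<close> it covers type
  \<open>Sympl\<close>.\<close>

definition twist_blk :: "nat \<Rightarrow> nat \<Rightarrow> nat \<Rightarrow> 'a::field mat \<Rightarrow> 'a mat" where
  "twist_blk n l k X = blk n (replicate l X @ replicate k (transpose_mat X))"

lemma twist_blk:
  assumes X: "X \<in> carrier_mat M M" and le: "M * (l + k) \<le> n"
  shows "emb (twist_blk n l k X) = bsum (l + k) M (\<lambda>c. if c < l then emb X else tr (emb X))"
    and "twist_blk n l k X \<in> carrier_mat n n"
proof -
  let ?Ms = "replicate l X @ replicate k (transpose_mat X)"
  have c: "Y \<in> carrier_mat M M" if "Y \<in> set ?Ms" for Y using that X by (auto split: if_splits)
  have s: "sum_list (map dim_row ?Ms) = (l + k) * M" using X by (simp add: sum_list_replicate algebra_simps)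
  have b: "twist_blk n l k X = diag_block_mat (?Ms @ [0\<^sub>m (n - (l + k) * M) (n - (l + k) * M)])"
    unfolding twist_blk_def blk_def Let_def s ..
  have "bsum (l + k) M (\<lambda>c. emb (?Ms ! c)) = bsum (l + k) M (\<lambda>c. if c < l then emb X else tr (emb X))"
    unfolding bsum_def by (intro sum.cong refl) (auto simp: nth_append emb_transpose)
  then show "emb (twist_blk n l k X) = bsum (l + k) M (\<lambda>c. if c < l then emb X else tr (emb X))"
    using emb_diag_block_mat[of ?Ms M "n - (l + k) * M", OF c] unfolding b by simp
  have "(l + k) * M + (n - (l + k) * M) = n" using le by (simp add: mult.commute)
  then show "twist_blk n l k X \<in> carrier_mat n n"
    using emb_diag_block_mat[of ?Ms M "n - (l + k) * M", OF c] unfolding b by simp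
qed

text \<open>Transposition respects the Jordan product, so each block depends on \<open>X\<close> by
  a Jordan homomorphism, and the first block already recovers \<open>X\<close>.\<close>

lemma twist_blk_jiso:
  assumes lk: "0 < l + k" and le: "msize T m * (l + k) \<le> n"
  shows "jiso (alg T m) (twist_blk n l k ` alg T m) (twist_blk n l k)"
proof -
  let ?M = "msize T m" and ?b = "twist_blk n l k :: 'a mat \<Rightarrow> 'a mat"
  let ?t = "\<lambda>x c. if c < l then x else tr (x :: 'a imat)"
  have e: "emb (?b X) = bsum (l + k) ?M (?t (emb X))" and c: "?b X \<in> carrier_mat n n"
    if "X \<in> alg T m" for X :: "'a mat"
    using twist_blk[OF alg_carrier[OF that] le] by auto
  have ic: "in_corner ?M (?t (emb X) c)" if "X \<in> alg T m" for X :: "'a mat" and c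
    using in_corner_emb[OF alg_carrier[OF that]] in_corner_intros(7) by auto
  show ?thesis unfolding jiso_def
  proof (intro conjI ballI allI)
    show "bij_betw ?b (alg T m) (?b ` alg T m)"
    proof (rule inj_on_imp_bij_betw, rule inj_onI)
      fix X Y :: "'a mat" assume X: "X \<in> alg T m" and Y: "Y \<in> alg T m" and "?b X = ?b Y"
      then have eq: "bsum (l + k) ?M (?t (emb X)) = bsum (l + k) ?M (?t (emb Y))"
        by (simp only: e[OF X, symmetric] e[OF Y, symmetric])
      have c0: "corner ?M * bsum (l + k) ?M (?t (emb Z)) * corner ?M = ?t (emb Z) 0"
        if "Z \<in> alg T m" for Z :: "'a mat"
        by (rule corner_bsum[OF lk ic[OF that]])
      have "?t (emb X) 0 = ?t (emb Y) 0"
        unfolding c0[OF X, symmetric] c0[OF Y, symmetric] eq ..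
      then have "emb X = emb Y" by (auto split: if_splits dest: arg_cong[of _ _ tr])
      then show "X = Y" by (rule emb_inj[OF alg_carrier[OF X] alg_carrier[OF Y]])
    qed
    fix X Y :: "'a mat" assume X: "X \<in> alg T m" and Y: "Y \<in> alg T m"
    have t1: "?t (x + y) c = ?t x c + ?t y c" "?t (sc a * x) c = sc a * ?t x c" for x y a c
      by (auto simp: tr_add tr_mult sc_commute)
    have cX: "X \<in> carrier_mat ?M ?M" "Y \<in> carrier_mat ?M ?M" using X Y alg_carrier by auto
    have "emb (?b (X + Y)) = emb (?b X + ?b Y)"
      by (simp only: e[OF alg_closed(1)[OF X Y]] e[OF X] e[OF Y] emb_add[OF c[OF X] c[OF Y]]
          emb_add[OF cX] t1(1) bsum_add)
    then show "?b (X + Y) = ?b X + ?b Y"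
      using c[OF alg_closed(1)[OF X Y]] c[OF X] c[OF Y] by (intro emb_inj[of _ n]) auto
    have t2: "?t (sc (1/2) * (x * y + y * x)) c = sc (1/2) * (?t x c * ?t y c + ?t y c * ?t x c)" for x y c
      by (auto simp: tr_add tr_mult sc_commute add.commute)
    have "emb (?b (jprod X Y)) = emb (jprod (?b X) (?b Y))"
      unfolding e[OF alg_closed(3)[OF X Y]] emb_jprod[OF cX] emb_jprod[OF c[OF X] c[OF Y]] e[OF X] e[OF Y]
      by (simp only: t2 bsum_sc bsum_add bsum_mult[OF ic[OF X] ic[OF Y]] bsum_mult[OF ic[OF Y] ic[OF X]])
    then show "?b (jprod X Y) = jprod (?b X) (?b Y)"
      using c[OF alg_closed(3)[OF X Y]] c[OF X] c[OF Y] by (intro emb_inj[of _ n]) (auto simp: jprod_def)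
  next
    fix a :: 'a and X :: "'a mat" assume X: "X \<in> alg T m"
    have "?t (sc a * x) c = sc a * ?t x c" for x c by (auto simp: tr_mult sc_commute)
    then have "emb (?b (a \<cdot>\<^sub>m X)) = emb (a \<cdot>\<^sub>m ?b X)"
      by (simp only: e[OF alg_closed(2)[OF X]] e[OF X] emb_smult bsum_sc)
    then show "?b (a \<cdot>\<^sub>m X) = a \<cdot>\<^sub>m ?b X"
      using c[OF alg_closed(2)[OF X]] c[OF X] by (intro emb_inj[of _ n]) auto
  qed
qed

text \<open>Each block contributes one diagonal matrix unit to exactly one of the two words: to the
  first if it is a copy of \<open>X\<close>, to the second if it is a copy of the transpose.\<close>

lemma franks_twist_blk:
  assumes m: "3 \<le> m" and le: "m * (l + k) \<le> n"
  shows "franks (lift Full m (twist_blk n l k :: 'a::field mat \<Rightarrow> 'a mat)) l k"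
proof -
  let ?\<phi> = "lift Full m (twist_blk n l k :: 'a mat \<Rightarrow> 'a mat)"
  have ic: "in_corner m (E i j :: 'a imat)" if "i < 2" "j < 2" for i j
    using that m by (intro in_corner_intros) auto
  have e: "?\<phi> (E i j) = bsum (l + k) m (\<lambda>c. if c < l then E i j else E j i)" if "i < 2" "j < 2" for i j
    by (simp add: lift_def twist_blk(1)[OF unemb_carrier(1) le] emb_unemb[OF ic[OF that]] cong: if_cong)
  have p: "?\<phi> (E a b) * ?\<phi> (E c d) * ?\<phi> (E f g)
      = bsum (l + k) m (\<lambda>i. if i < l then E a b * E c d * E f g else E b a * E d c * E g f)"
    if "a < 2" "b < 2" "c < 2" "d < 2" "f < 2" "g < 2" for a b c d f g
  proof -
    let ?F = "\<lambda>a b i. if i < l then E a b else E b a :: 'a imat"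
    have c: "in_corner m (?F a b i)" if "a < 2" "b < 2" for a b i using ic that by simp
    have "?\<phi> (E a b) * ?\<phi> (E c d) = bsum (l + k) m (\<lambda>i. ?F a b i * ?F c d i)"
      unfolding e[OF that(1,2)] e[OF that(3,4)]
      by (rule bsum_mult) (rule c[OF that(1,2)], rule c[OF that(3,4)])
    then have "?\<phi> (E a b) * ?\<phi> (E c d) * ?\<phi> (E f g) = bsum (l + k) m (\<lambda>i. ?F a b i * ?F c d i * ?F f g i)"
      unfolding e[OF that(5,6)]
      using bsum_mult[of "l + k" m "\<lambda>i. ?F a b i * ?F c d i" "?F f g",
          OF in_corner_mult[OF c[OF that(1,2)] c[OF that(3,4)]] c[OF that(5,6)]] by (simp only:)
    also have "\<dots> = bsum (l + k) m (\<lambda>i. if i < l then E a b * E c d * E f g else E b a * E d c * E g f)"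
      unfolding bsum_def by (intro sum.cong refl) auto
    finally show ?thesis .
  qed
  have eq: "bsum (l + k) m (\<lambda>i. if P i then E 0 0 else 0)
      = (\<Sum>i<l + k. if P i then E (i * m) (i * m) else 0 :: 'a imat)" for P
    unfolding bsum_def by (intro sum.cong refl) (auto simp: up_unit)
  have rk: "rk (\<Sum>i<l + k. if P i then E (i * m) (i * m) else 0 :: 'a imat) (\<Sum>i<l + k. if P i then 1 else 0)" for P
    by (rule rk_sum) (use m rk_unit rk_0 in \<open>auto simp: unit_mat_mult\<close>)
  have "?\<phi> (E 0 0) * ?\<phi> (E 0 1) * ?\<phi> (E 1 0) = bsum (l + k) m (\<lambda>i. if i < l then E 0 0 else 0)"
    "?\<phi> (E 0 0) * ?\<phi> (E 1 0) * ?\<phi> (E 0 1) = bsum (l + k) m (\<lambda>i. if \<not> i < l then E 0 0 else 0)"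
    by (subst p; auto simp: unit_mat_mult bsum_def intro!: sum.cong)+
  moreover have "(\<Sum>i<l + k. if i < l then 1 else 0) = l" "(\<Sum>i<l + k. if \<not> i < l then 1 else 0) = k"
  proof -
    have "{..<l + k} \<inter> {i. i < l} = {..<l}" "{..<l + k} \<inter> {i. \<not> i < l} = {l..<l + k}" by auto
    then show "(\<Sum>i<l + k. if i < l then 1 else 0) = l" "(\<Sum>i<l + k. if \<not> i < l then 1 else 0) = k"
      by (simp_all add: sum.If_cases)
  qed
  ultimately show ?thesis unfolding franks_def eq using rk[of "\<lambda>i. i < l"] rk[of "\<lambda>i. \<not> i < l"] by metis
qed

section \<open>The invariant of a subalgebra of type \<open>F_m\<^sup>(\<^sup>+\<^sup>)\<close>\<close>

lemma ialg_E: "i < 2 \<Longrightarrow> j < 2 \<Longrightarrow> 3 \<le> m \<Longrightarrow> (E i j :: 'a::field imat) \<in> ialg Full m"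
  by (auto simp: ialg_def intro: in_corner_intros)

lemma franks_cong:
  fixes \<phi> \<psi> :: "'a::field imat \<Rightarrow> 'a imat"
  assumes "3 \<le> m" "\<And>x. x \<in> ialg Full m \<Longrightarrow> \<phi> x = \<psi> x"
  shows "franks \<phi> l k \<longleftrightarrow> franks \<psi> l k"
proof -
  have "\<phi> (E i j) = \<psi> (E i j)" if "i < 2" "j < 2" for i j
    by (rule assms(2)[OF ialg_E[OF that assms(1)]])
  then show ?thesis by (simp add: franks_def del: One_nat_def)
qed

lemma jordan_hom_tr:
  assumes "jordan_hom T m N \<phi>" shows "jordan_hom T m N (\<lambda>x. tr (\<phi> x))"
proof -
  interpret jordan_hom T m N \<phi> by fact
  have "jhom T m N (\<lambda>x. tr (\<phi> x))" unfolding jhom_def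
    by (simp add: phi_corner phi_add phi_sc phi_jordan tr_add tr_mult sc_commute in_corner_intros(7) add.commute)
  then show ?thesis using char2 m3 by unfold_locales
qed

lemma jiso_zero:
  assumes "jiso (alg T m) J \<theta>" "J \<subseteq> carrier_mat N N"
  shows "emb (\<theta> (0\<^sub>m (msize T m) (msize T m) :: 'a::field mat)) = 0"
proof -
  let ?z = "0\<^sub>m (msize T m) (msize T m) :: 'a mat"
  have z: "?z \<in> alg T m" by (simp add: alg_iff ialg_intros)
  have "(0::'a) \<cdot>\<^sub>m ?z = ?z" by (intro eq_matI) auto
  then have "\<theta> ?z = 0 \<cdot>\<^sub>m \<theta> ?z" using assms(1) z unfolding jiso_def by metis
  then have "emb (\<theta> ?z) = sc 0 * emb (\<theta> ?z)" by (metis emb_smult)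
  then show ?thesis by simp
qed

lemma jiso_one_nonzero:
  assumes \<theta>: "jiso (alg T m) J \<theta>" and J: "J \<subseteq> carrier_mat N N" and m: "0 < m"
  shows "emb (\<theta> (1\<^sub>m (msize T m) :: 'a::field mat)) \<noteq> 0"
proof
  let ?z = "0\<^sub>m (msize T m) (msize T m) :: 'a mat" and ?o = "1\<^sub>m (msize T m) :: 'a mat"
  assume o0: "emb (\<theta> ?o) = 0"
  have z: "?z \<in> alg T m" "?o \<in> alg T m" using alg_closed(4) by (auto simp: alg_iff ialg_intros)
  have c: "\<theta> ?z \<in> carrier_mat N N" "\<theta> ?o \<in> carrier_mat N N"
    using jiso_image[OF \<theta>] J z by blast+
  have "\<theta> ?o = \<theta> ?z" by (rule emb_inj[OF c(2,1)]) (simp add: o0 jiso_zero[OF \<theta> J])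
  then have "?o = ?z" using \<theta> z unfolding jiso_def bij_betw_def inj_on_def by blast
  moreover have "0 < msize T m" using m by (cases T) auto
  ultimately have "?o $$ (0, 0) = ?z $$ (0, 0)" "0 < msize T m" by auto
  then show False by simp
qed

lemma lift_corner: "lift T m \<theta> (corner (msize T m)) = emb (\<theta> (1\<^sub>m (msize T m)))"
  using lift_emb[OF alg_closed(4), of T m \<theta>] by (simp add: emb_one)

text \<open>The image of the identity is nonzero and its rank is a multiple of
  \<open>msize T m\<close>. Applied in both directions, such bounds separate the standard algebras
  from each other.\<close>

lemma jiso_size_not_Full:
  fixes \<theta> :: "'a::field mat \<Rightarrow> 'a mat"
  assumes two: "(2::'a) \<noteq> 0" and m: "3 \<le> m" and \<theta>: "jiso (alg T m) J \<theta>" and J: "J \<subseteq> carrier_mat N N"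
    and T: "T \<noteq> Full"
  shows "msize T m \<le> N"
proof -
  interpret jordan_hom T m N "lift T m \<theta>" by (rule lift_jordan_hom[OF two m \<theta> J])
  obtain r where r: "rk unit_image (msize T m * r)" using ex_rk_not_Full[OF T] by blast
  have "unit_image \<noteq> 0"
    unfolding unit_image_def lift_corner using jiso_one_nonzero[OF \<theta> J] m by simp
  then have "r \<noteq> 0" using r rk_0D[of unit_image] by (cases r) auto
  then have "msize T m \<le> msize T m * r" by simp
  then show ?thesis using rk_le[OF unit_image_corner r] by linarith
qed

lemma jiso_franks:
  fixes \<theta> :: "'a::field mat \<Rightarrow> 'a mat"
  assumes two: "(2::'a) \<noteq> 0" and m: "3 \<le> m" and \<theta>: "jiso (alg Full m) J \<theta>" and J: "J \<subseteq> carrier_mat N N"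
    and f: "franks (lift Full m \<theta>) l k"
  shows "0 < l + k" "m * (l + k) \<le> N"
proof -
  interpret jordan_hom Full m N "lift Full m \<theta>" by (rule lift_jordan_hom[OF two m \<theta> J])
  have r: "rk unit_image (m * (l + k))" by (rule rk_franks[OF refl f])
  have "unit_image \<noteq> 0"
    unfolding unit_image_def lift_corner using jiso_one_nonzero[OF \<theta> J] m by simp
  then show "0 < l + k" using r rk_0D[of unit_image] by (cases "l + k") auto
  show "m * (l + k) \<le> N" by (rule rk_le[OF unit_image_corner r])
qed

lemma jiso_ex_franks:
  fixes \<theta> :: "'a::field mat \<Rightarrow> 'a mat"
  assumes two: "(2::'a) \<noteq> 0" and m: "3 \<le> m" and \<theta>: "jiso (alg Full m) J \<theta>" and J: "J \<subseteq> carrier_mat N N"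
  shows "\<exists>l k. franks (lift Full m \<theta>) l k"
proof -
  interpret jordan_hom Full m N "lift Full m \<theta>" by (rule lift_jordan_hom[OF two m \<theta> J])
  show ?thesis by (rule ex_franks[OF refl])
qed

lemma jiso_size_Full:
  fixes \<theta> :: "'a::field mat \<Rightarrow> 'a mat"
  assumes two: "(2::'a) \<noteq> 0" and m: "3 \<le> m" and \<theta>: "jiso (alg Full m) J \<theta>" and J: "J \<subseteq> carrier_mat N N"
  shows "m \<le> N"
proof -
  obtain l k where f: "franks (lift Full m \<theta>) l k" using jiso_ex_franks[OF assms] by blast
  have "1 \<le> l + k" using jiso_franks(1)[OF assms f] by linarith
  then have "m * 1 \<le> m * (l + k)" by (rule mult_le_mono2)
  then show ?thesis using le_trans[OF _ jiso_franks(2)[OF assms f], of "m * 1"] by simp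
qed

lemma alg_subset_carrier: "alg A n \<subseteq> carrier_mat (msize A n) (msize A n)"
  using alg_carrier by blast

lemma lift_ialg:
  assumes "jiso (alg T m) J \<theta>" "J \<subseteq> alg A n" "x \<in> ialg T m"
  shows "lift T m \<theta> x \<in> ialg A n"
proof -
  have "\<theta> (unemb (msize T m) x) \<in> alg A n"
    using assms jiso_image unemb_alg[OF assms(3)] by blast
  then show ?thesis unfolding lift_def alg_iff by blast
qed

lemma jiso_franks_symmetric:
  fixes \<theta> :: "'a::field mat \<Rightarrow> 'a mat"
  assumes two: "(2::'a) \<noteq> 0" and m: "3 \<le> m" and \<theta>: "jiso (alg Full m) J \<theta>" and J: "J \<subseteq> alg A n"
    and A: "A \<noteq> Full" and f: "franks (lift Full m \<theta>) l k"
  shows "l = k"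
proof -
  have J': "J \<subseteq> carrier_mat (msize A n) (msize A n)" using J alg_subset_carrier by blast
  interpret jordan_hom Full m "msize A n" "lift Full m \<theta>" by (rule lift_jordan_hom[OF two m \<theta> J'])
  show ?thesis by (rule franks_symmetric[OF refl A refl lift_ialg[OF \<theta> J] f])
qed

lemma lift_comp:
  assumes "jiso (alg T m) J \<beta>" "J \<subseteq> alg A n" "x \<in> ialg T m"
  shows "lift T m (\<psi> \<circ> \<beta>) x = lift A n \<psi> (lift T m \<beta> x)"
proof -
  have "\<beta> (unemb (msize T m) x) \<in> alg A n"
    using assms jiso_image unemb_alg[OF assms(3)] by blast
  then show ?thesis using lift_emb[of "\<beta> (unemb (msize T m) x)" A n \<psi>] by (simp add: lift_def)
qed

lemma jaut_lift:
  fixes \<psi> :: "'a::field mat \<Rightarrow> 'a mat"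
  assumes two: "(2::'a) \<noteq> 0" and n: "3 \<le> n" and \<psi>: "jaut (alg A n) \<psi>"
  shows "jordan_hom A n (msize A n) (lift A n \<psi>)" "lift A n \<psi> (corner (msize A n)) = corner (msize A n)"
proof -
  have i: "jiso (alg A n) (alg A n) \<psi>" using \<psi> by (simp add: jaut_def)
  show "jordan_hom A n (msize A n) (lift A n \<psi>)"
    by (rule lift_jordan_hom[OF two n i alg_subset_carrier])
  have "\<psi> (1\<^sub>m (msize A n)) = 1\<^sub>m (msize A n)"
    by (rule jid_unique[OF jid_image[OF i one_jid[OF two]] one_jid[OF two] alg_subset_carrier])
  then show "lift A n \<psi> (corner (msize A n)) = corner (msize A n)"
    by (simp add: lift_corner emb_one)
qed

text \<open>An automorphism of \<open>alg Full m\<close> is a conjugation, which keeps the ordered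
  pair of ranks, or a conjugated transposition, which exchanges its members. Up to order the pair
  thus belongs to \<open>J\<close> and not to the parametrization.\<close>

lemma franks_precomp_aut:
  fixes \<tau> :: "'a::field mat \<Rightarrow> 'a mat"
  assumes two: "(2::'a) \<noteq> 0" and m: "3 \<le> m" and \<tau>: "jaut (alg Full m) \<tau>"
    and \<beta>: "jiso (alg Full m) J \<beta>" and J: "J \<subseteq> carrier_mat N N" and f: "franks (lift Full m \<beta>) l k"
  shows "franks (lift Full m (\<beta> \<circ> \<tau>)) l k \<or> franks (lift Full m (\<beta> \<circ> \<tau>)) k l"
proof -
  have i: "jiso (alg Full m) (alg Full m) \<tau>" using \<tau> by (simp add: jaut_def)
  interpret B: jordan_hom Full m N "lift Full m \<beta>" by (rule lift_jordan_hom[OF two m \<beta> J])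
  note eq = lift_comp[OF i subset_refl, where \<psi> = \<beta>]
  obtain P P' where P: "in_corner m P" "in_corner m P'" "P * P' = corner m" "P' * P = corner m"
    and form: "(\<forall>x\<in>ialg Full m. lift Full m \<tau> x = P * x * P') \<or> (\<forall>x\<in>ialg Full m. lift Full m \<tau> x = P * tr x * P')"
    using automorphism_form[OF jaut_lift[OF two m \<tau>]] by auto
  have g: "franks (\<lambda>x. lift Full m \<beta> (P * x * P')) l k"
    by (rule B.franks_conj_pre[OF refl f P(1,2,4)])
  from form show ?thesis
  proof
    assume a: "\<forall>x\<in>ialg Full m. lift Full m \<tau> x = P * x * P'"
    have "franks (lift Full m (\<beta> \<circ> \<tau>)) l k \<longleftrightarrow> franks (\<lambda>x. lift Full m \<beta> (P * x * P')) l k"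
      by (rule franks_cong[OF m]) (simp add: eq a)
    then show ?thesis using g by simp
  next
    assume a: "\<forall>x\<in>ialg Full m. lift Full m \<tau> x = P * tr x * P'"
    have "franks (lift Full m (\<beta> \<circ> \<tau>)) k l \<longleftrightarrow> franks (\<lambda>x. lift Full m \<beta> (P * tr x * P')) k l"
      by (rule franks_cong[OF m]) (simp add: eq a)
    then show ?thesis using franks_tr_pre[OF g] by simp
  qed
qed

lemma franks_postcomp_aut:
  fixes \<psi> :: "'a::field mat \<Rightarrow> 'a mat"
  assumes two: "(2::'a) \<noteq> 0" and m: "3 \<le> m" and n: "3 \<le> n" and \<psi>: "jaut (alg Full n) \<psi>"
    and \<beta>: "jiso (alg Full m) J \<beta>" and J: "J \<subseteq> carrier_mat n n" and f: "franks (lift Full m \<beta>) l k"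
  shows "franks (lift Full m (\<psi> \<circ> \<beta>)) l k \<or> franks (lift Full m (\<psi> \<circ> \<beta>)) k l"
proof -
  interpret B: jordan_hom Full m n "lift Full m \<beta>" by (rule lift_jordan_hom[OF two m \<beta> J])
  interpret B': jordan_hom Full m n "\<lambda>x. tr (lift Full m \<beta> x)"
    by (rule jordan_hom_tr) (rule B.jordan_hom_axioms)
  have J': "J \<subseteq> alg Full n" using J by simp
  note eq = lift_comp[OF \<beta> J', where \<psi> = \<psi>]
  have il: "lift Full m \<beta> x \<in> ialg Full n" if "x \<in> ialg Full m" for x
    using B.phi_corner[OF that] by (simp add: ialg_def)
  obtain Q R where Q: "Q * R = corner n" "R * Q = corner n"
    and form: "(\<forall>x\<in>ialg Full n. lift Full n \<psi> x = Q * x * R) \<or> (\<forall>x\<in>ialg Full n. lift Full n \<psi> x = Q * tr x * R)"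
    using automorphism_form[OF jaut_lift[OF two n \<psi>]] by auto
  from form show ?thesis
  proof
    assume a: "\<forall>x\<in>ialg Full n. lift Full n \<psi> x = Q * x * R"
    have "franks (lift Full m (\<psi> \<circ> \<beta>)) l k \<longleftrightarrow> franks (\<lambda>x. Q * lift Full m \<beta> x * R) l k"
      by (rule franks_cong[OF m]) (simp add: eq a il)
    then show ?thesis using B.franks_conj_post[OF refl f Q(2)] by simp
  next
    assume a: "\<forall>x\<in>ialg Full n. lift Full n \<psi> x = Q * tr x * R"
    have "franks (lift Full m (\<psi> \<circ> \<beta>)) k l \<longleftrightarrow> franks (\<lambda>x. Q * tr (lift Full m \<beta> x) * R) k l"
      by (rule franks_cong[OF m]) (simp add: eq a il)
    then show ?thesis using B'.franks_conj_post[OF refl B.franks_tr_post[OF refl f] Q(2)] by simp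
  qed
qed

text \<open>Equal ranks give an invertible intertwiner. For \<open>Full\<close> it already induces
  an automorphism; otherwise it is replaced by an isometry, and this is where square roots, hence
  algebraic closedness, enter.\<close>

lemma conj_class_of_ranks:
  fixes \<theta> \<theta>' :: "'a::field mat \<Rightarrow> 'a mat"
  assumes ac: "alg_closed_field TYPE('a)" and two: "(2::'a) \<noteq> 0" and m: "3 \<le> m"
    and \<theta>: "jiso (alg T m) J \<theta>" and J: "J \<subseteq> alg A n"
    and \<theta>': "jiso (alg T m) J' \<theta>'" and J': "jsubalg (alg A n) J'"
    and r1: "T \<noteq> Full \<Longrightarrow> \<exists>s. rk (lift T m \<theta> (corner (msize T m))) s \<and> rk (lift T m \<theta>' (corner (msize T m))) s"
    and r2: "T = Full \<Longrightarrow> \<exists>l k. franks (lift T m \<theta>) l k \<and> franks (lift T m \<theta>') l k"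
  shows "J' \<in> conj_class (alg A n) J"
proof -
  let ?N = "msize A n"
  have J'a: "J' \<subseteq> alg A n" using J' by (simp add: jsubalg_def)
  have cJ: "J \<subseteq> carrier_mat ?N ?N" "J' \<subseteq> carrier_mat ?N ?N" using J J'a alg_subset_carrier by blast+
  note img = lift_ialg[OF \<theta> J] lift_ialg[OF \<theta>' J'a]
  obtain Q R where Q: "in_corner ?N Q" "in_corner ?N R" "Q * R = corner ?N" "R * Q = corner ?N"
    and int: "\<And>x. x \<in> ialg T m \<Longrightarrow> Q * lift T m \<theta> x = lift T m \<theta>' x * Q"
    using jhom_conjugate_rank[OF lift_jordan_hom[OF two m \<theta> cJ(1)] lift_jordan_hom[OF two m \<theta>' cJ(2)] r1 r2]
    by blast
  show ?thesis
  proof (cases "A = Full")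
    case True
    show ?thesis by (rule conj_class_lift[OF \<theta> \<theta>' J J' Q int]) (use True in auto)
  next
    case False
    obtain U where U: "in_corner ?N U" "U * star A n U = corner ?N" "star A n U * U = corner ?N"
      and int: "\<forall>x\<in>ialg T m. U * lift T m \<theta> x = lift T m \<theta>' x * U"
      using isometric_intertwiner[OF ac two Q, of "ialg T m" "lift T m \<theta>" "lift T m \<theta>'", OF int img False] by blast
    show ?thesis
      by (rule conj_class_lift[OF \<theta> \<theta>' J J' U(1) in_corner_star[OF U(1)] U(2,3)]) (use int in auto)
  qed
qed

lemma jiso_two_elements:
  assumes "jiso (alg T m) J \<theta>" "J \<subseteq> carrier_mat N N" "0 < m" "J \<subseteq> {M}"
  shows False
proof -
  have "0\<^sub>m (msize T m) (msize T m) \<in> alg T m" "1\<^sub>m (msize T m) \<in> alg T m"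
    using alg_closed(4) by (auto simp: alg_iff ialg_intros)
  then have "\<theta> (0\<^sub>m (msize T m) (msize T m)) = M" "\<theta> (1\<^sub>m (msize T m)) = M"
    using assms(4) jiso_image[OF assms(1)] by blast+
  then show False using jiso_zero[OF assms(1,2)] jiso_one_nonzero[OF assms(1-3)] by simp
qed

text \<open>The canonical form with multiplicities \<open>l\<close> and \<open>k\<close> has the
  same ranks as \<open>J\<close> and is therefore equivalent to it. Conversely, any canonical form
  equivalent to \<open>J\<close> must have type \<open>Full\<close>, size \<open>m\<close> and the
  same two multiplicities up to order.\<close>

lemma kinv_Full:
  fixes \<theta> :: "'a::field mat \<Rightarrow> 'a mat"
  assumes ac: "alg_closed_field TYPE('a)" and two: "(2::'a) \<noteq> 0" and m: "3 \<le> m" and n: "3 \<le> n"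
    and J: "jsubalg (alg Full n) J" and \<theta>: "jiso (alg Full m) J \<theta>" and f: "franks (lift Full m \<theta>) l k"
  shows "kinv Full n J = nat \<bar>int l - int k\<bar>"
  unfolding kinv_def
proof (rule the_equality)
  have Jc: "J \<subseteq> carrier_mat n n" using J by (simp add: jsubalg_def)
  note lk = jiso_franks[OF two m \<theta> Jc f]
  have canon: "canon Full Full n m' l' k' = twist_blk n l' k' ` (alg Full m' :: 'a mat set)"
    if "m' * (l' + k') \<le> n" for m' l' k'
    using that by (auto simp: twist_blk_def image_def)
  have tw: "jiso (alg Full m) (canon Full Full n m l k) (twist_blk n l k :: 'a mat \<Rightarrow> 'a mat)"
    unfolding canon[OF lk(2)] by (rule twist_blk_jiso) (use lk in auto)
  have "canon Full Full n m l k \<subseteq> (alg Full n :: 'a mat set)"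
    unfolding canon[OF lk(2)] using twist_blk(2)[of _ m l k n] lk(2) by auto
  then have "J \<in> conj_class (alg Full n) (canon Full Full n m l k)"
    by (rule conj_class_of_ranks[OF ac two m tw _ \<theta> J]) (use franks_twist_blk[OF m lk(2)] f in auto)
  then show "\<exists>T m l' k'. J \<in> conj_class (alg Full n) (canon Full T n m l' k')
      \<and> nat \<bar>int l - int k\<bar> = nat \<bar>int l' - int k'\<bar>" by blast
next
  have Jc: "J \<subseteq> carrier_mat n n" using J by (simp add: jsubalg_def)
  have Jne: "J \<noteq> {}" using J by (simp add: jsubalg_def)
  fix d assume "\<exists>T m l k. J \<in> conj_class (alg Full n) (canon Full T n m l k) \<and> d = nat \<bar>int l - int k\<bar>"
  then obtain T' m' l' k' \<psi> where \<psi>: "jaut (alg Full n) \<psi>" and J\<psi>: "\<psi> ` canon Full T' n m' l' k' = J"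
    and d: "d = nat \<bar>int l' - int k'\<bar>"
    unfolding conj_class_def by blast
  have sub: "jsubalg (alg Full m) (alg Full m :: 'a mat set)" by (rule jsubalg_alg)
  have parametrize: "\<exists>\<beta>. \<beta> = twist_blk n l' k' \<and> jiso (alg T' m') J (\<psi> \<circ> \<beta>) \<and> jiso (alg T' m') (\<beta> ` alg T' m') \<beta>
      \<and> \<beta> ` alg T' m' \<subseteq> carrier_mat n n"
    if le: "msize T' m' * (l' + k') \<le> n" and c: "canon Full T' n m' l' k' = twist_blk n l' k' ` (alg T' m' :: 'a mat set)"
  proof -
    let ?\<beta> = "twist_blk n l' k' :: 'a mat \<Rightarrow> 'a mat"
    have car: "?\<beta> ` alg T' m' \<subseteq> carrier_mat n n" using twist_blk(2)[OF alg_carrier le] by auto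
    \<comment> \<open>Without blocks the canonical set consists of one matrix, and so would
      \<open>J\<close>, which contains the distinct images of zero and one.\<close>
    have "0 < l' + k'"
    proof (rule ccontr)
      assume "\<not> 0 < l' + k'"
      then have lk0: "l' = 0" "k' = 0" by auto
      have "J = \<psi> ` ?\<beta> ` alg T' m'" using J\<psi> c by simp
      then have "J \<subseteq> {\<psi> (blk n [])}" using lk0 by (auto simp: twist_blk_def)
      then show False using jiso_two_elements[OF \<theta> Jc] m by auto
    qed
    then have j: "jiso (alg T' m') (?\<beta> ` alg T' m') ?\<beta>" by (rule twist_blk_jiso[OF _ le])
    have "jiso (?\<beta> ` alg T' m') (\<psi> ` ?\<beta> ` alg T' m') \<psi>"
      using \<psi> car unfolding jaut_def by (intro jiso_restrict[where S = "alg Full n"]) auto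
    then have "jiso (alg T' m') J (\<psi> \<circ> ?\<beta>)" using jiso_trans[OF j] J\<psi> c by auto
    then show ?thesis using j car by blast
  qed
  consider "T' = Sym" | "T' = Full" | "T' = Sympl" by (cases T') auto
  then show "d = nat \<bar>int l - int k\<bar>"
  proof cases
    case 1
    \<comment> \<open>For type \<open>Sym\<close> inside \<open>Full\<close> the set
      \<open>canon\<close> is empty, whereas \<open>J\<close> is not.\<close>
    then show ?thesis using J\<psi> Jne by simp
  next
    case 2
    have le: "m' * (l' + k') \<le> n" using J\<psi> Jne 2 by (auto split: if_splits)
    have c: "canon Full T' n m' l' k' = twist_blk n l' k' ` (alg T' m' :: 'a mat set)"
      using 2 le by (auto simp: twist_blk_def image_def)
    obtain \<beta> where b: "\<beta> = twist_blk n l' k'" and \<theta>': "jiso (alg Full m') J (\<psi> \<circ> \<beta>)"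
      and \<beta>: "jiso (alg Full m') (\<beta> ` alg Full m') \<beta>" "\<beta> ` alg Full m' \<subseteq> carrier_mat n n"
      using parametrize[OF _ c] le 2 by auto
    have inv: "jiso J (alg Full m') (inv_into (alg Full m') (\<psi> \<circ> \<beta>))"
      by (rule jiso_sym[OF \<theta>' jsubalg_alg])
    define \<tau> where "\<tau> = inv_into (alg Full m') (\<psi> \<circ> \<beta>) \<circ> \<theta>"
    have \<tau>: "jiso (alg Full m) (alg Full m') \<tau>" unfolding \<tau>_def by (rule jiso_trans[OF \<theta> inv])
    \<comment> \<open>The rank bound, applied to \<open>\<tau>\<close> and to its inverse, forces
      isomorphic algebras to have the same size.\<close>
    have "m \<le> m'" using jiso_size_Full[OF two m \<tau>, of m'] by simp
    moreover from this have "m' \<le> m"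
      using jiso_size_Full[OF two _ jiso_sym[OF \<tau> sub], of m] m by simp
    ultimately have mm: "m' = m" by simp
    have aut: "jaut (alg Full m) \<tau>" using \<tau> mm by (simp add: jaut_def)
    note \<beta>' = \<beta>[unfolded mm]
    have fb: "franks (lift Full m \<beta>) l' k'" using franks_twist_blk[OF m] le mm b by simp
    have bt: "jiso (alg Full m) (\<beta> ` alg Full m) (\<beta> \<circ> \<tau>)"
      using jiso_trans[OF \<tau> \<beta>(1)] mm by simp
    \<comment> \<open>The change of parametrization by \<open>\<tau>\<close> and the change of
      position by \<open>\<psi>\<close> each preserve the pair of ranks up to order.\<close>
    have "franks (lift Full m (\<psi> \<circ> (\<beta> \<circ> \<tau>))) l' k' \<or> franks (lift Full m (\<psi> \<circ> (\<beta> \<circ> \<tau>))) k' l'"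
      using franks_precomp_aut[OF two m aut \<beta>' fb] franks_postcomp_aut[OF two m n \<psi> bt \<beta>'(2)] by blast
    moreover have "lift Full m (\<psi> \<circ> (\<beta> \<circ> \<tau>)) x = lift Full m \<theta> x" if "x \<in> ialg Full m" for x
    proof -
      let ?X = "unemb m x"
      have "\<theta> ?X \<in> J" using jiso_image[OF \<theta>] unemb_alg[OF that] by auto
      then have "\<theta> ?X \<in> (\<psi> \<circ> \<beta>) ` alg Full m'" using jiso_image[OF \<theta>'] by simp
      then have "(\<psi> \<circ> \<beta>) (\<tau> ?X) = \<theta> ?X" unfolding \<tau>_def comp_apply[of "inv_into _ _"] by (rule f_inv_into_f)
      then show ?thesis by (simp add: lift_def)
    qed
    ultimately have "franks (lift Full m \<theta>) l' k' \<or> franks (lift Full m \<theta>) k' l'"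
      using franks_cong[OF m, of "lift Full m (\<psi> \<circ> (\<beta> \<circ> \<tau>))" "lift Full m \<theta>"] by blast
    then have "(l' = l \<and> k' = k) \<or> (k' = l \<and> l' = k)" using franks_unique f by blast
    then show ?thesis using d by auto
  next
    case 3
    have le: "2 * m' * l' \<le> n" "k' = 0" using J\<psi> Jne 3 by (auto split: if_splits)
    have c: "canon Full T' n m' l' k' = twist_blk n l' k' ` (alg T' m' :: 'a mat set)"
      using 3 le by (auto simp: twist_blk_def image_def)
    have \<theta>': "jiso (alg Sympl m') J (\<psi> \<circ> twist_blk n l' k')"
      using parametrize[OF _ c] le 3 by auto
    have \<tau>: "jiso (alg Full m) (alg Sympl m') (inv_into (alg Sympl m') (\<psi> \<circ> twist_blk n l' k') \<circ> \<theta>)"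
      by (rule jiso_trans[OF \<theta> jiso_sym[OF \<theta>' jsubalg_alg]])
    have car: "alg Sympl m' \<subseteq> carrier_mat (2 * m') (2 * m')" using alg_subset_carrier[of Sympl m'] by simp
    obtain a b where ab: "franks (lift Full m (inv_into (alg Sympl m') (\<psi> \<circ> twist_blk n l' k') \<circ> \<theta>)) a b"
      using jiso_ex_franks[OF two m \<tau> car] by blast
    \<comment> \<open>Inside \<open>alg Sympl m'\<close> both multiplicities agree and are positive,
      so \<open>2 * m * a\<close> is at most \<open>2 * m'\<close>; the inverse isomorphism forces
      \<open>2 * m' \<le> m\<close>, a contradiction.\<close>
    have "a = b" by (rule jiso_franks_symmetric[OF two m \<tau> subset_refl _ ab]) simp
    then have "m * (2 * a) \<le> 2 * m'" "0 < a" using jiso_franks[OF two m \<tau> car ab] by (auto simp: mult_2)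
    then have "m * a \<le> m'" "m \<le> m * a" by auto
    then have "m \<le> m'" by linarith
    moreover from this have "2 * m' \<le> m"
      using jiso_size_not_Full[OF two _ jiso_sym[OF \<tau> sub], of m] m by auto
    ultimately show ?thesis using m by simp
  qed
qed

section \<open>Conjugacy classes of simple subalgebras\<close>

lemma conj_class_trans:
  assumes "jaut S \<psi>" "\<psi> ` J = J'" "jsubalg S J'" "J \<in> conj_class S K"
  shows "J' \<in> conj_class S K"
proof -
  obtain \<chi> where \<chi>: "jaut S \<chi>" "\<chi> ` K = J" using assms(4) by (auto simp: conj_class_def)
  have "jaut S (\<psi> \<circ> \<chi>)" using jiso_trans[of S S \<chi> S \<psi>] \<chi>(1) assms(1) by (simp add: jaut_def)
  moreover have "(\<psi> \<circ> \<chi>) ` K = J'" using \<chi>(2) assms(2) by (metis image_comp)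
  ultimately show ?thesis using assms(3) by (auto simp: conj_class_def)
qed

lemma conj_class_sym:
  assumes "jsubalg S S" "jsubalg S J" "J' \<in> conj_class S J"
  shows "J \<in> conj_class S J'"
proof -
  obtain \<psi> where \<psi>: "jaut S \<psi>" "\<psi> ` J = J'" using assms(3) by (auto simp: conj_class_def)
  have i: "jaut S (inv_into S \<psi>)" using jiso_sym[OF _ assms(1)] \<psi>(1) by (simp add: jaut_def)
  have "inj_on \<psi> S" "J \<subseteq> S" using \<psi>(1) assms(2) by (auto simp: jaut_def jiso_def bij_betw_def jsubalg_def)
  then have "inv_into S \<psi> ` J' = J" unfolding \<psi>(2)[symmetric] by (rule inv_into_image_cancel)
  then show ?thesis using i assms(2) by (auto simp: conj_class_def)
qed

text \<open>Equivalent subalgebras satisfy the same instances of the defining predicate, so the two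
  descriptions coincide whether or not they single out a number.\<close>

lemma kinv_conj_class:
  assumes "jsubalg (alg A n) J" "J' \<in> conj_class (alg A n) J"
  shows "kinv A n J' = kinv A n J"
proof -
  have J: "J \<in> conj_class (alg A n) J'" by (rule conj_class_sym[OF jsubalg_alg assms])
  have "J' \<in> conj_class (alg A n) K \<longleftrightarrow> J \<in> conj_class (alg A n) K" for K
  proof
    obtain \<psi> where "jaut (alg A n) \<psi>" "\<psi> ` J' = J" using J by (auto simp: conj_class_def)
    then show "J' \<in> conj_class (alg A n) K \<Longrightarrow> J \<in> conj_class (alg A n) K"
      by (rule conj_class_trans[OF _ _ assms(1)])
    obtain \<psi> where "jaut (alg A n) \<psi>" "\<psi> ` J = J'" "jsubalg (alg A n) J'"
      using assms(2) by (auto simp: conj_class_def)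
    then show "J \<in> conj_class (alg A n) K \<Longrightarrow> J' \<in> conj_class (alg A n) K"
      by (rule conj_class_trans)
  qed
  then show ?thesis by (simp add: kinv_def)
qed

text \<open>The identity of \<open>J'\<close> is the image of that of \<open>J\<close>, and
  automorphisms of the ambient algebra preserve the ranks of idempotents.\<close>

lemma mrank_conj_class:
  fixes J J' :: "'a::field mat set"
  assumes two: "(2::'a) \<noteq> 0" and n: "3 \<le> n" and J: "jsubalg (alg A n) J"
    and J': "J' \<in> conj_class (alg A n) J" and e: "is_jid J e" "is_jid J' e'"
  shows "mrank e = mrank e'"
proof -
  let ?N = "msize A n"
  obtain \<psi> where \<psi>: "jaut (alg A n) \<psi>" "\<psi> ` J = J'" and J'a: "J' \<subseteq> alg A n"
    using J' by (auto simp: conj_class_def jsubalg_def)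
  have Ja: "J \<subseteq> alg A n" using J by (simp add: jsubalg_def)
  have i: "jiso J J' \<psi>" using jiso_restrict[OF _ Ja] \<psi> by (auto simp: jaut_def)
  have c: "J \<subseteq> carrier_mat ?N ?N" "J' \<subseteq> carrier_mat ?N ?N" using Ja J'a alg_subset_carrier by blast+
  have e': "e' = \<psi> e" by (rule jid_unique[OF e(2) jid_image[OF i e(1)] c(2)])
  have ea: "e \<in> alg A n" "e' \<in> alg A n" using e Ja J'a by (auto simp: is_jid_def)
  have "rk (emb e) (mrank e)" by (rule rk_mrank[OF alg_carrier[OF ea(1)] jid_idem[OF two e(1) c(1)]])
  then have "rk (lift A n \<psi> (emb e)) (mrank e)"
    using ea(1) by (intro automorphism_rk[OF jaut_lift[OF two n \<psi>(1)]]) (auto simp: alg_iff)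
  then have "rk (emb e') (mrank e)" using lift_emb[OF ea(1), of \<psi>] e' by simp
  moreover have "rk (emb e') (mrank e')" by (rule rk_mrank[OF alg_carrier[OF ea(2)] jid_idem[OF two e(2) c(2)]])
  ultimately show ?thesis by (rule rk_unique)
qed

theorem theorem2p9:
  fixes J J' :: "'a::field mat set" and e e' :: "'a mat"
    and A T :: jkind and n m :: nat
  assumes "alg_closed_field TYPE('a)"
    and "(2::'a) \<noteq> 0"
    and "n \<ge> 3"
    and "jsubalg (alg A n) J" and "J \<noteq> alg A n"
    and "jsubalg (alg A n) J'" and "J' \<noteq> alg A n"
    and "m \<ge> 3"
    and "jisomorphic J (alg T m)" and "jisomorphic J' (alg T m)"
    and "is_jid J e" and "is_jid J' e'"
  shows "J' \<in> conj_class (alg A n) J \<longleftrightarrow>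
           (mrank e = mrank e' \<and>
            ((T = Full \<or> T = Sympl) \<and> m < n \<and> (A = Full \<or> A = Sympl)
               \<longrightarrow> kinv A n J = kinv A n J'))"
proof
  assume "J' \<in> conj_class (alg A n) J"
  then show "mrank e = mrank e' \<and>
      ((T = Full \<or> T = Sympl) \<and> m < n \<and> (A = Full \<or> A = Sympl) \<longrightarrow> kinv A n J = kinv A n J')"
    using mrank_conj_class[OF assms(2,3,4) _ assms(11,12)] kinv_conj_class[OF assms(4)] by auto
next
  assume r: "mrank e = mrank e' \<and>
      ((T = Full \<or> T = Sympl) \<and> m < n \<and> (A = Full \<or> A = Sympl) \<longrightarrow> kinv A n J = kinv A n J')"
  note two = assms(2) and n = assms(3) and m = assms(8)
  let ?N = "msize A n" and ?one = "1\<^sub>m (msize T m) :: 'a mat"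
  have Ja: "J \<subseteq> alg A n" "J' \<subseteq> alg A n" using assms(4,6) by (auto simp: jsubalg_def)
  have Jc: "J \<subseteq> carrier_mat ?N ?N" "J' \<subseteq> carrier_mat ?N ?N" using Ja alg_subset_carrier by blast+
  obtain \<theta> where \<theta>: "jiso (alg T m) J \<theta>" using assms(4,9) jiso_sym unfolding jisomorphic_def by blast
  obtain \<theta>' where \<theta>': "jiso (alg T m) J' \<theta>'" using assms(6,10) jiso_sym unfolding jisomorphic_def by blast
  have e: "e = \<theta> ?one" "e' = \<theta>' ?one"
    using jid_unique[OF assms(11) jid_image[OF \<theta> one_jid[OF two]] Jc(1)]
      jid_unique[OF assms(12) jid_image[OF \<theta>' one_jid[OF two]] Jc(2)] .
  have ea: "e \<in> carrier_mat ?N ?N" "e' \<in> carrier_mat ?N ?N"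
    using assms(11,12) Jc by (auto simp: is_jid_def)
  have rk: "rk (lift T m \<theta> (corner (msize T m))) (mrank e)" "rk (lift T m \<theta>' (corner (msize T m))) (mrank e)"
    unfolding lift_corner e[symmetric]
    using rk_mrank[OF ea(1) jid_idem[OF two assms(11) Jc(1)]] rk_mrank[OF ea(2) jid_idem[OF two assms(12) Jc(2)]] r
    by simp_all
  show "J' \<in> conj_class (alg A n) J"
  proof (cases "T = Full")
    case False
    \<comment> \<open>All base idempotents are equivalent for this type, so the rank of the identity
      decides.\<close>
    show ?thesis
      by (rule conj_class_of_ranks[OF assms(1) two m \<theta> Ja(1) \<theta>' assms(6)]) (use rk False in auto)
  next
    case True
    note \<theta>F = \<theta>[unfolded True] and \<theta>'F = \<theta>'[unfolded True]
    obtain l k where f: "franks (lift Full m \<theta>) l k" using jiso_ex_franks[OF two m \<theta>F Jc(1)] by blast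
    obtain l' k' where f': "franks (lift Full m \<theta>') l' k'" using jiso_ex_franks[OF two m \<theta>'F Jc(2)] by blast
    interpret B: jordan_hom Full m ?N "lift Full m \<theta>" by (rule lift_jordan_hom[OF two m \<theta>F Jc(1)])
    interpret B': jordan_hom Full m ?N "lift Full m \<theta>'" by (rule lift_jordan_hom[OF two m \<theta>'F Jc(2)])
    \<comment> \<open>The rank of the identity fixes the total multiplicity; what remains is how it
      is distributed over the two parts.\<close>
    have "m * (l + k) = mrank e"
      using B.rk_franks[OF refl f] rk(1) True rk_unique unfolding B.unit_image_def by metis
    moreover have "m * (l' + k') = mrank e"
      using B'.rk_franks[OF refl f'] rk(2) True rk_unique unfolding B'.unit_image_def by metis
    ultimately have "m * (l + k) = m * (l' + k')" by simp
    then have sum: "l + k = l' + k'" using m by simp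
    have "l = l' \<and> k = k' \<or> l = k' \<and> k = l'"
    proof (cases "A = Full")
      case False
      \<comment> \<open>The involution of the ambient algebra equates the two multiplicities, so the
        total determines both.\<close>
      have "l = k" by (rule jiso_franks_symmetric[OF two m \<theta>F Ja(1) False f])
      moreover have "l' = k'" by (rule jiso_franks_symmetric[OF two m \<theta>'F Ja(2) False f'])
      ultimately show ?thesis using sum by simp
    next
      case A: True
      note J = assms(4)[unfolded A] and J' = assms(6)[unfolded A]
      have "nat \<bar>int l - int k\<bar> = nat \<bar>int l' - int k'\<bar>"
      proof (cases "m < n")
        case True
        then have "kinv Full n J = kinv Full n J'" using r \<open>T = Full\<close> A by auto
        then show ?thesis
          using kinv_Full[OF assms(1) two m n J \<theta>F f] kinv_Full[OF assms(1) two m n J' \<theta>'F f'] by simp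
      next
        case False
        \<comment> \<open>Condition (2) is silent for \<open>n \<le> m\<close>; but then at most one
          block fits, so the absolute difference of the multiplicities equals their total.\<close>
        have "m * (l + k) \<le> n" using jiso_franks(2)[OF two m \<theta>F Jc(1) f] A by simp
        also have "\<dots> \<le> m * 1" using False by simp
        finally have "l + k \<le> 1" using m by simp
        then have "(l = 0 \<or> k = 0) \<and> (l' = 0 \<or> k' = 0)" using sum by auto
        then show ?thesis using sum by auto
      qed
      then show ?thesis using sum by linarith
    qed
    then show ?thesis
    proof
      assume "l = l' \<and> k = k'"
      then show ?thesis
        by (intro conj_class_of_ranks[OF assms(1) two m \<theta> Ja(1) \<theta>' assms(6)]) (use True f f' in auto)
    next
      assume sw: "l = k' \<and> k = l'"
      \<comment> \<open>The parametrization of \<open>J'\<close> is changed, not \<open>J'\<close>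
        itself: precomposition with the transpose exchanges the two ranks.\<close>
      have t: "jiso (alg Full m) (alg Full m) (transpose_mat :: 'a mat \<Rightarrow> 'a mat)"
        unfolding jiso_def
      proof (intro conjI ballI allI)
        show "bij_betw transpose_mat (alg Full m) (alg Full m :: 'a mat set)"
          by (rule bij_betw_byWitness[where f' = transpose_mat]) auto
        fix X Y :: "'a mat" assume "X \<in> alg Full m" "Y \<in> alg Full m"
        then have XY: "X \<in> carrier_mat m m" "Y \<in> carrier_mat m m" by auto
        show "transpose_mat (X + Y) = transpose_mat X + transpose_mat Y" by (rule transpose_add[OF XY])
        show "transpose_mat (jprod X Y) = jprod (transpose_mat X) (transpose_mat Y)"
          using XY by (intro emb_inj[of _ m])
            (auto simp: jprod_def emb_smult emb_transpose tr_mult tr_add emb_add[of _ m m] emb_mult[of _ m m] sc_commute add.commute)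
      qed (auto intro: eq_matI)
      have \<theta>t: "jiso (alg Full m) J' (\<theta>' \<circ> transpose_mat)" by (rule jiso_trans[OF t \<theta>'F])
      have "lift Full m (\<theta>' \<circ> transpose_mat) x = lift Full m \<theta>' (tr x)" for x
      proof -
        have "transpose_mat (unemb m x) = unemb m (tr x)" by (rule eq_matI) (auto simp: unemb_def)
        then show ?thesis by (simp add: lift_def)
      qed
      then have "lift Full m (\<theta>' \<circ> transpose_mat) = (\<lambda>x. lift Full m \<theta>' (tr x))" by (rule ext)
      then have "franks (lift Full m (\<theta>' \<circ> transpose_mat)) l k" using franks_tr_pre[OF f'] sw by simp
      then show ?thesis
        by (intro conj_class_of_ranks[OF assms(1) two m \<theta>F Ja(1) \<theta>t assms(6)]) (use f in auto)
    qed
  qed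
qed

end
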